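(* Let $m\ge 1$ be an integer, let $t,t_0,t_1,t_2,s_1,\ldots,s_{m+1},u_1,\ldots,u_{m+1}$ be complex parameters of absolute value less than $1$ such that $|pq|<|t^2\prod_{k=1}^ms_k^2\,t_0t_1t_2|$, $|pq|<|t^2\prod_{l=k}^{m}s_l^2\,u_k|$ for every $k=1,\ldots,m$, and $|pq|<|t^2s_{m+1}^2u_{m+1}|$, and let $w\in\mathbb{T}$. Then $$\int_{\mathbb{T}}\frac{\Gamma(s_{m+1}w^\pm x^\pm,\,u_{m+1}x^\pm)}{\Gamma(x^{\pm2},\,t^2s_{m+1}^2u_{m+1}x^\pm)}\prod_{k=1}^m\frac{\Gamma(t\prod_{l=k+1}^ms_l\,u_kx^\pm)}{\Gamma(t\prod_{l=k+1}^ms_l\,s_k^2u_kx^\pm)}\cdot\frac{\prod_{r=0}^2\Gamma(t\prod_{k=1}^ms_k\,t_rx^\pm)}{\Gamma(t\prod_{k=1}^ms_k\,t_0t_1t_2x^\pm)}\,\frac{dx}{x}$$ $$=\frac{\kappa^m\,\Gamma(s_{m+1}^2,\,t^2,\,s_{m+1}u_{m+1}w^\pm)}{\Gamma(t^2s_{m+1}^2,\,t^2\prod_{k=1}^ms_k^2,\,t^2s_{m+1}u_{m+1}w^\pm)}\prod_{k=1}^m\frac{\Gamma(\prod_{l=k}^ms_l^2\,t^2)}{\Gamma(s_k^2,\,\prod_{l=k+1}^ms_l^2\,t^2)}\prod_{0\leq r<j\leq 2}\frac{\Gamma(t^2\prod_{k=1}^ms_k^2\,t_rt_j)}{\Gamma(t_rt_j)}$$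 $$\times\int_{\mathbb{T}^{m+1}}\frac{\Gamma(ts_{m+1}w^\pm x_{m+1}^\pm,\,tu_{m+1}x_{m+1}^\pm)\prod_{r=0}^2\Gamma(t_rx_1^\pm)}{\Gamma(ts_{m+1}^2u_{m+1}x_{m+1}^\pm,\,x_1^{\pm 2},\,t^2\prod_{k=1}^ms_k^2\,t_0t_1t_2x_1^\pm)}\prod_{k=1}^m\frac{\Gamma(u_kx_{k+1}^\pm,\,\prod_{l=k+1}^ms_l^2\,t^2s_ku_kx_k^\pm,\,s_kx_{k+1}^\pm x_k^\pm)}{\Gamma(x_{k+1}^{\pm2},\,\prod_{l=k}^ms_l^2\,t^2u_kx_{k+1}^\pm,\,s_ku_kx_k^\pm)}\,\frac{dx_1}{x_1}\cdots\frac{dx_{m+1}}{x_{m+1}}.$$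
   Context: $\mathbb{T}$ is the positively oriented unit circle in $\mathbb{C}$; $q,p$ are fixed complex numbers with $|q|,|p|<1$. The elliptic gamma function is $$\Gamma(z)=\Gamma(z;q,p)=\prod_{j,k=0}^\infty\frac{1-z^{-1}q^{j+1}p^{k+1}}{1-zq^jp^k}.$$ Conventions: $\Gamma(a_1,\ldots,a_n)=\prod_{r=1}^n\Gamma(a_r;q,p)$; $\Gamma(az^\pm)=\Gamma(az,az^{-1})$; $\Gamma(z^{\pm2})=\Gamma(z^2,z^{-2})$; $\Gamma(az^\pm x^\pm)=\Gamma(azx,azx^{-1},az^{-1}x,az^{-1}x^{-1})$. An entry carrying $\pm$ signs inside a list of arguments is expanded in this way. The function $1/\Gamma(z^{\pm2})$ is understood as its holomorphic extension to $\mathbb{C}\setminus\{0\}$. Empty products equal $1$. Also $(q;q)_\infty=\prod_{n=1}^\infty(1-q^n)$, $(p;p)_\infty=\prod_{n=1}^\infty(1-p^n)$ and $$\kappa=\frac{(p;p)_\infty(q;q)_\infty}{4\pi i}.$$ In expressions such as $\Gamma(t\prod_{l=k+1}^ms_l\,s_k^2u_kx^\pm)$ or $\Gamma(\prod_{l=k}^ms_l^2\,t^2u_kx_{k+1}^\pm)$ the product over $l$ (or $k$) applies only to the factor $s_l$, $s_l^2$ (or $s_k$, $s_k^2$) immediately following it; the remaining factors are outside the product. *)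

theory Defs
  imports "HOL-Complex_Analysis.Complex_Analysis"
begin

(* The factor at a pole z * q^j * p^k = 1 is a division by zero, hence 0, so this total function
   takes the value 0 at its poles. Consequently 1 / ell_gamma q p z is 0 there as well, which is
   the value of the holomorphic extension of 1 / \<Gamma>; on the unit circle this is what gives
   1 / \<Gamma>(z^2, z^(-2)) its intended value 0 at z = 1 and z = -1. *)
definition ell_gamma :: "complex \<Rightarrow> complex \<Rightarrow> complex \<Rightarrow> complex" where
  "ell_gamma q p z =
     (\<Prod>j. \<Prod>k. (1 - inverse z * q ^ (j + 1) * p ^ (k + 1)) / (1 - z * q ^ j * p ^ k))"

definition ell_gammas :: "complex \<Rightarrow> complex \<Rightarrow> complex list \<Rightarrow> complex" where
  "ell_gammas q p as = (\<Prod>a\<leftarrow>as. ell_gamma q p a)"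

(* The argument lists abbreviated by a x^{+-} and a z^{+-} x^{+-}. *)
definition pm :: "complex \<Rightarrow> complex \<Rightarrow> complex list" where
  "pm a x = [a * x, a * inverse x]"

definition pm2 :: "complex \<Rightarrow> complex \<Rightarrow> complex \<Rightarrow> complex list" where
  "pm2 a z x =
     [a * z * x, a * z * inverse x, a * inverse z * x, a * inverse z * inverse x]"

definition euler_prod :: "complex \<Rightarrow> complex" where
  "euler_prod q = (\<Prod>n. 1 - q ^ (n + 1))"

definition kappa :: "complex \<Rightarrow> complex \<Rightarrow> complex" where
  "kappa q p = euler_prod p * euler_prod q / (4 * of_real pi * \<i>)"

(* The n-fold integral of F(x_1, ..., x_n) dx_1/x_1 ... dx_n/x_n over the n-th power of the
   positively oriented unit circle, as an iterated contour integral (x_n innermost). A point of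
   the torus is given by the values of x at 1, ..., n; the other values of x are irrelevant. *)
primrec torus_integral :: "nat \<Rightarrow> ((nat \<Rightarrow> complex) \<Rightarrow> complex) \<Rightarrow> complex" where
  "torus_integral 0 F = F (\<lambda>_. 0)"
| "torus_integral (Suc n) F =
     torus_integral n (\<lambda>x. contour_integral (circlepath 0 1) (\<lambda>z. F (x(Suc n := z)) / z))"

end

theory Submission
  imports Defs
begin

text \<open>Rewriting the balancing condition through the product A of the five free parameters, the
elliptic beta integral takes a form that remains meaningful for p = 0 or q = 0. A substitution of
parameters turns it into the star-triangle relation, which trades the factor with index k of the
product on the left-hand side for one more integration. Iterating this over k writes the whole
product over k and r as an (m+1)-fold integral; after exchanging the order of integration, one last
star-triangle relation evaluates the integral over x.

The elliptic beta integral itself follows from Spiridonov's difference equation. By a theta function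
identity, a linear combination of the integrand and of the integrand with one parameter t replaced
by q t equals Y(z) + Y(1/z) with Y(1/(qz)) = -Y(z), so it integrates to zero; hence the normalised
integral is invariant under the shift. A holomorphic function on an annulus that contains a full
period of such a shift is constant by the maximum principle, so the normalised integral does not
depend on its parameters. Letting two of them tend to \<i> and -\<i>, the integrand becomes a Poisson
kernel, which gives the value.\<close>

section \<open>Infinite products\<close>

text \<open>In its usual form the elliptic beta integral has six parameters with product p q.
  Eliminating the sixth, p q / A, by the reflection Gamma(x) Gamma(p q / x) = 1 leaves a division by
  Gamma(A z, A / z). The main obstacle is a mismatch of domains. The shift of t_i to q t_i is proved
  for |p| < |A|^2, where the zeros used in the theta identity are distinct, whereas the integral is
  needed for |p q| < |A|. Constancy is therefore proved near the unit circle, one parameter at a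
  time, and then continued analytically in each parameter separately. Two parameters tend to i and
  -i, and not to 1 and -1, because the factor theta p (z^2) * theta q (1 / z^2) of the integrand
  vanishes at z = 1 and z = -1. The iteration over k is possible because every product over l ends
  at m: removing the last index amounts to replacing t by t s_m, so the induction runs over all
  t.\<close>

lemma prodinf_compact_bound:
  fixes f :: "nat \<Rightarrow> 'a::topological_space \<Rightarrow> complex"
  assumes cont: "\<And>n. continuous_on A (f n)" and A: "compact A"
    and bound: "\<And>n x. x \<in> A \<Longrightarrow> norm (f n x - 1) \<le> M n" and M: "summable M"
  shows "\<And>x. x \<in> A \<Longrightarrow> convergent_prod (\<lambda>n. f n x)"
    and "uniform_limit A (\<lambda>N x. \<Prod>n<N. f n x) (\<lambda>x. \<Prod>n. f n x) sequentially"
    and "continuous_on A (\<lambda>x. \<Prod>n. f n x)"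
    and "\<And>x. x \<in> A \<Longrightarrow> norm ((\<Prod>n. f n x) - 1) \<le> exp (suminf M) - 1"
proof -
  show cv: "convergent_prod (\<lambda>n. f n x)" if "x \<in> A" for x
  proof -
    have "summable (\<lambda>n. norm (f n x - 1))"
      by (rule summable_comparison_test'[OF M, of 0]) (use bound[OF that] in auto)
    thus ?thesis
      by (intro abs_convergent_prod_imp_convergent_prod summable_imp_abs_convergent_prod)
  qed
  have "uniformly_convergent_on A (\<lambda>N x. \<Sum>n<N. norm (f n x - 1))"
    by (rule Weierstrass_m_test'[OF _ M]) (use bound in auto)
  then have "uniformly_convergent_on A (\<lambda>N x. \<Prod>n<N. f n x)"
    by (intro uniformly_convergent_on_prod' cont A)
  then obtain l where l: "uniform_limit A (\<lambda>N x. \<Prod>n<N. f n x) l sequentially"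
    unfolding uniformly_convergent_on_def by blast
  have lim: "(\<lambda>N. \<Prod>n<N. f n x) \<longlonglongrightarrow> (\<Prod>n. f n x)" if "x \<in> A" for x
    using has_prod_imp_tendsto'[OF convergent_prod_has_prod[OF cv[OF that]]] .
  have "l x = (\<Prod>n. f n x)" if "x \<in> A" for x
    using tendsto_uniform_limitI[OF l that] lim[OF that] LIMSEQ_unique by blast
  then show ul: "uniform_limit A (\<lambda>N x. \<Prod>n<N. f n x) (\<lambda>x. \<Prod>n. f n x) sequentially"
    using l by (simp cong: uniform_limit_cong')
  show "continuous_on A (\<lambda>x. \<Prod>n. f n x)"
    by (rule uniform_limit_theorem[OF _ ul]) (auto intro!: always_eventually continuous_on_prod cont)
  \<comment> \<open>This bound allows nesting: it shows that an inner product is close enough to 1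
    to satisfy the hypothesis of the same lemma for an outer product.\<close>
  show "norm ((\<Prod>n. f n x) - 1) \<le> exp (suminf M) - 1" if "x \<in> A" for x
  proof -
    have M0: "M n \<ge> 0" for n using order_trans[OF norm_ge_zero bound[OF that, of n]] .
    have "norm ((\<Prod>n<N. f n x) - 1) \<le> exp (suminf M) - 1" for N
    proof -
      have "norm ((\<Prod>n<N. 1 + (f n x - 1)) - 1) \<le> (\<Prod>n<N. 1 + norm (f n x - 1)) - 1"
        by (rule norm_prod_minus1_le_prod_minus1)
      also have "(\<Prod>n<N. 1 + norm (f n x - 1)) \<le> exp (\<Sum>n<N. norm (f n x - 1))"
        by (rule prod_le_exp_sum) auto
      also have "(\<Sum>n<N. norm (f n x - 1)) \<le> (\<Sum>n<N. M n)"
        by (intro sum_mono bound that)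
      also have "\<dots> \<le> suminf M" using M0 M by (intro sum_le_suminf) auto
      finally show ?thesis by simp
    qed
    moreover have "(\<lambda>N. norm ((\<Prod>n<N. f n x) - 1)) \<longlonglongrightarrow> norm ((\<Prod>n. f n x) - 1)"
      by (intro tendsto_intros lim that)
    ultimately show ?thesis by (intro LIMSEQ_le_const2) auto
  qed
qed

text \<open>The shifted factorial (x; p)_infinity; \<open>qpoch2\<close> is its double analogue (x;
  q, p)_infinity. Base 0 makes sense: 0 ^ 0 = 1 keeps the first factor.\<close>

definition qpoch :: "complex \<Rightarrow> complex \<Rightarrow> complex" where
  "qpoch x p = (\<Prod>n. 1 - x * p ^ n)"

definition qpoch2 :: "complex \<Rightarrow> complex \<Rightarrow> complex \<Rightarrow> complex" where
  "qpoch2 q p x = (\<Prod>j. qpoch (x * q ^ j) p)"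

text \<open>The modified Jacobi theta function. For 0 < |p| < 1 its zeros away from the origin are
  the integral powers of p; for p = 0 and z nonzero it is 1 - z.\<close>

definition theta :: "complex \<Rightarrow> complex \<Rightarrow> complex" where
  "theta p z = qpoch z p * qpoch (p / z) p"

text \<open>The products converge uniformly on boxes with |p| <= r < 1 only, so continuity for |p| <
  1 is assembled from one box around each point.\<close>

lemma continuous_at_from_neighbourhood:
  fixes f :: "'a::t2_space \<Rightarrow> 'b::topological_space"
  assumes "\<And>x. x \<in> S \<Longrightarrow> \<exists>U A. open U \<and> x \<in> U \<and> U \<subseteq> A \<and> continuous_on A f"
  shows "continuous_on S f"
proof (rule continuous_at_imp_continuous_on, intro ballI)
  fix x assume "x \<in> S"
  then obtain U A where "open U" "x \<in> U" "U \<subseteq> A" "continuous_on A f" using assms by blast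
  thus "isCont f x"
    using continuous_on_subset continuous_on_eq_continuous_at by metis
qed

text \<open>The bound is linear in \<open>norm x\<close>. Applied to x q^j it decays geometrically
  in j, which makes the outer product of \<open>qpoch2\<close> converge.\<close>

lemma qpoch_box:
  fixes R r :: real
  assumes "0 \<le> R" "0 \<le> r" "r < 1"
  defines "A \<equiv> cball 0 R \<times> cball (0::complex) r"
  shows "continuous_on A (\<lambda>(x, p). qpoch x p)"
    and "\<And>x p. norm x \<le> R \<Longrightarrow> norm p \<le> r \<Longrightarrow>
           norm (qpoch x p - 1) \<le> norm x * (exp (R / (1 - r)) / (1 - r))"
proof -
  have sum: "summable (\<lambda>n. R' * r ^ n)" "suminf (\<lambda>n. R' * r ^ n) = R' / (1 - r)" for R' :: real
    using assms by (auto intro!: summable_mult simp: suminf_mult suminf_geometric divide_simps)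
  have b: "norm ((1 - x * p ^ n) - 1) \<le> R' * r ^ n" if "norm x \<le> R'" "norm p \<le> r" for x p :: complex and n R'
    using that by (auto simp: norm_mult norm_power intro!: mult_mono power_mono order_trans[OF norm_ge_zero that(1)])
  show "continuous_on A (\<lambda>(x, p). qpoch x p)"
    unfolding qpoch_def case_prod_unfold
    by (rule prodinf_compact_bound(3)[where M="\<lambda>n. R * r ^ n"])
       (use b sum in \<open>auto simp: A_def intro!: continuous_intros compact_Times\<close>)
  show "norm (qpoch x p - 1) \<le> norm x * (exp (R / (1 - r)) / (1 - r))"
    if "norm x \<le> R" "norm p \<le> r" for x p
  proof -
    \<comment> \<open>On a singleton the majorant may contain \<open>norm x\<close> in place of R,
      which yields the linear factor. The term \<open>snd (x, p) * 0\<close> vanishes.\<close>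
    have "norm ((\<Prod>n. 1 - snd (x, p) * 0 + (- x * p ^ n)) - 1) \<le> exp (suminf (\<lambda>n. norm x * r ^ n)) - 1"
      by (rule prodinf_compact_bound(4)[where A="{(x,p)}" and M="\<lambda>n. norm x * r ^ n"
            and f="\<lambda>n xp. 1 - snd (x, p) * 0 + (- x * p ^ n)"])
         (use b[of x "norm x"] sum that in auto)
    hence "norm (qpoch x p - 1) \<le> exp (norm x / (1 - r)) - 1"
      by (simp add: sum qpoch_def)
    \<comment> \<open>The inequality exp y - 1 <= y exp y is 1 - y <= exp (-y) multiplied by exp
      y.\<close>
    also have "\<dots> \<le> (norm x / (1 - r)) * exp (norm x / (1 - r))"
      using exp_ge_add_one_self[of "- (norm x / (1 - r))"]
        mult_right_mono[OF exp_ge_add_one_self[of "- (norm x / (1 - r))"], of "exp (norm x / (1 - r))"]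
      by (simp add: algebra_simps flip: exp_add)
    also have "\<dots> \<le> (norm x / (1 - r)) * exp (R / (1 - r))"
      using assms that by (intro mult_left_mono) (auto simp: divide_right_mono)
    finally show ?thesis by (simp add: field_simps)
  qed
qed

lemma qpoch_convergent:
  fixes x p :: complex
  assumes "norm p < 1"
  shows "convergent_prod (\<lambda>n. 1 - x * p ^ n)"
  by (rule prodinf_compact_bound(1)[where A="{x}" and f="\<lambda>n x. 1 - x * p ^ n" and M="\<lambda>n. norm x * norm p ^ n"])
     (use assms in \<open>auto simp: norm_mult norm_power\<close>)

lemma continuous_on_qpoch_pair:
  "continuous_on {xp. norm (snd xp) < 1} (\<lambda>(x, p). qpoch x p)"
proof (rule continuous_at_from_neighbourhood, clarsimp)
  fix x p :: complex assume p: "norm p < 1"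
  let ?R = "norm x + 1" and ?r = "(norm p + 1) / 2"
  show "\<exists>U. open U \<and> (x, p) \<in> U \<and> (\<exists>A. U \<subseteq> A \<and> continuous_on A (\<lambda>(x, p). qpoch x p))"
    by (rule exI[of _ "ball 0 ?R \<times> ball 0 ?r"], intro conjI exI[of _ "cball 0 ?R \<times> cball 0 ?r"] qpoch_box)
       (use p in \<open>auto simp: open_Times intro: less_imp_le\<close>)
qed

lemma continuous_on_qpoch [continuous_intros]:
  assumes "continuous_on S f" "continuous_on S g" "\<And>x. x \<in> S \<Longrightarrow> norm (g x) < 1"
  shows "continuous_on S (\<lambda>x. qpoch (f x) (g x))"
proof -
  have "continuous_on S (\<lambda>x. (f x, g x))" using assms by (intro continuous_intros)
  moreover have "(\<lambda>x. (f x, g x)) ` S \<subseteq> {xp. norm (snd xp) < 1}" using assms(3) by auto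
  ultimately show ?thesis using continuous_on_compose2[OF continuous_on_qpoch_pair] by fastforce
qed

lemma qpoch2_box:
  fixes R r :: real
  assumes "0 \<le> R" "0 \<le> r" "r < 1"
  defines "A \<equiv> cball (0::complex) r \<times> cball (0::complex) r \<times> cball 0 R"
  shows "continuous_on A (\<lambda>(q, p, x). qpoch2 q p x)"
    and "\<And>q p x. norm q \<le> r \<Longrightarrow> norm p \<le> r \<Longrightarrow> norm x \<le> R \<Longrightarrow> convergent_prod (\<lambda>j. qpoch (x * q ^ j) p)"
    and "\<And>q p. norm q \<le> r \<Longrightarrow> norm p \<le> r \<Longrightarrow>
      uniform_limit (cball 0 R) (\<lambda>N x. \<Prod>j<N. qpoch (x * q ^ j) p) (qpoch2 q p) sequentially"
proof -
  define M where "M = (\<lambda>j. R * r ^ j * (exp (R / (1 - r)) / (1 - r)))"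
  have M: "summable M" unfolding M_def using assms by (intro summable_mult summable_mult2) auto
  have b: "norm (qpoch (x * q ^ j) p - 1) \<le> M j"
    if "norm q \<le> r" "norm p \<le> r" "norm x \<le> R" for q p x j
  proof -
    have 1: "norm (x * q ^ j) \<le> R * r ^ j"
      using that assms by (auto simp: norm_mult norm_power intro!: mult_mono power_mono)
    also have "\<dots> \<le> R * 1" using assms by (intro mult_left_mono power_le_one) auto
    finally have "norm (x * q ^ j) \<le> R" by simp
    from qpoch_box(2)[OF assms(1-3) this that(2)]
    have "norm (qpoch (x * q ^ j) p - 1) \<le> norm (x * q ^ j) * (exp (R / (1 - r)) / (1 - r))" .
    also have "\<dots> \<le> M j" unfolding M_def using 1 assms by (intro mult_right_mono) auto
    finally show ?thesis .
  qed
  show "continuous_on A (\<lambda>(q, p, x). qpoch2 q p x)"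
    unfolding qpoch2_def case_prod_unfold
    by (rule prodinf_compact_bound(3)[where M=M])
       (use b M assms in \<open>auto simp: A_def intro!: continuous_intros compact_Times\<close>)
  show "convergent_prod (\<lambda>j. qpoch (x * q ^ j) p)" if "norm q \<le> r" "norm p \<le> r" "norm x \<le> R" for q p x
    by (rule prodinf_compact_bound(1)[where A="{x}" and f="\<lambda>j x. qpoch (x * q ^ j) p" and M=M])
       (use b[OF that] M in auto)
  show "uniform_limit (cball 0 R) (\<lambda>N x. \<Prod>j<N. qpoch (x * q ^ j) p) (qpoch2 q p) sequentially"
    if "norm q \<le> r" "norm p \<le> r" for q p
    unfolding qpoch2_def
    by (rule prodinf_compact_bound(2)[where M=M])
       (use b[OF that] M assms that in \<open>auto intro!: continuous_intros\<close>)
qed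

lemma qpoch2_convergent:
  assumes "norm q < 1" "norm p < 1"
  shows "convergent_prod (\<lambda>j. qpoch (x * q ^ j) p)"
  by (rule qpoch2_box(2)[of "norm x" "max (norm p) (norm q)"]) (use assms in \<open>auto simp: max_def\<close>)

lemma continuous_on_qpoch2_triple:
  "continuous_on {qpx. norm (fst qpx) < 1 \<and> norm (fst (snd qpx)) < 1} (\<lambda>(q, p, x). qpoch2 q p x)"
proof (rule continuous_at_from_neighbourhood, clarsimp)
  fix x p q :: complex assume p: "norm p < 1" "norm q < 1"
  let ?R = "norm x + 1" and ?r = "(max (norm p) (norm q) + 1) / 2"
  show "\<exists>U. open U \<and> (q, p, x) \<in> U \<and> (\<exists>A. U \<subseteq> A \<and> continuous_on A (\<lambda>(q, p, x). qpoch2 q p x))"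
    by (rule exI[of _ "ball 0 ?r \<times> ball 0 ?r \<times> ball 0 ?R"], intro conjI exI[of _ "cball 0 ?r \<times> cball 0 ?r \<times> cball 0 ?R"] qpoch2_box)
       (use p in \<open>auto simp: open_Times max_def intro: less_imp_le\<close>)
qed

lemma continuous_on_qpoch2 [continuous_intros]:
  assumes "continuous_on S f" "continuous_on S g" "continuous_on S h"
    "\<And>x. x \<in> S \<Longrightarrow> norm (f x) < 1" "\<And>x. x \<in> S \<Longrightarrow> norm (g x) < 1"
  shows "continuous_on S (\<lambda>x. qpoch2 (f x) (g x) (h x))"
proof -
  have "continuous_on S (\<lambda>x. (f x, g x, h x))" using assms by (intro continuous_intros)
  moreover have "(\<lambda>x. (f x, g x, h x)) ` S \<subseteq> {qpx. norm (fst qpx) < 1 \<and> norm (fst (snd qpx)) < 1}"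
    using assms(4,5) by auto
  ultimately show ?thesis using continuous_on_compose2[OF continuous_on_qpoch2_triple] by fastforce
qed

lemma holomorphic_of_uniform_limit_on_balls:
  fixes F :: "nat \<Rightarrow> complex \<Rightarrow> complex"
  assumes "\<And>R. 0 \<le> R \<Longrightarrow> uniform_limit (cball 0 R) F g sequentially" "\<And>n. F n holomorphic_on UNIV"
  shows "g holomorphic_on UNIV"
proof (rule holomorphic_uniform_sequence[of UNIV F])
  fix x :: complex
  show "\<exists>d>0. cball x d \<subseteq> UNIV \<and> uniform_limit (cball x d) F g sequentially"
  proof (intro exI[of _ 1] conjI)
    have "norm y \<le> norm x + 1" if "dist x y \<le> 1" for y
      using norm_triangle_sub[of y x] that by (simp add: dist_norm norm_minus_commute)
    then show "uniform_limit (cball x 1) F g sequentially"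
      by (intro uniform_limit_on_subset[OF assms(1)[of "norm x + 1"]]) auto
  qed auto
qed (use assms in auto)

lemma holomorphic_qpoch_UNIV:
  assumes "norm p < 1" shows "(\<lambda>x. qpoch x p) holomorphic_on UNIV"
  unfolding qpoch_def
proof (rule holomorphic_of_uniform_limit_on_balls)
  fix R :: real assume "0 \<le> R"
  show "uniform_limit (cball 0 R) (\<lambda>N x. \<Prod>n<N. 1 - x * p ^ n) (\<lambda>x. \<Prod>n. 1 - x * p ^ n) sequentially"
    by (rule prodinf_compact_bound(2)[where M="\<lambda>n. R * norm p ^ n"])
       (use assms \<open>0 \<le> R\<close> in \<open>auto intro!: continuous_intros mult_right_mono summable_mult simp: norm_mult norm_power\<close>)
qed (auto intro!: holomorphic_intros)

lemma holomorphic_on_qpoch [holomorphic_intros]: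
  assumes "f holomorphic_on S" "norm p < 1"
  shows "(\<lambda>x. qpoch (f x) p) holomorphic_on S"
  using holomorphic_on_compose_gen[OF assms(1) holomorphic_qpoch_UNIV[OF assms(2)]] by (simp add: o_def)

lemma holomorphic_on_qpoch2 [holomorphic_intros]:
  assumes "f holomorphic_on S" "norm p < 1" "norm q < 1"
  shows "(\<lambda>x. qpoch2 q p (f x)) holomorphic_on S"
proof -
  have "qpoch2 q p holomorphic_on UNIV"
  proof (rule holomorphic_of_uniform_limit_on_balls)
    fix R :: real assume "0 \<le> R"
    show "uniform_limit (cball 0 R) (\<lambda>N x. \<Prod>j<N. qpoch (x * q ^ j) p) (qpoch2 q p) sequentially"
      by (rule qpoch2_box(3)[of _ "max (norm p) (norm q)"]) (use assms \<open>0 \<le> R\<close> in \<open>auto simp: max_def\<close>)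
  qed (use assms in \<open>auto intro!: holomorphic_intros\<close>)
  from holomorphic_on_compose_gen[OF assms(1) this] show ?thesis by (simp add: o_def)
qed

lemma prodinf_split_first:
  fixes f :: "nat \<Rightarrow> complex"
  assumes "convergent_prod f"
  shows "(\<Prod>n. f n) = f 0 * (\<Prod>n. f (Suc n))"
proof -
  have "(\<lambda>n. f (Suc n)) has_prod (\<Prod>n. f (Suc n))"
    using assms by (intro convergent_prod_has_prod) simp
  from has_prod_Suc_imp[OF this] show ?thesis by (simp add: has_prod_iff mult.commute)
qed

lemma qpoch_step: "norm p < 1 \<Longrightarrow> qpoch x p = (1 - x) * qpoch (p * x) p"
  unfolding qpoch_def by (subst prodinf_split_first[OF qpoch_convergent]) (auto simp: mult_ac)

lemma qpoch2_step_q: "norm q < 1 \<Longrightarrow> norm p < 1 \<Longrightarrow> qpoch2 q p x = qpoch x p * qpoch2 q p (q * x)"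
  unfolding qpoch2_def by (subst prodinf_split_first[OF qpoch2_convergent]) (auto simp: mult_ac)

text \<open>The powers of p belong to the inner product, so a factor is split off for every j; the
  split-off factors assemble to \<open>qpoch x q\<close>.\<close>

lemma qpoch2_step_p:
  assumes "norm q < 1" "norm p < 1"
  shows "qpoch2 q p x = qpoch x q * qpoch2 q p (p * x)"
proof -
  have "qpoch x q * qpoch2 q p (p * x) = (\<Prod>j. (1 - x * q ^ j) * qpoch (p * x * q ^ j) p)"
    unfolding qpoch2_def qpoch_def[of x q]
    by (intro prodinf_mult qpoch_convergent qpoch2_convergent assms)
  also have "\<dots> = qpoch2 q p x"
    unfolding qpoch2_def by (intro prodinf_cong, subst qpoch_step[OF assms(2)]) (simp add: mult_ac)
  finally show ?thesis by simp
qed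

lemma qpoch_eq_0_iff:
  assumes "norm p < 1"
  shows "qpoch x p = 0 \<longleftrightarrow> (\<exists>n. x * p ^ n = 1)"
proof -
  have "qpoch x p = 0 \<longleftrightarrow> (\<exists>n. 1 - x * p ^ n = 0)"
    using has_prod_eq_0_iff[OF convergent_prod_has_prod[OF qpoch_convergent[OF assms, of x]]]
    by (auto simp: qpoch_def)
  thus ?thesis by (metis right_minus_eq)
qed

lemma qpoch_nonzero: "norm p < 1 \<Longrightarrow> norm x < 1 \<Longrightarrow> qpoch x p \<noteq> 0"
proof
  assume "norm p < 1" "norm x < 1" "qpoch x p = 0"
  then obtain n where n: "x * p ^ n = 1" by (auto simp: qpoch_eq_0_iff)
  have "norm x * norm p ^ n \<le> norm x" using \<open>norm p < 1\<close> by (simp add: mult_left_le power_le_one)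
  moreover have "norm x * norm p ^ n = 1" using arg_cong[OF n, of norm] by (simp add: norm_mult norm_power)
  ultimately show False using \<open>norm x < 1\<close> by simp
qed

lemma qpoch2_nonzero:
  assumes "norm q < 1" "norm p < 1" "norm x < 1"
  shows "qpoch2 q p x \<noteq> 0"
proof
  assume "qpoch2 q p x = 0"
  then obtain j where "qpoch (x * q ^ j) p = 0"
    using has_prod_eq_0_iff[OF convergent_prod_has_prod[OF qpoch2_convergent[OF assms(1,2), of x]]]
    by (auto simp: qpoch2_def)
  moreover have "norm (x * q ^ j) \<le> norm x * 1"
    unfolding norm_mult norm_power using assms by (intro mult_left_mono power_le_one) auto
  ultimately show False using qpoch_nonzero[of p "x * q ^ j"] assms by auto
qed

lemma euler_prod_eq_qpoch: "euler_prod q = qpoch q q"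
  by (simp add: euler_prod_def qpoch_def)

text \<open>The equation holds at the poles too: there \<open>qpoch2 q p z\<close> is 0, and both
  sides are 0 by the convention for division by zero.\<close>

lemma ell_gamma_eq:
  assumes "norm q < 1" "norm p < 1"
  shows "ell_gamma q p z = qpoch2 q p (p * q / z) / qpoch2 q p z"
proof -
  have "ell_gamma q p z = (\<Prod>j. qpoch (p * q / z * q ^ j) p / qpoch (z * q ^ j) p)"
    unfolding ell_gamma_def
  proof (rule prodinf_cong)
    fix j
    have "qpoch (p * q / z * q ^ j) p / qpoch (z * q ^ j) p
        = (\<Prod>k. (1 - p * q / z * q ^ j * p ^ k) / (1 - z * q ^ j * p ^ k))"
      unfolding qpoch_def by (intro prodinf_divide qpoch_convergent assms)
    thus "(\<Prod>k. (1 - inverse z * q ^ (j + 1) * p ^ (k + 1)) / (1 - z * q ^ j * p ^ k))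
         = qpoch (p * q / z * q ^ j) p / qpoch (z * q ^ j) p"
      by (simp add: divide_inverse mult_ac)
  qed
  also have "\<dots> = qpoch2 q p (p * q / z) / qpoch2 q p z"
    unfolding qpoch2_def by (intro prodinf_divide[symmetric] qpoch2_convergent assms)
  finally show ?thesis .
qed

section \<open>Theta functions and the elliptic gamma function\<close>

lemma theta_shift:
  assumes "norm p < 1" "p \<noteq> 0" "z \<noteq> 0"
  shows "theta p (p * z) = - (theta p z / z)"
  using assms unfolding theta_def
  by (simp add: qpoch_step[of p z] qpoch_step[of p "1/z"]) (simp add: field_simps)

lemma theta_inverse:
  assumes "norm p < 1" "z \<noteq> 0"
  shows "theta p (1 / z) = - (theta p z / z)"
  using assms unfolding theta_def
  by (simp add: qpoch_step[of p z] qpoch_step[of p "1/z"]) (simp add: field_simps)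

lemma theta_reflect: "p \<noteq> 0 \<Longrightarrow> theta p (p / z) = theta p z"
  by (cases "z = 0") (auto simp: theta_def)

lemma theta_1: "norm p < 1 \<Longrightarrow> theta p 1 = 0"
  by (auto simp: theta_def qpoch_eq_0_iff intro: exI[of _ 0])

lemma theta_nonzero:
  assumes "norm p < norm z" "norm z < 1"
  shows "theta p z \<noteq> 0"
proof -
  have "norm (p / z) < 1" using assms by (auto simp: norm_divide divide_simps)
  thus ?thesis unfolding theta_def using assms qpoch_nonzero[of p] by auto
qed

lemma continuous_on_theta [continuous_intros]:
  assumes "continuous_on S f" "continuous_on S g" "\<And>x. x \<in> S \<Longrightarrow> norm (f x) < 1" "\<And>x. x \<in> S \<Longrightarrow> g x \<noteq> 0"
  shows "continuous_on S (\<lambda>x. theta (f x) (g x))"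
  unfolding theta_def using assms by (auto intro!: continuous_intros)

lemma holomorphic_on_theta [holomorphic_intros]:
  assumes "f holomorphic_on S" "norm p < 1" "\<And>x. x \<in> S \<Longrightarrow> f x \<noteq> 0"
  shows "(\<lambda>x. theta p (f x)) holomorphic_on S"
  unfolding theta_def by (intro holomorphic_intros assms)

text \<open>The bound \<open>norm z < 1\<close> keeps z away from the poles, where Gamma takes the
  value 0 and the equation can fail, as at z = 1.\<close>

lemma ell_gamma_shift:
  assumes "norm q < 1" "norm p < 1" "q \<noteq> 0" "z \<noteq> 0" "norm z < 1"
  shows "ell_gamma q p (q * z) = theta p z * ell_gamma q p z"
proof -
  have "p * q / (q * z) = p / z" using assms by simp
  moreover have "qpoch2 q p (p / z) = qpoch (p / z) p * qpoch2 q p (p * q / z)"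
    using assms by (subst qpoch2_step_q) (auto simp: mult_ac)
  ultimately show ?thesis
    using assms qpoch_nonzero[of p z]
    by (simp add: ell_gamma_eq theta_def qpoch2_step_q[of q p z])
qed

text \<open>The poles of Gamma lie in |z| >= 1 and its zeros in |z| <= |p q|. Lower bounds by |p q|
  serve throughout to place arguments of Gamma in the annulus between, where it may stand in a
  denominator.\<close>

lemma ell_gamma_nonzero:
  assumes "norm q < 1" "norm p < 1" "norm (p * q) < norm z" "norm z < 1"
  shows "ell_gamma q p z \<noteq> 0"
proof -
  have "norm (p * q / z) < 1" using assms by (auto simp: norm_divide divide_simps)
  thus ?thesis using assms qpoch2_nonzero[of q p] by (auto simp: ell_gamma_eq)
qed

lemma continuous_on_ell_gamma:
  assumes "continuous_on S f" "continuous_on S g" "continuous_on S h"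
    "\<And>x. x \<in> S \<Longrightarrow> norm (f x) < 1" "\<And>x. x \<in> S \<Longrightarrow> norm (g x) < 1"
    "\<And>x. x \<in> S \<Longrightarrow> h x \<noteq> 0" "\<And>x. x \<in> S \<Longrightarrow> norm (h x) < 1"
  shows "continuous_on S (\<lambda>x. ell_gamma (f x) (g x) (h x))"
proof -
  have "continuous_on S (\<lambda>x. qpoch2 (f x) (g x) (g x * f x / h x) / qpoch2 (f x) (g x) (h x))"
    using assms qpoch2_nonzero by (intro continuous_intros) auto
  thus ?thesis using assms by (simp add: ell_gamma_eq cong: continuous_on_cong)
qed

lemma holomorphic_on_ell_gamma:
  assumes "h holomorphic_on S" "norm q < 1" "norm p < 1"
    "\<And>x. x \<in> S \<Longrightarrow> h x \<noteq> 0" "\<And>x. x \<in> S \<Longrightarrow> norm (h x) < 1"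
  shows "(\<lambda>x. ell_gamma q p (h x)) holomorphic_on S"
proof -
  have "(\<lambda>x. qpoch2 q p (p * q / h x) / qpoch2 q p (h x)) holomorphic_on S"
    using assms qpoch2_nonzero by (intro holomorphic_intros) auto
  thus ?thesis using assms by (simp add: ell_gamma_eq)
qed

lemma norm_mult_less_1:
  fixes p q :: complex
  assumes "norm p < 1" "norm q < 1"
  shows "norm (p * q) < 1"
  using mult_left_mono[of "norm q" 1 "norm p"] assms by (simp add: norm_mult)

text \<open>At z = 1 both sides are 0, the left one by convention and the right one because theta
  vanishes. Thus the continuous right-hand side represents the reciprocal on the whole unit circle,
  which is the intended holomorphic extension.\<close>

lemma inverse_ell_gamma_pair:
  assumes "norm q < 1" "norm p < 1" "norm z = 1"
  shows "1 / (ell_gamma q p z * ell_gamma q p (1 / z)) = theta p z * theta q (1 / z)"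
proof -
  have z: "z \<noteq> 0" using assms by auto
  have pq: "norm (p * q) < 1" using assms by (intro norm_mult_less_1)
  have nz: "qpoch2 q p (p * (q * z)) \<noteq> 0" "qpoch2 q p (p * q / z) \<noteq> 0"
    using assms pq by (intro qpoch2_nonzero; simp add: norm_mult norm_divide)+
  have 1: "qpoch2 q p z = qpoch z p * (qpoch (q * z) q * qpoch2 q p (p * (q * z)))"
    using qpoch2_step_q[OF assms(1,2), of z] qpoch2_step_p[OF assms(1,2), of "q * z"] by simp
  have 2: "qpoch2 q p (1 / z) = qpoch (1 / z) q * (qpoch (p / z) p * qpoch2 q p (p * q / z))"
    using qpoch2_step_p[OF assms(1,2), of "1 / z"] qpoch2_step_q[OF assms(1,2), of "p / z"]
    by (simp add: mult_ac)
  show ?thesis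
    using nz z by (simp add: ell_gamma_eq assms theta_def 1 2 mult_ac)
qed

section \<open>Means over the unit circle, that is, integrals against dz / (2 pi i z)\<close>

definition circ :: "(complex \<Rightarrow> complex) \<Rightarrow> complex" where
  "circ f = integral {0..1} (\<lambda>x. f (exp (2 * of_real pi * \<i> * of_real x)))"

lemma exp_in_circle: "norm (exp (2 * of_real pi * \<i> * of_real x)) = 1"
  by (simp add: norm_exp_eq_Re)

lemma contour_integral_eq_circ:
  "contour_integral (circlepath 0 1) (\<lambda>z. f z / z) = 2 * of_real pi * \<i> * circ f"
proof -
  have "contour_integral (circlepath 0 1) (\<lambda>z. f z / z)
      = integral {0..1} (\<lambda>x. (2 * of_real pi * \<i>) * f (exp (2 * of_real pi * \<i> * of_real x)))"
    unfolding contour_integral_integral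
    by (intro integral_cong, simp only: vector_derivative_circlepath) (simp add: circlepath)
  thus ?thesis by (simp add: circ_def)
qed

lemma circ_cong:
  assumes "\<And>z. norm z = 1 \<Longrightarrow> f z = g z"
  shows "circ f = circ g"
  unfolding circ_def by (intro integral_cong assms exp_in_circle)

lemma circ_cmult: "circ (\<lambda>z. c * f z) = c * circ f"
  unfolding circ_def by simp

lemma continuous_on_exp_circle:
  assumes "continuous_on (sphere 0 1) f"
  shows "continuous_on A (\<lambda>x::real. f (exp (2 * of_real pi * \<i> * of_real x)))"
  by (rule continuous_on_compose2[OF assms]) (auto intro!: continuous_intros simp: exp_in_circle)

lemma circ_add:
  assumes "continuous_on (sphere 0 1) f" "continuous_on (sphere 0 1) g"
  shows "circ (\<lambda>z. f z + g z) = circ f + circ g"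
  unfolding circ_def
  by (intro integral_add integrable_continuous_interval continuous_on_exp_circle assms)

lemma circ_const: "circ (\<lambda>z. c) = c"
  by (simp add: circ_def)

lemma circ_reflect:
  assumes "continuous_on (sphere 0 1) f"
  shows "circ (\<lambda>z. f (1 / z)) = circ f"
proof -
  let ?g = "\<lambda>x::real. f (exp (2 * of_real pi * \<i> * of_real x))"
  have "(?g has_integral circ f) (cbox 0 1)"
    unfolding circ_def cbox_interval
    by (intro integrable_integral integrable_continuous_interval continuous_on_exp_circle assms)
  from has_integral_affinity[OF this, of "-1" 1]
  have "((\<lambda>x. ?g (1 - x)) has_integral circ f) ((\<lambda>x. 1 - x) ` {0..1})"
    by (simp add: algebra_simps)
  also have "(\<lambda>x::real. 1 - x) ` {0..1} = {0..1}"
    by (auto intro: rev_image_eqI[of "1 - x" for x])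
  also have "(\<lambda>x. ?g (1 - x)) = (\<lambda>x::real. f (1 / exp (2 * of_real pi * \<i> * of_real x)))"
  proof
    fix x :: real
    have "2 * of_real pi * \<i> * of_real (1 - x) = 2 * of_real pi * \<i> - 2 * of_real pi * \<i> * of_real x"
      by (simp add: algebra_simps)
    hence "exp (2 * of_real pi * \<i> * of_real (1 - x)) = 1 / exp (2 * of_real pi * \<i> * of_real x)"
      by (simp only: exp_diff) simp
    thus "?g (1 - x) = f (1 / exp (2 * of_real pi * \<i> * of_real x))" by simp
  qed
  finally show ?thesis unfolding circ_def by (simp add: integral_unique)
qed

lemma continuous_on_circ:
  fixes f :: "'a::topological_space \<Rightarrow> complex \<Rightarrow> complex"
  assumes "continuous_on (U \<times> sphere 0 1) (\<lambda>(x, z). f x z)"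
  shows "continuous_on U (\<lambda>x. circ (f x))"
proof -
  have "continuous_on (U \<times> cbox 0 1) (\<lambda>y. (fst y, exp (2 * of_real pi * \<i> * of_real (snd y :: real))))"
    by (intro continuous_intros)
  then have "continuous_on (U \<times> cbox 0 1) (\<lambda>y. (\<lambda>(x, z). f x z) (fst y, exp (2 * of_real pi * \<i> * of_real (snd y :: real))))"
    by (rule continuous_on_compose2[OF assms]) (auto simp: exp_in_circle)
  then have "continuous_on (U \<times> cbox 0 1) (\<lambda>(x, t). f x (exp (2 * of_real pi * \<i> * of_real (t :: real))))"
    by (simp add: case_prod_unfold)
  from integral_continuous_on_param[OF this] show ?thesis by (simp add: circ_def)
qed

lemma circ_swap:
  assumes "continuous_on (sphere 0 1 \<times> sphere 0 1) (\<lambda>(x, y). f x y)"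
  shows "circ (\<lambda>x. circ (\<lambda>y. f x y)) = circ (\<lambda>y. circ (\<lambda>x. f x y))"
proof -
  let ?e = "\<lambda>x::real. exp (2 * of_real pi * \<i> * of_real x)"
  have "continuous_on (cbox (0, 0) (1, 1)) (\<lambda>y. (?e (fst y), ?e (snd y)))"
    by (intro continuous_intros)
  then have "continuous_on (cbox (0, 0) (1, 1)) (\<lambda>y. (\<lambda>(x, z). f x z) (?e (fst y), ?e (snd y)))"
    by (rule continuous_on_compose2[OF assms]) (auto simp: exp_in_circle)
  then have "continuous_on (cbox (0, 0) (1, 1)) (\<lambda>(x, t). f (?e x) (?e t))"
    by (simp add: case_prod_unfold)
  from integral_swap_continuous[OF this] show ?thesis by (simp add: circ_def)
qed

text \<open>Cauchy's theorem for the homotopy that multiplies the circle by exp (s L) with s from 0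
  to 1. Writing the factor as an exponential supplies a path to it from 1.\<close>

lemma circ_scale:
  assumes "open S" "F holomorphic_on S"
    and "\<And>s z. 0 \<le> s \<Longrightarrow> s \<le> 1 \<Longrightarrow> norm z = 1 \<Longrightarrow> exp (of_real s * L) * z \<in> S"
  shows "circ (\<lambda>z. F (exp L * z)) = circ F"
proof -
  \<comment> \<open>The form F z / z may have a pole at 0, which no multiplied circle meets.\<close>
  define T where "T = S - {0}"
  let ?e = "\<lambda>x::real. exp (2 * of_real pi * \<i> * of_real x)"
  have scaled: "contour_integral ((*) c \<circ> circlepath 0 1) (\<lambda>z. F z / z) = 2 * of_real pi * \<i> * circ (\<lambda>z. F (c * z))"
    if "c \<noteq> 0" for c
  proof -
    have vd: "vector_derivative (\<lambda>x. c * circlepath 0 1 x) (at x) = c * (2 * of_real pi * \<i> * ?e x)" for x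
      by (intro vector_derivative_at has_vector_derivative_mult_right)
         (use has_vector_derivative_circlepath[of 0 1 x] in simp)
    have "contour_integral ((*) c \<circ> circlepath 0 1) (\<lambda>z. F z / z)
        = integral {0..1} (\<lambda>x. (2 * of_real pi * \<i>) * F (c * ?e x))"
      unfolding contour_integral_integral o_def vd
      by (intro integral_cong) (use that in \<open>simp add: circlepath\<close>)
    thus ?thesis by (simp add: circ_def)
  qed
  have hom: "homotopic_loops T (circlepath 0 1) ((*) (exp L) \<circ> circlepath 0 1)"
    unfolding homotopic_loops
  proof (intro exI[of _ "\<lambda>y. exp (of_real (fst y) * L) * ?e (snd y)"] conjI ballI)
    show "(\<lambda>y. exp (of_real (fst y) * L) * ?e (snd y)) \<in> {0..1} \<times> {0..1} \<rightarrow> T"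
      using assms(3) by (auto simp: T_def exp_in_circle)
  qed (auto intro!: continuous_intros simp: circlepath pathstart_def pathfinish_def)
  have "contour_integral (circlepath 0 1) (\<lambda>z. F z / z)
      = contour_integral ((*) (exp L) \<circ> circlepath 0 1) (\<lambda>z. F z / z)"
    by (rule Cauchy_theorem_homotopic_loops[OF hom])
       (use assms in \<open>auto simp: T_def valid_path_times intro!: holomorphic_intros intro: holomorphic_on_subset\<close>)
  thus ?thesis using scaled[of "exp L"] by (simp add: contour_integral_eq_circ)
qed

text \<open>Cauchy's formula for each z and an exchange of the two contour integrals show that the
  mean is a Cauchy integral of itself; such integrals are differentiable.\<close>

lemma holomorphic_on_circ:
  assumes "open U" and cont: "continuous_on (U \<times> sphere 0 1) (\<lambda>(x, z). f x z)"
    and holo: "\<And>z. norm z = 1 \<Longrightarrow> (\<lambda>x. f x z) holomorphic_on U"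
  shows "(\<lambda>x. circ (f x)) holomorphic_on U"
proof (rule holomorphic_onI)
  fix a assume "a \<in> U"
  then obtain r where r: "r > 0" "cball a r \<subseteq> U" using \<open>open U\<close> open_contains_cball by blast
  let ?J = "\<lambda>x. circ (f x)" and ?C = "2 * of_real pi * \<i> :: complex"
  have contJ: "continuous_on U ?J" by (rule continuous_on_circ[OF cont])
  have sub: "sphere a r \<subseteq> U" using r by auto
  \<comment> \<open>The exponent 1 gives the shape required by
    \<open>Cauchy_next_derivative_circlepath\<close>.\<close>
  have int: "((\<lambda>u. (?J u / ?C) / (u - w) ^ 1) has_contour_integral ?J w) (circlepath a r)" if w: "w \<in> ball a r" for w
  proof -
    have ne: "u - w \<noteq> 0" if "u \<in> sphere a r" for u using that w by (auto simp: dist_norm)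
    have "continuous_on (sphere a r) (\<lambda>u. ?J u / ?C / (u - w) ^ 1)"
      using ne by (intro continuous_intros continuous_on_subset[OF contJ sub]) auto
    hence ci: "(\<lambda>u. ?J u / ?C / (u - w) ^ 1) contour_integrable_on circlepath a r"
      using r by (intro contour_integrable_continuous_circlepath) simp
    have "contour_integral (circlepath a r) (\<lambda>u. ?J u / ?C / (u - w) ^ 1)
        = contour_integral (circlepath a r) (\<lambda>u. contour_integral (circlepath 0 1) (\<lambda>z. f u z / (u - w) / ?C ^ 2 / z))"
    proof (intro contour_integral_cong refl)
      fix u
      have "contour_integral (circlepath 0 1) (\<lambda>z. f u z / (u - w) / ?C ^ 2 / z) = ?C * circ (\<lambda>z. 1 / ((u - w) * ?C ^ 2) * f u z)"
        by (subst contour_integral_eq_circ[symmetric]) (simp add: mult_ac)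
      thus "?J u / ?C / (u - w) ^ 1 = contour_integral (circlepath 0 1) (\<lambda>z. f u z / (u - w) / ?C ^ 2 / z)"
        unfolding circ_cmult by (simp add: power2_eq_square)
    qed
    also have "\<dots> = contour_integral (circlepath 0 1) (\<lambda>z. contour_integral (circlepath a r) (\<lambda>u. f u z / (u - w) / ?C ^ 2 / z))"
    proof (rule contour_integral_swap)
      have "continuous_on (sphere a r \<times> sphere 0 1) (\<lambda>y. (\<lambda>(x, z). f x z) y / (fst y - w) / ?C ^ 2 / snd y)"
        using ne by (intro continuous_intros continuous_on_subset[OF cont] Sigma_mono sub) auto
      then show "continuous_on (path_image (circlepath a r) \<times> path_image (circlepath 0 1)) (\<lambda>(u, z). f u z / (u - w) / ?C ^ 2 / z)"
        using r by (simp add: case_prod_unfold)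
    qed (use r in \<open>auto simp: vector_derivative_circlepath intro!: continuous_intros\<close>)
    also have "\<dots> = contour_integral (circlepath 0 1) (\<lambda>z. (f w z / ?C) / z)"
    proof (rule contour_integral_cong, simp)
      fix z :: complex assume "z \<in> path_image (circlepath 0 1)"
      hence z: "norm z = 1" by simp
      have "(\<lambda>x. f x z) holomorphic_on cball a r"
        by (rule holomorphic_on_subset[OF holo[OF z] r(2)])
      moreover have "norm (w - a) < r" using w by (simp add: dist_norm norm_minus_commute)
      ultimately have "((\<lambda>u. f u z / (u - w)) has_contour_integral ?C * f w z) (circlepath a r)"
        by (rule Cauchy_integral_circlepath_simple)
      hence "((\<lambda>u. f u z / (u - w) / (?C ^ 2 * z)) has_contour_integral ?C * f w z / (?C ^ 2 * z)) (circlepath a r)"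
        by (rule has_contour_integral_div)
      from contour_integral_unique[OF this]
      have "contour_integral (circlepath a r) (\<lambda>u. f u z / (u - w) / ?C ^ 2 / z) = ?C * f w z / (?C ^ 2 * z)"
        by (simp only: divide_divide_eq_left mult.assoc)
      also have "\<dots> = f w z / ?C / z"
        unfolding power2_eq_square by simp
      finally show "contour_integral (circlepath a r) (\<lambda>u. f u z / (u - w) / ?C ^ 2 / z) = f w z / ?C / z" .
    qed
    also have "\<dots> = ?C * circ (\<lambda>z. 1 / ?C * f w z)"
      by (subst contour_integral_eq_circ) simp
    also have "\<dots> = ?J w" unfolding circ_cmult by simp
    finally show ?thesis using has_contour_integral_integral[OF ci] by (simp only:)
  qed
  have "(?J has_field_derivative of_nat 1 * contour_integral (circlepath a r) (\<lambda>u. (?J u / ?C) / (u - a) ^ Suc 1)) (at a)"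
    by (rule Cauchy_next_derivative_circlepath(2)[OF _ int])
       (use r sub in \<open>auto intro!: continuous_intros continuous_on_subset[OF contJ]\<close>)
  thus "?J field_differentiable at a within U"
    using field_differentiable_at_within field_differentiable_def by blast
qed

section \<open>Multiplicatively periodic holomorphic functions and zeros of theta functions\<close>

lemma open_annulus: "open {z::complex. a < norm z \<and> norm z < b}"
  by (intro open_Collect_conj open_Collect_less continuous_intros)

lemma connected_annulus_0: "connected {z::complex. a < norm z \<and> norm z < b}"
  using connected_annulus(1)[of a "0::complex" b] by simp

text \<open>A maximum of |f| on the closed fundamental annulus K dominates the larger open annulus V
  by periodicity, and is attained inside V, so the maximum principle applies. The condition a < |q|
  r says that a whole period lies in the domain.\<close>

lemma multiplicatively_periodic_on_annulus_imp_constant: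
  fixes f :: "complex \<Rightarrow> complex"
  assumes holo: "f holomorphic_on {z. a < norm z \<and> norm z < b}" and "0 \<le> a"
    and q: "q \<noteq> 0" "norm q < 1" and r: "a < norm q * r" "r < b"
    and per: "\<And>z. r \<le> norm z \<Longrightarrow> norm z < b \<Longrightarrow> f (q * z) = f z"
  shows "f constant_on {z. a < norm z \<and> norm z < b}"
proof -
  let ?S = "{z::complex. a < norm z \<and> norm z < b}"
  have "0 < norm q * r" using r \<open>0 \<le> a\<close> by linarith
  hence rpos: "r > 0" using q by (simp add: zero_less_mult_iff)
  have qr: "norm q * r < r" using rpos q by simp
  define K where "K = {z::complex. norm q * r \<le> norm z \<and> norm z \<le> r}"
  \<comment> \<open>For r < |z| < r / |q| the point q z lies in K, so |f z| is bounded by the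
    maximum over K.\<close>
  define b' where "b' = min b (r / norm q)"
  define V where "V = {z::complex. norm q * r < norm z \<and> norm z < b'}"
  have KS: "K \<subseteq> ?S" using r by (auto simp: K_def)
  have VS: "V \<subseteq> ?S" using r by (auto simp: V_def b'_def)
  have rb': "r < b'" using r q rpos by (auto simp: b'_def field_simps)
  have "closed K" unfolding K_def by (intro closed_Collect_conj closed_Collect_le continuous_intros)
  moreover have "bounded K" unfolding bounded_iff K_def by blast
  ultimately have "compact K" by (simp add: compact_eq_bounded_closed)
  moreover have "of_real r \<in> K" using rpos qr by (simp add: K_def)
  ultimately obtain z0 where z0: "z0 \<in> K" "\<And>z. z \<in> K \<Longrightarrow> norm (f z) \<le> norm (f z0)"
    using continuous_attains_sup[of K "\<lambda>z. norm (f z)"] holomorphic_on_imp_continuous_on[OF holo]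
      continuous_on_subset[OF _ KS] by (metis continuous_on_norm empty_iff)
  have max: "norm (f z) \<le> norm (f z0)" if "z \<in> V" for z
  proof (cases "norm z \<le> r")
    case True
    thus ?thesis using that by (intro z0) (auto simp: K_def V_def)
  next
    case False
    hence "norm q * norm z < r" using that q by (auto simp: V_def b'_def field_simps)
    hence "q * z \<in> K" using False q by (auto simp: K_def norm_mult)
    thus ?thesis using z0(2)[of "q * z"] per[of z] False that by (auto simp: V_def b'_def)
  qed
  \<comment> \<open>A maximum on the inner circle of K would lie on the boundary of V; division by q
    moves it to the outer circle, which is interior to V.\<close>
  obtain z1 where z1: "z1 \<in> V" "norm (f z1) = norm (f z0)"
  proof (cases "norm z0 = norm q * r")
    case True
    hence "norm (z0 / q) = r" using q by (simp add: norm_divide)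
    moreover from this have "f (q * (z0 / q)) = f (z0 / q)" using r by (intro per) auto
    ultimately show ?thesis using q rpos rb' qr by (intro that[of "z0 / q"]) (auto simp: V_def)
  next
    case False
    thus ?thesis using z0(1) rb' by (intro that[of z0]) (auto simp: K_def V_def)
  qed
  have "open V" unfolding V_def by (rule open_annulus)
  from maximum_modulus_principle[OF holo open_annulus connected_annulus_0 this VS z1(1)] max z1(2)
  show ?thesis by simp
qed

lemma multiplicatively_periodic_imp_constant:
  fixes f :: "complex \<Rightarrow> complex"
  assumes holo: "f holomorphic_on -{0}" and q: "q \<noteq> 0" "norm q < 1"
    and per: "\<And>z. z \<noteq> 0 \<Longrightarrow> f (q * z) = f z" and "z \<noteq> 0" "w \<noteq> 0"
  shows "f z = f w"
proof -
  define b where "b = norm z + norm w + 1"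
  have b: "norm z < b" "norm w < b" "0 < b" unfolding b_def using norm_ge_zero[of z] norm_ge_zero[of w] by linarith+
  have "f constant_on {z. 0 < norm z \<and> norm z < b}"
    by (rule multiplicatively_periodic_on_annulus_imp_constant[where q=q and r="b/2"])
       (use assms b in \<open>auto intro!: holomorphic_on_subset[OF holo] per\<close>)
  thus ?thesis using assms b by (force simp: constant_on_def)
qed

text \<open>At a simple zero a of g both f and g contain the factor z - a. Cancelling it leaves a
  holomorphic quotient with the value f' / g' at a.\<close>

lemma holomorphic_quotient_simple_zeros:
  assumes f: "f holomorphic_on S" and g: "g holomorphic_on S" and S: "open S"
    and zeros: "\<And>z. z \<in> S \<Longrightarrow> g z = 0 \<Longrightarrow> f z = 0 \<and> deriv g z \<noteq> 0"
  obtains h where "h holomorphic_on S" "\<And>z. z \<in> S \<Longrightarrow> f z = g z * h z"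
proof -
  define h where "h = (\<lambda>z. if g z = 0 then deriv f z / deriv g z else f z / g z)"
  have "\<exists>T. open T \<and> a \<in> T \<and> h holomorphic_on T" if a: "a \<in> S" for a
  proof (cases "g a = 0")
    case False
    define T where "T = S \<inter> g -` (-{0})"
    have "open T" unfolding T_def
      using continuous_open_preimage[OF holomorphic_on_imp_continuous_on[OF g] S, of "-{0}"] open_Compl[OF closed_singleton] by blast
    moreover have "(\<lambda>z. f z / g z) holomorphic_on T"
      by (intro holomorphic_intros holomorphic_on_subset[OF f] holomorphic_on_subset[OF g]) (auto simp: T_def)
    hence "h holomorphic_on T" by (rule holomorphic_transform) (auto simp: T_def h_def)
    ultimately show ?thesis using False a by (auto simp: T_def)
  next
    case True
    define f1 where "f1 = (\<lambda>z. if z = a then deriv f a else (f z - f a) / (z - a))"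
    define g1 where "g1 = (\<lambda>z. if z = a then deriv g a else (g z - g a) / (z - a))"
    have f1: "f1 holomorphic_on S" and g1: "g1 holomorphic_on S"
      unfolding f1_def g1_def using pole_lemma f g a S interior_open by metis+
    define T where "T = S \<inter> g1 -` (-{0})"
    have "open T" unfolding T_def
      using continuous_open_preimage[OF holomorphic_on_imp_continuous_on[OF g1] S, of "-{0}"] open_Compl[OF closed_singleton] by blast
    moreover have "(\<lambda>z. f1 z / g1 z) holomorphic_on T"
      by (intro holomorphic_intros holomorphic_on_subset[OF f1] holomorphic_on_subset[OF g1]) (auto simp: T_def)
    hence "h holomorphic_on T"
      by (rule holomorphic_transform) (use zeros[OF a] True in \<open>auto simp: T_def h_def f1_def g1_def split: if_splits\<close>)
    moreover have "a \<in> T" using zeros[OF a True] a by (auto simp: T_def g1_def)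
    ultimately show ?thesis by blast
  qed
  hence "h holomorphic_on S"
    by (intro holomorphic_onI) (metis field_differentiable_at_within holomorphic_on_imp_differentiable_at)
  moreover have "f z = g z * h z" if "z \<in> S" for z using zeros[OF that] by (auto simp: h_def)
  ultimately show ?thesis by (rule that)
qed

context
  fixes p :: complex
  assumes p: "p \<noteq> 0" "norm p < 1"
begin

lemma theta_has_derivative:
  assumes "z \<noteq> 0"
  shows "(theta p has_field_derivative deriv (theta p) z) (at z)"
proof -
  have "theta p holomorphic_on -{0}" using holomorphic_on_theta[of "\<lambda>z. z" "-{0}" p] p by simp
  thus ?thesis using assms holomorphic_derivI[of "theta p" "-{0}" z] by (simp add: open_Compl)
qed

lemma theta_eq_0_imp:
  assumes "theta p z = 0" "z \<noteq> 0"
  shows "(\<exists>n. p ^ n * z = 1) \<or> (\<exists>n. z = p ^ n)"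
proof -
  from assms consider n where "z * p ^ n = 1" | n where "p / z * p ^ n = 1"
    unfolding theta_def using p by (auto simp: qpoch_eq_0_iff)
  thus ?thesis
  proof cases
    case (1 n)
    thus ?thesis by (auto simp: mult.commute)
  next
    case (2 n)
    hence "z = p ^ Suc n" using assms by (simp add: field_simps)
    thus ?thesis by blast
  qed
qed

text \<open>theta p z is 1 - z times a function that is nonzero at 1.\<close>

lemma deriv_theta_1: "deriv (theta p) 1 \<noteq> 0"
proof -
  define k where "k = (\<lambda>z. qpoch (p * z) p * qpoch (p / z) p)"
  have "k holomorphic_on -{0}" unfolding k_def using p by (auto intro!: holomorphic_intros)
  hence "(k has_field_derivative deriv k 1) (at 1)"
    by (intro holomorphic_derivI[of k "-{0}"]) auto
  hence "((\<lambda>z. (1 - z) * k z) has_field_derivative - k 1) (at 1)"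
    by (auto intro!: derivative_eq_intros)
  moreover have "theta p = (\<lambda>z. (1 - z) * k z)"
    using qpoch_step[OF p(2), of z for z] unfolding theta_def k_def fun_eq_iff by (metis mult.assoc)
  ultimately have "deriv (theta p) 1 = - k 1" by (simp add: DERIV_imp_deriv)
  thus ?thesis using qpoch_nonzero[of p p] p by (simp add: k_def)
qed

lemma deriv_theta_shift:
  assumes "theta p z = 0" "z \<noteq> 0"
  shows "deriv (theta p) (p * z) = 0 \<longleftrightarrow> deriv (theta p) z = 0"
proof -
  have "((\<lambda>z. theta p (p * z)) has_field_derivative deriv (theta p) (p * z) * p) (at z)"
    using p assms by (intro DERIV_chain2[OF theta_has_derivative]) (auto intro!: derivative_eq_intros)
  moreover have "((\<lambda>z. - (theta p z / z)) has_field_derivative - (deriv (theta p) z / z)) (at z)"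
    using theta_has_derivative[OF assms(2)] assms by (auto intro!: derivative_eq_intros simp: field_simps)
  hence "((\<lambda>z. theta p (p * z)) has_field_derivative - (deriv (theta p) z / z)) (at z)"
    by (rule has_field_derivative_transform_within_open[of _ _ _ "-{0}"])
       (use assms p in \<open>auto simp: theta_shift\<close>)
  ultimately have "deriv (theta p) (p * z) * p = - (deriv (theta p) z / z)" by (rule DERIV_unique)
  thus ?thesis using p assms by auto
qed

lemma deriv_theta_shift_power:
  assumes "theta p z = 0" "z \<noteq> 0"
  shows "theta p (p ^ n * z) = 0 \<and> (deriv (theta p) (p ^ n * z) = 0 \<longleftrightarrow> deriv (theta p) z = 0)"
proof (induction n)
  case (Suc n)
  thus ?case using assms p deriv_theta_shift[of "p ^ n * z"] theta_shift[of p "p ^ n * z"]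
    by (simp add: mult.assoc)
qed (use assms in auto)

text \<open>Every zero is linked to the zero 1 by multiplication with a power of p, and
  quasi-periodicity transports simplicity along such a chain in both directions.\<close>

lemma theta_zeros_simple:
  assumes "theta p z = 0" "z \<noteq> 0"
  shows "deriv (theta p) z \<noteq> 0"
  using theta_eq_0_imp[OF assms]
proof (elim disjE exE)
  fix n assume "p ^ n * z = 1"
  thus ?thesis using deriv_theta_shift_power[OF assms, of n] deriv_theta_1 by simp
next
  fix n assume "z = p ^ n"
  thus ?thesis using deriv_theta_shift_power[of 1 n] deriv_theta_1 theta_1 p by simp
qed

lemma theta_compose_zeros_simple:
  assumes "theta p (\<phi> z) = 0" "\<phi> z \<noteq> 0" "(\<phi> has_field_derivative d) (at z)" "d \<noteq> 0"
  shows "deriv (\<lambda>z. theta p (\<phi> z)) z \<noteq> 0"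
  using DERIV_imp_deriv[OF DERIV_chain2[OF theta_has_derivative[OF assms(2)] assms(3)]]
    theta_zeros_simple[OF assms(1,2)] assms(4) by simp

lemma quasi_periodic_zero_power:
  assumes "\<And>z. z \<noteq> 0 \<Longrightarrow> f (p * z) = m z * f z" "\<And>z. z \<noteq> 0 \<Longrightarrow> m z \<noteq> (0::complex)" "z \<noteq> 0"
  shows "f (p ^ n * z) = 0 \<longleftrightarrow> f z = 0"
proof (induction n)
  case (Suc n)
  thus ?case using assms p by (simp add: mult.assoc)
qed simp

text \<open>The zeros of theta p (c z) form the single orbit of 1 / c under powers of p, and a
  quasi-periodic function vanishes at all points of an orbit or at none.\<close>

lemma quasi_periodic_zero_iff:
  assumes "\<And>z. z \<noteq> 0 \<Longrightarrow> f (p * z) = m z * f z" "\<And>z. z \<noteq> 0 \<Longrightarrow> m z \<noteq> (0::complex)"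
    and "theta p (c * z) = 0" "z \<noteq> 0" "c \<noteq> 0"
  shows "f z = 0 \<longleftrightarrow> f (1 / c) = 0"
proof -
  have "c * z \<noteq> 0" using assms by simp
  then consider n where "p ^ n * (c * z) = 1" | n where "c * z = p ^ n"
    using theta_eq_0_imp[OF assms(3)] by blast
  thus ?thesis
  proof cases
    case (1 n)
    hence eq: "p ^ n * z = 1 / c" using assms by (simp add: field_simps)
    have "f (p ^ n * z) = 0 \<longleftrightarrow> f z = 0" by (rule quasi_periodic_zero_power[of f m, OF assms(1,2,4)])
    thus ?thesis unfolding eq by blast
  next
    case (2 n)
    hence eq: "z = p ^ n * (1 / c)" using assms by (simp add: field_simps)
    have "1 / c \<noteq> 0" using assms by simp
    show ?thesis unfolding eq by (rule quasi_periodic_zero_power[of f m, OF assms(1,2) \<open>1 / c \<noteq> 0\<close>])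
  qed
qed

text \<open>The zeros of theta p (z^2) are the square roots of the powers of p. Modulo powers of p
  only the square roots of 1 and of p remain, according to the parity of the exponent.\<close>

lemma quasi_periodic_zero_square:
  assumes per: "\<And>z. z \<noteq> 0 \<Longrightarrow> f (p * z) = m z * f z" "\<And>z. z \<noteq> 0 \<Longrightarrow> m z \<noteq> (0::complex)"
    and zero: "\<And>s. s\<^sup>2 = 1 \<or> s\<^sup>2 = p \<Longrightarrow> f s = 0"
    and "theta p (z\<^sup>2) = 0" "z \<noteq> 0"
  shows "f z = 0"
proof -
  have "z\<^sup>2 \<noteq> 0" using assms by simp
  then consider n where "p ^ n * z\<^sup>2 = 1" | n where "z\<^sup>2 = p ^ n"
    using theta_eq_0_imp[OF assms(4)] by blast
  thus ?thesis
  proof cases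
    case (1 n)
    \<comment> \<open>For odd n one more factor p is multiplied in, which turns the square into
      p.\<close>
    obtain k where k: "n = 2 * k \<or> Suc n = 2 * k" by (metis evenE even_Suc)
    have "(p ^ k * z)\<^sup>2 = p ^ (2 * k) * z\<^sup>2" by (simp add: power_mult_distrib power_even_eq)
    moreover have "p ^ Suc n * z\<^sup>2 = p" using 1 by (simp add: mult.assoc)
    ultimately have "(p ^ k * z)\<^sup>2 = 1 \<or> (p ^ k * z)\<^sup>2 = p" using 1 k by metis
    hence "f (p ^ k * z) = 0" by (rule zero)
    thus ?thesis using quasi_periodic_zero_power[of f m, OF per assms(5)] by simp
  next
    case (2 n)
    obtain k where k: "n = 2 * k \<or> n = Suc (2 * k)" by (metis evenE oddE Suc_eq_plus1)
    define s where "s = z / p ^ k"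
    have z: "z = p ^ k * s" using p by (simp add: s_def)
    have "s \<noteq> 0" using assms p by (simp add: s_def)
    have "p ^ (2 * k) * s\<^sup>2 = p ^ n" using 2 p by (simp add: s_def power_divide power_even_eq)
    hence "s\<^sup>2 = 1 \<or> s\<^sup>2 = p"
      using k p by auto
    hence "f s = 0" by (rule zero)
    thus ?thesis unfolding z using quasi_periodic_zero_power[of f m, OF per \<open>s \<noteq> 0\<close>] by simp
  qed
qed

end

section \<open>A theta function identity\<close>

context
  fixes p :: complex
  assumes p: "p \<noteq> 0" "norm p < 1"
begin

lemma theta_unshift: "x \<noteq> 0 \<Longrightarrow> theta p (x / p) = - (x / p) * theta p x"
  using theta_shift[of p "x / p"] p by (simp add: field_simps)

lemma theta_swap: "x \<noteq> 0 \<Longrightarrow> y \<noteq> 0 \<Longrightarrow> theta p (x / y) = - (x / y) * theta p (y / x)"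
  using theta_inverse[of p "y / x"] p by (simp add: field_simps)

text \<open>The algebra behind the difference equation: up to a common factor the left side is Y(z)
  + Y(1/z) and the right side is the combination of the two integrands. The coefficients are forced:
  the product of theta p (t_i t_j) makes the difference D of the sides vanish at t_i and 1 / t_i,
  the product of theta p (A / t_j) makes it vanish at A. This is one zero modulo p more than the
  multiplier of D permits, so D is 0.\<close>

lemma theta_bilateral_identity:
  fixes t :: "nat \<Rightarrow> complex"
  defines "A \<equiv> (\<Prod>j<5. t j)"
  assumes t: "\<And>j. j < 5 \<Longrightarrow> norm (t j) < 1" and A: "norm p < norm A ^ 2" and i: "i < 5" and z: "z \<noteq> 0"
  shows "t i * theta p (A * t i) * ((\<Prod>j<5. theta p (t j * z)) * theta p (A / z) / z
           - z ^ 3 * (\<Prod>j<5. theta p (t j / z)) * theta p (A * z))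
       = theta p (z\<^sup>2) * ((\<Prod>j\<in>{..<5}-{i}. theta p (t i * t j)) * theta p (A * z) * theta p (A / z)
           - (\<Prod>j\<in>{..<5}-{i}. theta p (A / t j)) * theta p (t i * z) * theta p (t i / z))"
proof -
  define Q1 where "Q1 = (\<Prod>j\<in>{..<5}-{i}. theta p (t i * t j))"
  define Q2 where "Q2 = (\<Prod>j\<in>{..<5}-{i}. theta p (A / t j))"
  define P where "P = (\<lambda>z. \<Prod>j<5. theta p (t j * z))"
  define P' where "P' = (\<lambda>z. \<Prod>j<5. theta p (t j / z))"
  define B where "B = (\<lambda>z. P z * theta p (A / z) / z - z ^ 3 * P' z * theta p (A * z))"
  define C where "C = (\<lambda>z. Q1 * theta p (A * z) * theta p (A / z) - Q2 * theta p (t i * z) * theta p (t i / z))"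
  \<comment> \<open>D has multiplier 1 / (p^2 z^6), the same as theta p (z^2) * theta p (t i * z) * theta p (t i / z),
     up to a constant; it vanishes at all zeros of that product and, in addition, at A.\<close>
  define D where "D = (\<lambda>z. t i * theta p (A * t i) * B z - theta p (z\<^sup>2) * C z)"
  have A0: "A \<noteq> 0" using A p by (auto dest: le_less_trans[OF norm_ge_zero])
  have t0: "t j \<noteq> 0" if "j < 5" for j using A0 that by (auto simp: A_def)
  note ti0 = t0[OF i]
  have A_split: "A = t i * (\<Prod>j\<in>{..<5}-{i}. t j)"
    unfolding A_def using i by (intro prod.remove) auto
  have rest: "norm (\<Prod>j\<in>{..<5}-{i}. t j) \<le> 1"
    unfolding prod_norm[symmetric] by (intro prod_le_1) (auto intro: less_imp_le t)
  have At: "norm A \<le> norm (t i)"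
    unfolding A_split norm_mult using rest by (simp add: mult_left_le)
  have A1: "norm A < 1" using At t[OF i] by simp
  have "norm A ^ 2 \<le> norm A" using A1 by (simp add: power2_eq_square mult_left_le)
  hence pA: "norm p < norm A" using A by simp

  have prod_mult: "(\<Prod>j<5. c * t j * f j) = c ^ 5 * A * (\<Prod>j<5. f j)" for c and f :: "nat \<Rightarrow> complex"
    by (simp add: prod.distrib A_def)
  have prod_div: "(\<Prod>j<5. c / t j * f j) = c ^ 5 / A * (\<Prod>j<5. f j)" for c and f :: "nat \<Rightarrow> complex"
    by (simp add: prod.distrib prod_dividef A_def)

  have Ppz: "P (p * z) = - (1 / (A * z ^ 5)) * P z" if "z \<noteq> 0" for z
  proof -
    have "P (p * z) = (\<Prod>j<5. (-1 / z) / t j * theta p (t j * z))"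
      unfolding P_def
    proof (intro prod.cong refl)
      fix j assume "j \<in> {..<5::nat}"
      thus "theta p (t j * (p * z)) = (-1 / z) / t j * theta p (t j * z)"
        using theta_shift[of p "t j * z"] t0 that p by (simp add: mult_ac)
    qed
    thus ?thesis unfolding prod_div by (simp add: P_def power_divide mult_ac)
  qed
  have P'pz: "P' (p * z) = - (A / (p ^ 5 * z ^ 5)) * P' z" if "z \<noteq> 0" for z
  proof -
    have "P' (p * z) = (\<Prod>j<5. (-1 / (p * z)) * t j * theta p (t j / z))"
      unfolding P'_def
    proof (intro prod.cong refl)
      fix j assume "j \<in> {..<5::nat}"
      thus "theta p (t j / (p * z)) = (-1 / (p * z)) * t j * theta p (t j / z)"
        using theta_unshift[of "t j / z"] t0 that by (simp add: mult_ac)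
    qed
    thus ?thesis unfolding prod_mult by (simp add: P'_def power_divide power_mult_distrib mult_ac)
  qed
  have sh: "theta p (c * (p * z)) = - (1 / (c * z)) * theta p (c * z)"
    "theta p (c / (p * z)) = - (c / (p * z)) * theta p (c / z)"
    "theta p (p * z / c) = - (c / z) * theta p (z / c)" if "z \<noteq> 0" "c \<noteq> 0" for z c
    using theta_shift[of p "c * z"] theta_shift[of p "z / c"] theta_unshift[of "c / z"] that p
    by (simp_all add: mult_ac)
  have sq: "theta p ((p * z)\<^sup>2) = 1 / (p * z ^ 4) * theta p (z\<^sup>2)" if "z \<noteq> 0" for z
  proof -
    have "theta p ((p * z)\<^sup>2) = theta p (p * (p * z\<^sup>2))" by (simp add: power2_eq_square mult_ac)
    also have "\<dots> = 1 / (p * z ^ 4) * theta p (z\<^sup>2)"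
      using that p by (simp add: theta_shift power2_eq_square power4_eq_xxxx)
    finally show ?thesis .
  qed
  have Bpz: "B (p * z) = 1 / (p\<^sup>2 * z ^ 6) * B z" if "z \<noteq> 0" for z
  proof -
    have "B (p * z) = (- (1 / (A * z ^ 5)) * P z) * (- (A / (p * z)) * theta p (A / z)) / (p * z)
        - (p * z) ^ 3 * (- (A / (p ^ 5 * z ^ 5)) * P' z) * (- (1 / (A * z)) * theta p (A * z))"
      unfolding B_def Ppz[OF that] P'pz[OF that] sh[OF that A0] by simp
    also have "\<dots> = 1 / (p\<^sup>2 * z ^ 6) * B z"
      unfolding B_def using that p A0 by (simp add: field_simps) (simp add: power_def numeral_eq_Suc algebra_simps)
    finally show ?thesis .
  qed
  have Cpz: "C (p * z) = 1 / (p * z\<^sup>2) * C z" if "z \<noteq> 0" for z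
    unfolding C_def sh[OF that A0] sh[OF that ti0] using that p A0 ti0
    by (simp add: field_simps power2_eq_square)
  have Dpz: "D (p * z) = 1 / (p\<^sup>2 * z ^ 6) * D z" if "z \<noteq> 0" for z
  proof -
    have "D (p * z) = t i * theta p (A * t i) * (1 / (p\<^sup>2 * z ^ 6) * B z)
       - 1 / (p * z ^ 4) * theta p (z\<^sup>2) * (1 / (p * z\<^sup>2) * C z)"
      unfolding D_def Bpz[OF that] Cpz[OF that] sq[OF that] ..
    also have "1 / (p * z ^ 4) * theta p (z\<^sup>2) * (1 / (p * z\<^sup>2) * C z) = 1 / (p\<^sup>2 * z ^ 6) * (theta p (z\<^sup>2) * C z)"
      by (simp add: numeral_eq_Suc)
    finally show ?thesis by (simp add: D_def algebra_simps)
  qed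

  \<comment> \<open>In the first case s = 1 / s and in the second s = p / s. Either way the two
    terms of B cancel and theta p (s^2) is 0.\<close>
  have D_root: "D s = 0" if "s\<^sup>2 = 1 \<or> s\<^sup>2 = p" for s
    using that
  proof
    assume s: "s\<^sup>2 = 1"
    hence "s \<noteq> 0" by auto
    with s have inv: "c / s = c * s" for c by (simp add: field_simps power2_eq_square)
    have "s ^ 3 = s" using s by (simp add: power3_eq_cube power2_eq_square)
    hence "B s = 0" unfolding B_def P_def P'_def inv by (simp add: mult_ac)
    thus ?thesis using theta_1 p by (simp add: D_def s)
  next
    assume s: "s\<^sup>2 = p"
    hence s0: "s \<noteq> 0" using p by auto
    have inv: "theta p (c / s) = - (c / s) * theta p (c * s)" if "c \<noteq> 0" for c
      using theta_unshift[of "c * s"] that s0 unfolding s[symmetric] by (simp add: power2_eq_square)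
    have "P' s = (\<Prod>j<5. (-1 / s) * t j * theta p (t j * s))"
      unfolding P'_def by (intro prod.cong refl) (use inv t0 in auto)
    hence P's: "P' s = (-1 / s) ^ 5 * A * P s" unfolding prod_mult by (simp add: P_def)
    have "B s = 0"
      unfolding B_def inv[OF A0] P's using s0 by (simp add: field_simps power_def numeral_eq_Suc)
    moreover have "theta p p = 0" using theta_reflect[of p 1] theta_1 p by simp
    ultimately show ?thesis by (simp add: D_def s)
  qed
  have P_ti: "P (1 / t i) = 0" "P' (t i) = 0"
    unfolding P_def P'_def using i ti0 theta_1 p by (auto intro!: bexI[of _ i])
  have P_i: "P (t i) = theta p ((t i)\<^sup>2) * Q1" "P' (1 / t i) = theta p ((t i)\<^sup>2) * Q1"
    unfolding P_def P'_def Q1_def using i by (auto simp: prod.remove[of _ i] power2_eq_square mult_ac)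
  have D_inv_ti: "D (1 / t i) = 0"
  proof -
    have sq_inv: "theta p ((1 / t i)\<^sup>2) = - (theta p ((t i)\<^sup>2) / (t i)\<^sup>2)"
      using theta_inverse[of p "(t i)\<^sup>2"] ti0 p by (simp add: power_divide)
    show ?thesis unfolding D_def B_def C_def P_ti P_i sq_inv using ti0 theta_1 p
      by (simp add: field_simps power_def numeral_eq_Suc)
  qed
  have D_ti: "D (t i) = 0"
    unfolding D_def B_def C_def P_ti P_i using ti0 theta_1 p by (simp add: field_simps)
  \<comment> \<open>The terms with theta p (A / z) vanish at A; the factor t_i theta p (A t_i) and
    Q2 are what balances the two others.\<close>
  have D_A: "D A = 0"
  proof -
    have "P' A = (\<Prod>j<5. (-1 / A) * t j * theta p (A / t j))"
      unfolding P'_def by (intro prod.cong refl, subst theta_swap) (use t0 A0 in auto)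
    hence P'A: "P' A = (-1 / A) ^ 5 * A * (theta p (A / t i) * Q2)"
      unfolding prod_mult Q2_def using i by (simp add: prod.remove[of _ i])
    show ?thesis unfolding D_def B_def C_def P'A theta_swap[OF ti0 A0] using ti0 theta_1 p A0
      by (simp add: field_simps power_def numeral_eq_Suc)
  qed

  have holoD: "D holomorphic_on -{0}"
    unfolding D_def B_def C_def P_def P'_def using p A0 t0 ti0 by (auto intro!: holomorphic_intros)
  define g1 g2 g3 where "g1 = (\<lambda>z. theta p (z\<^sup>2))" and "g2 = (\<lambda>z. theta p (t i * z))"
    and "g3 = (\<lambda>z. theta p (z / t i))"
  have holo: "g1 holomorphic_on -{0}" "g2 holomorphic_on -{0}" "g3 holomorphic_on -{0}"
    unfolding g1_def g2_def g3_def using p ti0 by (auto intro!: holomorphic_intros)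
  have simple: "g1 z = 0 \<Longrightarrow> deriv g1 z \<noteq> 0" "g2 z = 0 \<Longrightarrow> deriv g2 z \<noteq> 0" "g3 z = 0 \<Longrightarrow> deriv g3 z \<noteq> 0"
    if "z \<noteq> 0" for z
    unfolding g1_def g2_def g3_def
    by (rule theta_compose_zeros_simple[OF p, where \<phi>="\<lambda>z. z\<^sup>2" and d="2 * z"]
          theta_compose_zeros_simple[OF p, where \<phi>="\<lambda>z. t i * z" and d="t i"]
          theta_compose_zeros_simple[OF p, where \<phi>="\<lambda>z. z / t i" and d="1 / t i"];
        use that ti0 in \<open>auto intro!: derivative_eq_intros\<close>)+
  \<comment> \<open>By |p| < |A|^2 the modulus of t_i^2 lies strictly between |p| and 1. Hence t_i
    and 1 / t_i are not zeros of theta p (z^2), and t_i is not a zero of theta p (t_i z).\<close>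
  have pti: "norm p < norm (t i) ^ 2"
    using A At by (meson less_le_trans norm_ge_zero power_mono)
  have ti2: "theta p ((t i)\<^sup>2) \<noteq> 0"
    using pti t[OF i] by (intro theta_nonzero) (auto simp: norm_power power_less_one_iff)
  hence ti2': "theta p ((1 / t i)\<^sup>2) \<noteq> 0"
    using theta_inverse[of p "(t i)\<^sup>2"] ti0 p by (simp add: power_divide)

  obtain h1 where h1: "h1 holomorphic_on -{0}" "\<And>z. z \<in> -{0} \<Longrightarrow> D z = g1 z * h1 z"
  proof (rule holomorphic_quotient_simple_zeros[OF holoD holo(1)])
    fix z assume z: "z \<in> -{0::complex}" "g1 z = 0"
    have "D z = 0"
      by (rule quasi_periodic_zero_square[where f=D and m="\<lambda>z. 1 / (p\<^sup>2 * z ^ 6)", OF p Dpz _ D_root]) (use z p in \<open>auto simp: g1_def\<close>)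
    thus "D z = 0 \<and> deriv g1 z \<noteq> 0" using simple(1)[of z] z by auto
  qed auto
  obtain h2 where h2: "h2 holomorphic_on -{0}" "\<And>z. z \<in> -{0} \<Longrightarrow> h1 z = g2 z * h2 z"
  proof (rule holomorphic_quotient_simple_zeros[OF h1(1) holo(2)])
    fix z assume z: "z \<in> -{0::complex}" "g2 z = 0"
    \<comment> \<open>On the orbit of 1 / t_i the function D vanishes while theta p (z^2) does not,
      so the zero belongs to the quotient \<open>h1\<close>.\<close>
    have "D z = 0 \<longleftrightarrow> D (1 / t i) = 0"
      by (rule quasi_periodic_zero_iff[where f=D and m="\<lambda>z. 1 / (p\<^sup>2 * z ^ 6)", OF p Dpz]) (use z p ti0 in \<open>auto simp: g2_def\<close>)
    moreover have "theta p (z\<^sup>2) = 0 \<longleftrightarrow> theta p ((1 / t i)\<^sup>2) = 0"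
      by (rule quasi_periodic_zero_iff[where f="\<lambda>z. theta p (z\<^sup>2)" and m="\<lambda>z. 1 / (p * z ^ 4)", OF p sq]) (use z p ti0 in \<open>auto simp: g2_def\<close>)
    ultimately have "h1 z = 0" using D_inv_ti ti2' h1(2)[of z] z by (auto simp: g1_def)
    thus "h1 z = 0 \<and> deriv g2 z \<noteq> 0" using simple(2)[of z] z by auto
  qed auto
  obtain h3 where h3: "h3 holomorphic_on -{0}" "\<And>z. z \<in> -{0} \<Longrightarrow> h2 z = g3 z * h3 z"
  proof (rule holomorphic_quotient_simple_zeros[OF h2(1) holo(3)])
    fix z assume z: "z \<in> -{0::complex}" "g3 z = 0"
    have "D z = 0 \<longleftrightarrow> D (1 / (1 / t i)) = 0"
      by (rule quasi_periodic_zero_iff[where f=D and m="\<lambda>z. 1 / (p\<^sup>2 * z ^ 6)", OF p Dpz]) (use z p ti0 in \<open>auto simp: g3_def\<close>)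
    moreover have "theta p (z\<^sup>2) = 0 \<longleftrightarrow> theta p ((1 / (1 / t i))\<^sup>2) = 0"
      by (rule quasi_periodic_zero_iff[where f="\<lambda>z. theta p (z\<^sup>2)" and m="\<lambda>z. 1 / (p * z ^ 4)", OF p sq]) (use z p ti0 in \<open>auto simp: g3_def\<close>)
    moreover have "theta p (t i * z) = 0 \<longleftrightarrow> theta p (t i * (1 / (1 / t i))) = 0"
      by (rule quasi_periodic_zero_iff[where f="\<lambda>z. theta p (t i * z)" and m="\<lambda>z. - (1 / (t i * z))", OF p sh(1)]) (use z p ti0 in \<open>auto simp: g3_def\<close>)
    ultimately have "h2 z = 0"
      using D_ti ti2 h1(2)[of z] h2(2)[of z] z by (auto simp: g1_def g2_def power2_eq_square)
    thus "h2 z = 0 \<and> deriv g3 z \<noteq> 0" using simple(3)[of z] z by auto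
  qed auto
  define g where "g = (\<lambda>z. g1 z * g2 z * g3 z)"
  have D_eq: "D z = g z * h3 z" if "z \<noteq> 0" for z
    using h1(2)[of z] h2(2)[of z] h3(2)[of z] that by (simp add: g_def mult_ac)
  have gpz: "g (p * z) = 1 / (p * z ^ 6) * g z" if "z \<noteq> 0" for z
    unfolding g_def g1_def g2_def g3_def sq[OF that] sh[OF that ti0]
    using that p ti0 by (simp add: field_simps power_def numeral_eq_Suc)
  have gA: "g A \<noteq> 0"
  proof -
    have "theta p (A\<^sup>2) \<noteq> 0"
      using A A1 by (intro theta_nonzero) (auto simp: norm_power power_less_one_iff)
    moreover have "norm A * norm A \<le> norm (t i) * norm A" using At by (intro mult_right_mono) auto
    hence "norm p < norm (t i * A)" using A by (simp add: norm_mult power2_eq_square)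
    hence "theta p (t i * A) \<noteq> 0"
      using norm_mult_less_1[OF t[OF i] A1] by (intro theta_nonzero)
    moreover have "theta p (A / t i) \<noteq> 0"
    proof (rule theta_nonzero)
      have "norm A * norm (t i) \<le> norm A" using t[OF i] by (simp add: mult_left_le)
      hence "norm A \<le> norm (A / t i)" using ti0 by (simp add: norm_divide pos_le_divide_eq)
      thus "norm p < norm (A / t i)" using pA by simp
      have "(\<Prod>j\<in>{..<5}-{i}. norm (t j)) < 1"
      proof -
        obtain k where k: "k \<in> {..<5} - {i}" by (cases "i = 0") (use that[of 0] that[of 1] in auto)
        have "(\<Prod>j\<in>{..<5}-{i}. norm (t j)) = norm (t k) * (\<Prod>j\<in>{..<5}-{i}-{k}. norm (t j))"
          using k by (intro prod.remove) auto
        also have "\<dots> \<le> norm (t k) * 1"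
          by (intro mult_left_mono prod_le_1) (auto intro: less_imp_le t)
        also have "\<dots> < 1" using t[of k] k by auto
        finally show ?thesis .
      qed
      thus "norm (A / t i) < 1" using ti0 A_split by (simp add: norm_divide norm_mult prod_norm)
    qed
    ultimately show ?thesis by (simp add: g_def g1_def g2_def g3_def)
  qed
  \<comment> \<open>The multipliers of D and g differ by 1 / p, so \<open>h3\<close> gains 1 / p
    under z -> p z, and the factor z makes it periodic, hence constant. The constant is 0 because D
    vanishes at A and g does not.\<close>
  define h where "h = (\<lambda>z. z * h3 z)"
  have holoh: "h holomorphic_on -{0}" unfolding h_def by (intro holomorphic_intros h3)
  have conn: "connected (-{0::complex})" by (simp add: connected_punctured_universe)
  have hper: "h (p * z) = h z" if z: "z \<noteq> 0" for z
  proof -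
    have "continuous_on (-{0}) g" unfolding g_def
      by (intro holomorphic_on_imp_continuous_on holomorphic_intros holo)
    hence op: "open (-{0} \<inter> g -` (-{0}))"
      by (intro continuous_open_preimage) auto
    \<comment> \<open>Cancelling g is possible off its zeros only; the identity theorem covers the
      rest.\<close>
    show ?thesis
    proof (rule analytic_continuation_open[of "-{0} \<inter> g -` (-{0})" "-{0}" "\<lambda>z. h (p * z)" h z, OF op])
      show "-{0} \<inter> g -` (-{0}) \<noteq> {}" using A0 gA by auto
      show "(\<lambda>z. h (p * z)) holomorphic_on -{0}"
        by (rule holomorphic_on_compose_gen[OF _ holoh, unfolded o_def]) (use p in \<open>auto intro!: holomorphic_intros\<close>)
      fix w assume "w \<in> -{0} \<inter> g -` (-{0})"
      hence w: "w \<noteq> 0" "g w \<noteq> 0" by auto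
      have "1 / (p\<^sup>2 * w ^ 6) * (g w * h3 w) = 1 / (p * w ^ 6) * g w * h3 (p * w)"
        using Dpz[OF w(1)] D_eq[of "p * w"] D_eq[of w] gpz[OF w(1)] w p by simp
      thus "h (p * w) = h w" using w p by (simp add: h_def field_simps power2_eq_square)
    qed (use conn holoh z in auto)
  qed
  have "h A = 0" using D_eq[OF A0] D_A gA by (simp add: h_def)
  moreover have "h z = h A"
    by (rule multiplicatively_periodic_imp_constant[OF holoh p hper z A0])
  ultimately have "D z = 0" using D_eq[OF z] z A0 by (simp add: h_def)
  thus ?thesis unfolding D_def B_def C_def P_def P'_def Q1_def Q2_def by simp
qed

end

section \<open>The q-difference equation of the elliptic beta integral\<close>

text \<open>On the unit circle, theta p (z^2) * theta q (1 / z^2) is the reciprocal of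
Gamma(z^2, z^(-2)); in contrast to the latter it involves no division by zero at z = 1 and z = -1.\<close>

definition ebeta_weight :: "complex \<Rightarrow> complex \<Rightarrow> (nat \<Rightarrow> complex) \<Rightarrow> complex \<Rightarrow> complex" where
  "ebeta_weight q p t z =
     (\<Prod>j<5. ell_gamma q p (t j * z) * ell_gamma q p (t j / z)) * (theta p (z\<^sup>2) * theta q (1 / z\<^sup>2))
     / (ell_gamma q p ((\<Prod>j<5. t j) * z) * ell_gamma q p ((\<Prod>j<5. t j) / z))"

text \<open>With t_5 = p q / A as sixth parameter this is the integral divided by Gamma(t_j t_k)
  over all 15 pairs: reflection turns Gamma(t_j t_5) into 1 / Gamma(A / t_j).\<close>

definition ebeta_normalised :: "complex \<Rightarrow> complex \<Rightarrow> (nat \<Rightarrow> complex) \<Rightarrow> complex" where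
  "ebeta_normalised q p t =
     circ (ebeta_weight q p t) * (\<Prod>j<5. ell_gamma q p ((\<Prod>j<5. t j) / t j))
     / (\<Prod>k<5. \<Prod>j<k. ell_gamma q p (t j * t k))"

text \<open>The condition on the product says that the eliminated sixth parameter p q / A also has
  modulus below 1.\<close>

definition ebeta_domain :: "complex \<Rightarrow> complex \<Rightarrow> (nat \<Rightarrow> complex) \<Rightarrow> bool" where
  "ebeta_domain q p t \<longleftrightarrow> (\<forall>j<5. norm (t j) < 1) \<and> norm (p * q) < norm (\<Prod>j<5. t j)"

text \<open>A contains every t_j and every t_j t_k as a factor, with cofactors of modulus at most 1.
  Together with |p q| < |A| the bounds place the arguments of Gamma between its zeros and its
  poles.\<close>

lemma ebeta_bounds:
  fixes t :: "nat \<Rightarrow> complex"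
  assumes t': "\<forall>j<5. norm (t j) < 1" and A0: "(\<Prod>j<5. t j) \<noteq> 0"
  defines "A \<equiv> (\<Prod>j<5. t j)"
  shows "\<And>j. j < 5 \<Longrightarrow> t j \<noteq> 0"
    and "norm A < 1"
    and "\<And>j. j < 5 \<Longrightarrow> norm A \<le> norm (t j)"
    and "\<And>j k. j < 5 \<Longrightarrow> k < 5 \<Longrightarrow> j \<noteq> k \<Longrightarrow> norm A \<le> norm (t j * t k)"
    and "\<And>j. j < 5 \<Longrightarrow> norm A < norm (A / t j)"
    and "\<And>j. j < 5 \<Longrightarrow> norm (A / t j) < 1"
proof -
  have t: "norm (t j) < 1" if "j < 5" for j using t' that by blast
  show t0: "t j \<noteq> 0" if "j < 5" for j using A0 that by auto
  have le1: "(\<Prod>j\<in>I. norm (t j)) \<le> 1" if "I \<subseteq> {..<5}" for I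
    using that by (intro prod_le_1) (auto intro: less_imp_le t)
  have two: "norm A = norm (t j) * norm (t k) * (\<Prod>j\<in>{..<5}-{j}-{k}. norm (t j))"
    if "j < 5" "k < 5" "j \<noteq> k" for j k
    unfolding A_def prod_norm[symmetric] using that
    by (subst prod.remove[of _ j]; (subst prod.remove[of _ k])?) (auto simp: mult_ac)
  show jk: "norm A \<le> norm (t j * t k)" if "j < 5" "k < 5" "j \<noteq> k" for j k
    unfolding two[OF that] norm_mult by (intro mult_left_le le1) auto
  have other: "\<exists>k<5. k \<noteq> j" if "j < 5" for j :: nat
    by (cases "j = 0") (auto intro: exI[of _ 0] exI[of _ 1])
  show j: "norm A \<le> norm (t j)" if "j < 5" for j
  proof -
    obtain k where k: "k < 5" "k \<noteq> j" using other[OF \<open>j < 5\<close>] by blast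
    have "norm (t j) * norm (t k) \<le> norm (t j)" using t[OF k(1)] by (intro mult_left_le) auto
    thus ?thesis using jk[OF that k(1)] k by (simp add: norm_mult)
  qed
  show A1: "norm A < 1" using j[of 0] t[of 0] by simp
  show "norm (A / t j) < 1" if "j < 5" for j
  proof -
    obtain k where k: "k < 5" "k \<noteq> j" using other[OF \<open>j < 5\<close>] by blast
    have "norm A \<le> norm (t j * t k)" using jk[OF that k(1)] k by auto
    also have "\<dots> < norm (t j)" using t[OF k(1)] t0[OF that] by (simp add: norm_mult)
    finally show ?thesis using t0[OF that] by (simp add: norm_divide)
  qed
  show "norm A < norm (A / t j)" if "j < 5" for j
    using A0 t[OF that] t0[OF that] by (simp add: norm_divide A_def field_simps)
qed

lemma ebeta_domainD:
  assumes "ebeta_domain q p t"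
  shows "\<And>j. j < 5 \<Longrightarrow> norm (t j) < 1" "(\<Prod>j<5. t j) \<noteq> 0" "norm (p * q) < norm (\<Prod>j<5. t j)"
    "\<And>j. j < 5 \<Longrightarrow> t j \<noteq> 0"
proof -
  show "\<And>j. j < 5 \<Longrightarrow> norm (t j) < 1" "norm (p * q) < norm (\<Prod>j<5. t j)"
    using assms by (auto simp: ebeta_domain_def)
  thus A0: "(\<Prod>j<5. t j) \<noteq> 0" by (metis norm_ge_zero norm_zero not_less)
  show "t j \<noteq> 0" if "j < 5" for j using A0 that by auto
qed

lemma continuous_on_ebeta_weight:
  fixes T :: "'a::topological_space \<Rightarrow> nat \<Rightarrow> complex"
  assumes "continuous_on S Q" "continuous_on S P" "\<And>j. j < 5 \<Longrightarrow> continuous_on S (\<lambda>x. T x j)" "continuous_on S Z"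
    and "\<And>x. x \<in> S \<Longrightarrow> norm (Q x) < 1" "\<And>x. x \<in> S \<Longrightarrow> norm (P x) < 1"
    and dom: "\<And>x. x \<in> S \<Longrightarrow> ebeta_domain (Q x) (P x) (T x)" and Z: "\<And>x. x \<in> S \<Longrightarrow> norm (Z x) = 1"
  shows "continuous_on S (\<lambda>x. ebeta_weight (Q x) (P x) (T x) (Z x))"
proof -
  have Z0: "Z x \<noteq> 0" if "x \<in> S" for x using Z[OF that] by auto
  have A: "(\<Prod>j<5. T x j) \<noteq> 0" "norm (\<Prod>j<5. T x j) < 1" "norm (P x * Q x) < norm (\<Prod>j<5. T x j)"
    "\<And>j. j < 5 \<Longrightarrow> norm (T x j) < 1 \<and> T x j \<noteq> 0" if "x \<in> S" for x
    using ebeta_domainD[OF dom[OF that]] ebeta_bounds(2)[of "T x"] by auto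
  have "ell_gamma (Q x) (P x) ((\<Prod>j<5. T x j) * Z x) \<noteq> 0" "ell_gamma (Q x) (P x) ((\<Prod>j<5. T x j) / Z x) \<noteq> 0"
    if "x \<in> S" for x
    by (rule ell_gamma_nonzero; use assms(5,6)[OF that] A[OF that] Z[OF that] in \<open>simp add: norm_mult norm_divide del: prod_norm\<close>)+
  then show ?thesis unfolding ebeta_weight_def
    using assms A Z0
    by (intro continuous_intros continuous_on_ell_gamma) (auto simp: norm_mult norm_divide simp del: prod_norm)
qed

lemma prod_fun_upd_scale:
  fixes t :: "nat \<Rightarrow> complex"
  assumes "i < n"
  shows "(\<Prod>j<n. (t(i := c * t i)) j) = c * (\<Prod>j<n. t j)"
  using assms by (simp add: prod.remove[of "{..<n}" i] mult.assoc)

text \<open>Isolates the four pairs that contain i, the only ones affected when t_i is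
  shifted.\<close>

lemma prod_pairs_remove:
  fixes f :: "nat \<Rightarrow> nat \<Rightarrow> complex"
  assumes "i < 5" "\<And>j k. f j k = f k j"
  shows "(\<Prod>k<5. \<Prod>j<k. f j k) = (\<Prod>j\<in>{..<5}-{i}. f i j) * (\<Prod>k\<in>{..<5}-{i}. \<Prod>j\<in>{..<k}-{i}. f j k)"
proof -
  have "i \<in> {0, 1, 2, 3, 4}" using assms by auto
  moreover have "{..<5::nat} = {0,1,2,3,4}" "{..<4::nat} = {0,1,2,3}" "{..<3::nat} = {0,1,2}" "{..<2::nat} = {0,1}"
    "{..<Suc 0} = {0}" by auto
  ultimately show ?thesis
    using assms(2)[of 1 0] assms(2)[of 2 0] assms(2)[of 3 0] assms(2)[of 4 0] assms(2)[of 2 1]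
      assms(2)[of 3 1] assms(2)[of 4 1] assms(2)[of 3 2] assms(2)[of 4 2] assms(2)[of 4 3]
    by (elim insertE emptyE) (simp_all add: insert_Diff_if mult_ac)
qed

context
  fixes q p :: complex
  assumes q: "q \<noteq> 0" "norm q < 1" and p: "p \<noteq> 0" "norm p < 1"
begin

text \<open>Y has the parameters q t_j with z and t_j with 1 / z, so z -> 1 / (q z) exchanges the
  two groups; theta q and the factor 1 / z together produce the sign -1. On the circle of radius
  |q|^(-1/2), which this map preserves, the mean of Y is thus its own negative, and the unit circle
  can be deformed into it without meeting a singularity.\<close>

lemma circ_ebeta_telescoping:
  fixes t :: "nat \<Rightarrow> complex"
  defines "A \<equiv> (\<Prod>j<5. t j)"
  assumes t: "\<And>j. j < 5 \<Longrightarrow> norm (t j) < 1" and A: "norm p < norm A"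
  defines "Y \<equiv> (\<lambda>z. (\<Prod>j<5. ell_gamma q p (q * t j * z) * ell_gamma q p (t j / z)) * theta q (1 / z\<^sup>2)
      / (z * ell_gamma q p (q * A * z) * ell_gamma q p (A / z)))"
  shows "circ Y = 0" and "continuous_on (sphere 0 1) Y"
proof -
  have A0: "A \<noteq> 0" using A by (auto dest: le_less_trans[OF norm_ge_zero])
  have "\<forall>j<5. norm (t j) < 1" using t by blast
  note bounds = ebeta_bounds[of t, folded A_def, OF this A0]
  define M where "M = max (norm p / norm A) (Max ((\<lambda>j. norm (t j)) ` {..<5}))"
  have "Max ((\<lambda>j. norm (t j)) ` {..<5}) < 1"
    by (subst Max_less_iff) (use t in \<open>auto simp: lessThan_empty_iff\<close>)
  hence M1: "M < 1" unfolding M_def using A A0 by auto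
  have Mt: "norm (t j) \<le> M" if "j < 5" for j
    unfolding M_def using that by (intro max.coboundedI2 Max_ge) auto
  have MA: "norm A \<le> M" using bounds(3)[of 0] Mt[of 0] by simp
  have Mp: "norm p \<le> M * norm A"
    using A0 by (simp add: M_def max_def field_simps)
  \<comment> \<open>For |z| > M the moduli of t_j / z and A / z are below 1 and that of q A z is
    above |p q|. For |z| < 1 / |q| the moduli of q t_j z and q A z are below 1 and that of A / z is
    above |p q|.\<close>
  define S where "S = {z::complex. M < norm z \<and> norm z < 1 / norm q}"
  have M0: "0 \<le> M" using order_trans[OF norm_ge_zero Mt[of 0]] by simp
  have S: "z \<noteq> 0" "norm z < 1 / norm q" "M < norm z" if "z \<in> S" for z using that M0 by (auto simp: S_def)
  have 1: "norm (q * t j * z) < 1" "norm (t j / z) < 1" if "z \<in> S" "j < 5" for z j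
  proof -
    have "norm (q * t j * z) = (norm q * norm z) * norm (t j)" by (simp add: norm_mult)
    also have "\<dots> \<le> norm q * norm z" using t[OF that(2)] by (intro mult_left_le) auto
    also have "\<dots> < 1" using S(2)[OF that(1)] q by (simp add: field_simps)
    finally show "norm (q * t j * z) < 1" .
    show "norm (t j / z) < 1" using Mt[OF that(2)] S[OF that(1)] by (simp add: norm_divide)
  qed
  have 2: "norm (q * A * z) < 1" "norm (A / z) < 1" "norm (p * q) < norm (q * A * z)" "norm (p * q) < norm (A / z)" if "z \<in> S" for z
  proof -
    have "norm (q * A * z) = (norm q * norm z) * norm A" by (simp add: norm_mult)
    also have "\<dots> \<le> norm q * norm z" using bounds(2) by (intro mult_left_le) auto
    also have "\<dots> < 1" using S(2)[OF that(1)] q by (simp add: field_simps)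
    finally show "norm (q * A * z) < 1" .
    show "norm (A / z) < 1" using MA S[OF that(1)] by (simp add: norm_divide)
    have "norm p < norm z * norm A"
      using Mp S(3)[OF that] A0 by (meson le_less_trans mult_strict_right_mono zero_less_norm_iff)
    thus "norm (p * q) < norm (q * A * z)" using q by (simp add: norm_mult mult_ac)
    have "norm z * norm q < 1" using S(2)[OF that(1)] q by (simp add: field_simps)
    hence "norm p * (norm z * norm q) \<le> norm p * 1" by (intro mult_left_mono) auto
    hence "norm p * norm q * norm z < norm A" using A by (simp add: mult_ac)
    thus "norm (p * q) < norm (A / z)" using S[OF that] by (simp add: norm_divide norm_mult field_simps)
  qed
  have openS: "open S" unfolding S_def by (rule open_annulus)
  have holo: "Y holomorphic_on S"
    unfolding Y_def using q p S 1 2 A0 bounds(1) ell_gamma_nonzero[OF q(2) p(2)]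
    by (intro holomorphic_intros holomorphic_on_ell_gamma) auto
  have circle: "z \<in> S" if "norm z = 1" for z using that M1 q by (auto simp: S_def)
  show contY: "continuous_on (sphere 0 1) Y"
    by (rule continuous_on_subset[OF holomorphic_on_imp_continuous_on[OF holo]]) (use circle in auto)
  \<comment> \<open>A square root of 1 / q, in the exponential form that \<open>circ_scale\<close>
    expects.\<close>
  define c where "c = exp (- (Ln q / 2))"
  have c0: "c \<noteq> 0" by (simp add: c_def)
  have "c * c = exp (- Ln q)" unfolding c_def exp_add[symmetric] by simp
  hence cc: "c * c * q = 1" using q by (simp add: exp_minus)
  have scale_in: "exp (of_real s * (- (Ln q / 2))) * z \<in> S" if "0 \<le> s" "s \<le> 1" "norm z = 1" for s z
  proof -
    have "ln (norm q) < 0" using q by simp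
    hence "0 \<le> - s / 2 * ln (norm q)" "- s / 2 * ln (norm q) < - ln (norm q)"
      using that by (auto simp: mult_nonpos_nonneg mult_nonneg_nonpos field_simps)
    hence "1 \<le> exp (- s / 2 * ln (norm q))" "exp (- s / 2 * ln (norm q)) < exp (- ln (norm q))"
      by simp_all
    moreover have "exp (- ln (norm q)) = 1 / norm q" using q by (simp add: exp_minus inverse_eq_divide)
    moreover have "norm (exp (of_real s * (- (Ln q / 2))) * z) = exp (- s / 2 * ln (norm q))"
      using q that by (simp add: norm_mult norm_exp_eq_Re del: exp_minus)
    ultimately show ?thesis unfolding S_def mem_Collect_eq using M1 by linarith
  qed
  have anti: "Y (c * (1 / z)) = - Y (c * z)" if "norm z = 1" for z
  proof -
    define x where "x = c * z"
    have z0: "z \<noteq> 0" using that by auto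
    have x0: "x \<noteq> 0" using z0 c0 by (simp add: x_def)
    have y: "c * (1 / z) = 1 / (q * x)" using cc z0 q c0 by (simp add: x_def field_simps)
    have "theta q (1 / (1 / (q * x))\<^sup>2) = theta q (q * (q * x\<^sup>2))" by (simp add: power2_eq_square mult_ac)
    also have "\<dots> = theta q (x\<^sup>2) / (q * x ^ 4)"
      using x0 q by (simp add: theta_shift power2_eq_square power4_eq_xxxx)
    also have "theta q (x\<^sup>2) = - x\<^sup>2 * theta q (1 / x\<^sup>2)"
      using theta_inverse[OF q(2), of "x\<^sup>2"] x0 by simp
    finally have th: "theta q (1 / (1 / (q * x))\<^sup>2) = - x\<^sup>2 * theta q (1 / x\<^sup>2) / (q * x ^ 4)" .
    have pr: "(\<Prod>j<5. ell_gamma q p (q * t j * (1 / (q * x))) * ell_gamma q p (t j / (1 / (q * x))))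
      = (\<Prod>j<5. ell_gamma q p (q * t j * x) * ell_gamma q p (t j / x))"
      using q by (intro prod.cong refl) (simp add: mult_ac)
    have ga: "ell_gamma q p (q * A * (1 / (q * x))) = ell_gamma q p (A / x)"
       "ell_gamma q p (A / (1 / (q * x))) = ell_gamma q p (q * A * x)"
      using q by (simp_all add: mult_ac)
    show ?thesis
      unfolding y x_def[symmetric] unfolding Y_def pr th ga using x0 q
      by (simp add: field_simps power2_eq_square power4_eq_xxxx)
  qed
  have contZ: "continuous_on (sphere 0 1) (\<lambda>z. Y (c * z))"
    by (rule continuous_on_compose2[OF holomorphic_on_imp_continuous_on[OF holo]])
       (use scale_in[of 1] in \<open>auto intro!: continuous_intros simp: c_def\<close>)
  have "circ Y = circ (\<lambda>z. Y (c * z))"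
    unfolding c_def by (rule circ_scale[OF openS holo scale_in, symmetric])
  also have "\<dots> = circ (\<lambda>z. Y (c * (1 / z)))" by (rule circ_reflect[OF contZ, symmetric])
  also have "\<dots> = circ (\<lambda>z. (-1) * Y (c * z))" by (rule circ_cong) (subst anti, simp_all)
  also have "\<dots> = - circ (\<lambda>z. Y (c * z))" by (subst circ_cmult) simp
  also have "circ (\<lambda>z. Y (c * z)) = circ Y"
    unfolding c_def by (rule circ_scale[OF openS holo scale_in])
  finally show "circ Y = 0" by simp
qed

text \<open>The theta identity, multiplied by the common Gamma factors, expresses a combination of
  the two integrands as a multiple of Y(z) + Y(1/z), whose mean is 0 by the preceding lemma and the
  symmetry z -> 1 / z.\<close>

lemma ebeta_shift_relation:
  fixes t :: "nat \<Rightarrow> complex"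
  defines "A \<equiv> (\<Prod>j<5. t j)"
  assumes t: "\<And>j. j < 5 \<Longrightarrow> norm (t j) < 1" and A: "norm p < norm A ^ 2" and i: "i < 5"
  shows "(\<Prod>j\<in>{..<5}-{i}. theta p (t i * t j)) * circ (ebeta_weight q p t)
       = (\<Prod>j\<in>{..<5}-{i}. theta p (A / t j)) * circ (ebeta_weight q p (t(i := q * t i)))"
proof -
  define Q1 where "Q1 = (\<Prod>j\<in>{..<5}-{i}. theta p (t i * t j))"
  define Q2 where "Q2 = (\<Prod>j\<in>{..<5}-{i}. theta p (A / t j))"
  define t' where "t' = t(i := q * t i)"
  define k where "k = t i * theta p (A * t i)"
  have A0: "A \<noteq> 0" using A p by (auto dest: le_less_trans[OF norm_ge_zero])
  have "\<forall>j<5. norm (t j) < 1" using t by blast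
  note bounds = ebeta_bounds[of t, folded A_def, OF this A0]
  have "norm A ^ 2 \<le> norm A" using bounds(2) by (simp add: power2_eq_square mult_left_le)
  hence pA: "norm p < norm A" using A by simp
  define Y where "Y = (\<lambda>z. (\<Prod>j<5. ell_gamma q p (q * t j * z) * ell_gamma q p (t j / z)) * theta q (1 / z\<^sup>2)
      / (z * ell_gamma q p (q * A * z) * ell_gamma q p (A / z)))"
  have Y: "circ Y = 0" "continuous_on (sphere 0 1) Y"
    unfolding Y_def A_def by (rule circ_ebeta_telescoping; use t pA in \<open>simp add: A_def\<close>)+
  have A': "(\<Prod>j<5. t' j) = q * A" unfolding t'_def A_def by (rule prod_fun_upd_scale[OF i])
  have key: "k * (Y z + Y (1 / z)) = Q1 * ebeta_weight q p t z - Q2 * ebeta_weight q p t' z"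
    if z: "norm z = 1" for z
  proof -
    have z0: "z \<noteq> 0" using z by auto
    define G where "G = (\<Prod>j<5. ell_gamma q p (t j * z) * ell_gamma q p (t j / z))"
    \<comment> \<open>The common factor: both weights, Y z and Y (1 / z) are b times theta functions
      of base p and powers of z.\<close>
    define b where "b = G * theta q (1 / z\<^sup>2) / (ell_gamma q p (q * A * z) * ell_gamma q p (q * A / z))"
    have shift: "ell_gamma q p (q * c * z) = theta p (c * z) * ell_gamma q p (c * z)"
      "ell_gamma q p (q * c / z) = theta p (c / z) * ell_gamma q p (c / z)"
      if "norm c < 1" "c \<noteq> 0" for c
      using ell_gamma_shift[OF q(2) p(2) q(1), of "c * z"] ell_gamma_shift[OF q(2) p(2) q(1), of "c / z"] that z z0
      by (simp_all add: norm_mult norm_divide mult.assoc)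
    have thn: "theta p (A * z) \<noteq> 0" "theta p (A / z) \<noteq> 0"
      using theta_nonzero[of p "A * z"] theta_nonzero[of p "A / z"] pA bounds(2) z
      by (auto simp: norm_mult norm_divide)
    have gan: "ell_gamma q p (A * z) \<noteq> 0" "ell_gamma q p (A / z) \<noteq> 0"
      using ell_gamma_nonzero[OF q(2) p(2), of "A * z"] ell_gamma_nonzero[OF q(2) p(2), of "A / z"]
        pA bounds(2) z q mult_left_le[of "norm q" "norm p"]
      by (auto simp: norm_mult norm_divide)
    have w: "ebeta_weight q p t z = theta p (z\<^sup>2) * (theta p (A * z) * theta p (A / z)) * b"
      unfolding ebeta_weight_def A_def[symmetric] G_def[symmetric] b_def shift[OF bounds(2) A0]
      using thn gan by (simp add: field_simps)
    have w': "ebeta_weight q p t' z = theta p (z\<^sup>2) * (theta p (t i * z) * theta p (t i / z)) * b"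
    proof -
      have "(\<Prod>j<5. ell_gamma q p (t' j * z) * ell_gamma q p (t' j / z)) = theta p (t i * z) * theta p (t i / z) * G"
        unfolding G_def t'_def using i shift[OF t[OF i] bounds(1)[OF i]]
        by (simp add: prod.remove[of "{..<5}" i] mult_ac)
      thus ?thesis unfolding ebeta_weight_def A' b_def by (simp add: mult_ac)
    qed
    have Y1: "Y z = (\<Prod>j<5. theta p (t j * z)) * theta p (A / z) / z * b"
    proof -
      have "(\<Prod>j<5. ell_gamma q p (q * t j * z) * ell_gamma q p (t j / z)) = (\<Prod>j<5. theta p (t j * z)) * G"
        unfolding G_def prod.distrib[symmetric]
        by (intro prod.cong refl) (use shift t bounds(1) in auto)
      thus ?thesis unfolding Y_def b_def shift(2)[OF bounds(2) A0] using thn by (simp add: field_simps)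
    qed
    have Y2: "Y (1 / z) = - (z ^ 3 * (\<Prod>j<5. theta p (t j / z)) * theta p (A * z)) * b"
    proof -
      have "(\<Prod>j<5. ell_gamma q p (q * t j * (1 / z)) * ell_gamma q p (t j / (1 / z))) = (\<Prod>j<5. theta p (t j / z)) * G"
        unfolding G_def prod.distrib[symmetric]
        by (intro prod.cong refl) (use shift t bounds(1) in auto)
      moreover have "theta q (1 / (1 / z)\<^sup>2) = - z\<^sup>2 * theta q (1 / z\<^sup>2)"
        using theta_inverse[OF q(2), of "z\<^sup>2"] z0 by (simp add: power_divide)
      moreover have "ell_gamma q p (q * A * (1 / z)) = ell_gamma q p (q * A / z)" "A / (1 / z) = A * z" by simp_all
      ultimately show ?thesis unfolding Y_def b_def shift(1)[OF bounds(2) A0]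
        using thn z0 by (simp add: field_simps power2_eq_square power3_eq_cube)
    qed
    have "k * (Y z + Y (1 / z)) = k * ((\<Prod>j<5. theta p (t j * z)) * theta p (A / z) / z
           - z ^ 3 * (\<Prod>j<5. theta p (t j / z)) * theta p (A * z)) * b"
      unfolding Y1 Y2 by (simp add: algebra_simps)
    also have "k * ((\<Prod>j<5. theta p (t j * z)) * theta p (A / z) / z
           - z ^ 3 * (\<Prod>j<5. theta p (t j / z)) * theta p (A * z))
         = theta p (z\<^sup>2) * (Q1 * theta p (A * z) * theta p (A / z) - Q2 * theta p (t i * z) * theta p (t i / z))"
      unfolding k_def Q1_def Q2_def A_def
      by (rule theta_bilateral_identity[OF p]) (use t A i z0 in \<open>auto simp: A_def\<close>)
    finally show ?thesis unfolding w w' by (simp add: algebra_simps)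
  qed
  have contW: "continuous_on (sphere 0 1) (ebeta_weight q p s)"
    if "\<And>j. j < 5 \<Longrightarrow> norm (s j) < 1" "norm (p * q) < norm (\<Prod>j<5. s j)" for s
    by (rule continuous_on_ebeta_weight) (use that q p in \<open>auto simp: ebeta_domain_def intro!: continuous_intros\<close>)
  have cw: "continuous_on (sphere 0 1) (ebeta_weight q p t)" "continuous_on (sphere 0 1) (ebeta_weight q p t')"
  proof -
    have "norm (p * q) \<le> norm p" using q mult_left_le[of "norm q" "norm p"] by (simp add: norm_mult)
    thus "continuous_on (sphere 0 1) (ebeta_weight q p t)"
      using pA t by (intro contW) (auto simp: A_def)
    have "norm (t' j) < 1" if "j < 5" for j
      unfolding t'_def using norm_mult_less_1[OF q(2) t[OF i]] t[OF that] by simp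
    thus "continuous_on (sphere 0 1) (ebeta_weight q p t')"
      using pA q by (intro contW) (auto simp: A' norm_mult)
  qed
  have refl: "continuous_on (sphere 0 1) (\<lambda>z. Y (1 / z))"
    by (rule continuous_on_compose2[OF Y(2)]) (auto intro!: continuous_intros simp: norm_divide)
  have "0 = k * (circ Y + circ Y)" using Y by simp
  also have "\<dots> = k * (circ Y + circ (\<lambda>z. Y (1 / z)))" by (simp add: circ_reflect[OF Y(2)])
  also have "\<dots> = circ (\<lambda>z. k * (Y z + Y (1 / z)))" by (simp add: circ_cmult circ_add[OF Y(2) refl])
  also have "\<dots> = circ (\<lambda>z. Q1 * ebeta_weight q p t z + (- Q2) * ebeta_weight q p t' z)"
    by (rule circ_cong) (simp add: key)
  also have "\<dots> = circ (\<lambda>z. Q1 * ebeta_weight q p t z) + circ (\<lambda>z. (- Q2) * ebeta_weight q p t' z)"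
    by (intro circ_add continuous_intros cw)
  also have "\<dots> = Q1 * circ (ebeta_weight q p t) - Q2 * circ (ebeta_weight q p t')"
    by (simp only: circ_cmult) simp
  finally show ?thesis by (simp add: Q1_def Q2_def t'_def)
qed

text \<open>By Gamma(q x) = theta(x) Gamma(x) the Gamma factors gain Q2 in the numerator and Q1 in
  the denominator, while A / t_i is unchanged. The shift relation gives the integral the
  compensating factor Q1 / Q2.\<close>

lemma ebeta_normalised_shift:
  fixes t :: "nat \<Rightarrow> complex"
  assumes t: "\<And>j. j < 5 \<Longrightarrow> norm (t j) < 1" and A: "norm p < norm (\<Prod>j<5. t j) ^ 2" and i: "i < 5"
  shows "ebeta_normalised q p (t(i := q * t i)) = ebeta_normalised q p t"
proof -
  define A where "A = (\<Prod>j<5. t j)"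
  define t' where "t' = t(i := q * t i)"
  note A = A[folded A_def]
  have A0: "A \<noteq> 0" using A p by (auto dest: le_less_trans[OF norm_ge_zero])
  have "\<forall>j<5. norm (t j) < 1" using t by blast
  note bounds = ebeta_bounds[of t, folded A_def, OF this A0]
  have "norm A ^ 2 \<le> norm A" using bounds(2) by (simp add: power2_eq_square mult_left_le)
  hence pA: "norm p < norm A" using A by simp
  define Q1 where "Q1 = (\<Prod>j\<in>{..<5}-{i}. theta p (t i * t j))"
  define Q2 where "Q2 = (\<Prod>j\<in>{..<5}-{i}. theta p (A / t j))"
  have A': "(\<Prod>j<5. t' j) = q * A" unfolding t'_def A_def by (rule prod_fun_upd_scale[OF i])
  have rel: "Q1 * circ (ebeta_weight q p t) = Q2 * circ (ebeta_weight q p t')"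
    unfolding Q1_def Q2_def t'_def A_def by (rule ebeta_shift_relation) (use t A i in \<open>auto simp: A_def\<close>)
  have tt: "norm (t i * t j) < 1" if "j < 5" for j using norm_mult_less_1[OF t[OF i] t[OF that]] .
  have Q1: "Q1 \<noteq> 0"
    unfolding Q1_def using less_le_trans[OF pA bounds(4)[OF i]] tt
    by (auto dest: theta_nonzero)
  have num: "(\<Prod>j<5. ell_gamma q p (q * A / t' j)) = Q2 * (\<Prod>j<5. ell_gamma q p (A / t j))"
  proof -
    have "(\<Prod>j\<in>{..<5}-{i}. ell_gamma q p (q * A / t' j)) = (\<Prod>j\<in>{..<5}-{i}. theta p (A / t j) * ell_gamma q p (A / t j))"
    proof (intro prod.cong refl)
      fix j assume "j \<in> {..<5}-{i}"
      hence j: "j < 5" "j \<noteq> i" by auto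
      show "ell_gamma q p (q * A / t' j) = theta p (A / t j) * ell_gamma q p (A / t j)"
        using ell_gamma_shift[OF q(2) p(2) q(1), of "A / t j"] j bounds(1)[OF j(1)] bounds(6)[OF j(1)] A0
        by (simp add: t'_def)
    qed
    thus ?thesis using i q
      by (simp add: prod.remove[of "{..<5}" i] prod.distrib Q2_def) (simp add: t'_def)
  qed
  have den: "(\<Prod>k<5. \<Prod>j<k. ell_gamma q p (t' j * t' k)) = Q1 * (\<Prod>k<5. \<Prod>j<k. ell_gamma q p (t j * t k))"
  proof -
    have "(\<Prod>j\<in>{..<5}-{i}. ell_gamma q p (t' i * t' j)) = (\<Prod>j\<in>{..<5}-{i}. theta p (t i * t j) * ell_gamma q p (t i * t j))"
    proof (intro prod.cong refl)
      fix j assume "j \<in> {..<5}-{i}"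
      hence j: "j < 5" "j \<noteq> i" by auto
      show "ell_gamma q p (t' i * t' j) = theta p (t i * t j) * ell_gamma q p (t i * t j)"
        using ell_gamma_shift[OF q(2) p(2) q(1), of "t i * t j"] j bounds(1)[OF j(1)] bounds(1)[OF i] tt[OF j(1)]
        by (simp add: t'_def mult_ac)
    qed
    moreover have "(\<Prod>k\<in>{..<5}-{i}. \<Prod>j\<in>{..<k}-{i}. ell_gamma q p (t' j * t' k))
        = (\<Prod>k\<in>{..<5}-{i}. \<Prod>j\<in>{..<k}-{i}. ell_gamma q p (t j * t k))"
      by (intro prod.cong refl) (auto simp: t'_def)
    moreover have "(\<Prod>k<5. \<Prod>j<k. ell_gamma q p (s j * s k))
        = (\<Prod>j\<in>{..<5}-{i}. ell_gamma q p (s i * s j)) * (\<Prod>k\<in>{..<5}-{i}. \<Prod>j\<in>{..<k}-{i}. ell_gamma q p (s j * s k))"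
      for s :: "nat \<Rightarrow> complex"
      by (rule prod_pairs_remove[OF i]) (simp add: mult.commute)
    ultimately show ?thesis by (simp only: prod.distrib Q1_def mult.assoc)
  qed
  have "ebeta_normalised q p t' = (Q2 * circ (ebeta_weight q p t')) * (\<Prod>j<5. ell_gamma q p (A / t j))
     / (Q1 * (\<Prod>k<5. \<Prod>j<k. ell_gamma q p (t j * t k)))"
    unfolding ebeta_normalised_def A' num den by (simp add: mult_ac)
  also have "\<dots> = ebeta_normalised q p t"
    unfolding rel[symmetric] ebeta_normalised_def A_def using Q1 by simp
  finally show ?thesis by (simp add: t'_def)
qed

end

section \<open>Independence of the parameters\<close>

lemma continuous_on_ebeta_normalised:
  fixes T :: "'a::topological_space \<Rightarrow> nat \<Rightarrow> complex"
  assumes "continuous_on S Q" "continuous_on S P" "\<And>j. j < 5 \<Longrightarrow> continuous_on S (\<lambda>x. T x j)"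
    and "\<And>x. x \<in> S \<Longrightarrow> norm (Q x) < 1" "\<And>x. x \<in> S \<Longrightarrow> norm (P x) < 1"
    and dom: "\<And>x. x \<in> S \<Longrightarrow> ebeta_domain (Q x) (P x) (T x)"
  shows "continuous_on S (\<lambda>x. ebeta_normalised (Q x) (P x) (T x))"
proof -
  have "continuous_on (S \<times> sphere 0 1) (\<lambda>y. ebeta_weight (Q (fst y)) (P (fst y)) (T (fst y)) (snd y))"
    by (rule continuous_on_ebeta_weight)
       (use assms in \<open>auto intro!: continuous_intros continuous_on_compose2[of S _ _ fst]\<close>)
  hence 1: "continuous_on S (\<lambda>x. circ (ebeta_weight (Q x) (P x) (T x)))"
    by (intro continuous_on_circ) (simp add: case_prod_unfold)
  have 2: "T x j \<noteq> 0" "norm (T x j) < 1" if "x \<in> S" "j < 5" for x j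
    using ebeta_domainD[OF dom[OF that(1)]] that by blast+
  have A0: "(\<Prod>j<5. T x j) \<noteq> 0" if "x \<in> S" for x
    using ebeta_domainD[OF dom[OF that]] by blast
  have 3: "norm ((\<Prod>j<5. T x j) / T x k) < 1" if "x \<in> S" "k < 5" for x k
    using ebeta_bounds(6)[of "T x"] ebeta_domainD[OF dom[OF that(1)]] that by blast
  have 4: "ell_gamma (Q x) (P x) (T x j * T x k) \<noteq> 0" if "x \<in> S" "j < k" "k < 5" for x j k
  proof -
    have "j < 5" "j \<noteq> k" using that by auto
    hence "norm (\<Prod>j<5. T x j) \<le> norm (T x j * T x k)"
      using ebeta_bounds(4)[of "T x"] ebeta_domainD[OF dom[OF that(1)]] that by blast
    hence "norm (P x * Q x) < norm (T x j * T x k)"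
      using ebeta_domainD(3)[OF dom[OF that(1)]] by (rule less_le_trans[rotated])
    thus ?thesis using norm_mult_less_1[of "T x j" "T x k"] assms(4,5) that 2 \<open>j < 5\<close>
      by (intro ell_gamma_nonzero) auto
  qed
  have num: "continuous_on S (\<lambda>x. ell_gamma (Q x) (P x) ((\<Prod>j<5. T x j) / T x k))" if "k < 5" for k
    using 2 A0 3 assms(4,5) that by (intro continuous_on_ell_gamma continuous_intros assms(1-3)) auto
  have den: "continuous_on S (\<lambda>x. ell_gamma (Q x) (P x) (T x j * T x k))" if "j < k" "k < 5" for j k
    using 2 assms(4,5) that norm_mult_less_1
    by (intro continuous_on_ell_gamma continuous_intros assms(1-3)) auto
  have nz: "(\<Prod>k<5. \<Prod>j<k. ell_gamma (Q x) (P x) (T x j * T x k)) \<noteq> 0" if "x \<in> S" for x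
    using 4[OF that] by auto
  show ?thesis unfolding ebeta_normalised_def
    by (intro continuous_on_divide continuous_on_mult continuous_on_prod 1 num den ballI nz) auto
qed

lemma ebeta_normalised_cong:
  assumes "\<And>j. j < 5 \<Longrightarrow> t j = t' j"
  shows "ebeta_normalised q p t = ebeta_normalised q p t'"
proof -
  have 1: "(\<Prod>j<5. f (t j)) = (\<Prod>j<5. f (t' j))" for f :: "complex \<Rightarrow> complex"
    using assms by (intro prod.cong) auto
  have "(\<Prod>k<5. \<Prod>j<k. ell_gamma q p (t j * t k)) = (\<Prod>k<5. \<Prod>j<k. ell_gamma q p (t' j * t' k))"
    using assms by (intro prod.cong) auto
  moreover have "ebeta_weight q p t = ebeta_weight q p t'"
    unfolding ebeta_weight_def using 1[of "\<lambda>x. x"] 1[of "\<lambda>x. ell_gamma q p (x * z) * ell_gamma q p (x / z)" for z] by auto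
  ultimately show ?thesis
    unfolding ebeta_normalised_def using 1[of "\<lambda>x. x"] 1[of "\<lambda>x. ell_gamma q p ((\<Prod>j<5. t' j) / x)"] by simp
qed

lemma continuous_on_fun_upd:
  "continuous_on S f \<Longrightarrow> continuous_on S (\<lambda>x. (t(i := f x)) j)"
  by (cases "j = i") auto

lemma holomorphic_on_fun_upd:
  "(\<lambda>x. (t(i := x)) j) holomorphic_on S"
  by (cases "j = i") auto

context
  fixes q p :: complex
  assumes q: "norm q < 1" and p: "norm p < 1"
begin

lemma ebeta_normalised_holomorphic:
  fixes t :: "nat \<Rightarrow> complex"
  defines "B \<equiv> \<lambda>i. \<Prod>j\<in>{..<5}-{i}. t j"
  assumes t: "\<And>j. j < 5 \<Longrightarrow> j \<noteq> i \<Longrightarrow> norm (t j) < 1" and i: "i < 5" and B: "B i \<noteq> 0"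
  defines "S \<equiv> {x::complex. norm (p * q) / norm (B i) < norm x \<and> norm x < 1}"
  shows "\<And>x. x \<in> S \<Longrightarrow> ebeta_domain q p (t(i := x))"
    and "(\<lambda>x. ebeta_normalised q p (t(i := x))) holomorphic_on S"
proof -
  have A: "(\<Prod>j<5. (t(i := x)) j) = x * B i" for x
    using i by (simp add: prod.remove[of "{..<5}" i] B_def)
  have Sx: "x \<noteq> 0" "norm x < 1" "norm (p * q) < norm (x * B i)" if "x \<in> S" for x
  proof -
    have "0 \<le> norm (p * q) / norm (B i)" by simp
    also have "\<dots> < norm x" using that unfolding S_def by blast
    finally have "0 < norm x" .
    thus "x \<noteq> 0" by simp
    show "norm x < 1" "norm (p * q) < norm (x * B i)"
      using that B by (auto simp: S_def norm_mult pos_divide_less_eq)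
  qed
  show dom: "ebeta_domain q p (t(i := x))" if "x \<in> S" for x
    unfolding ebeta_domain_def A using Sx[OF that] t by auto
  note domD = ebeta_domainD[OF dom] 
  have bnd: "norm (x * B i) < 1" "\<And>j. j < 5 \<Longrightarrow> norm (x * B i / (t(i := x)) j) < 1"
    "\<And>j k. j < 5 \<Longrightarrow> k < 5 \<Longrightarrow> j \<noteq> k \<Longrightarrow> norm (x * B i) \<le> norm ((t(i := x)) j * (t(i := x)) k)" if "x \<in> S" for x
    using ebeta_bounds(2,4,6)[of "t(i := x)", unfolded A] domD(1)[OF that] domD(2)[OF that, unfolded A] by blast+
  have "open S" unfolding S_def by (rule open_annulus)
  have "continuous_on (S \<times> sphere 0 1) (\<lambda>y. ebeta_weight q p (t(i := fst y)) (snd y))"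
    by (rule continuous_on_ebeta_weight) (use dom q p in \<open>auto intro!: continuous_intros continuous_on_fun_upd simp del: fun_upd_apply\<close>)
  hence cont: "continuous_on (S \<times> sphere 0 1) (\<lambda>(x, z). ebeta_weight q p (t(i := x)) z)"
    by (simp add: case_prod_unfold)
  have 1: "(\<lambda>x. circ (ebeta_weight q p (t(i := x)))) holomorphic_on S"
  proof (rule holomorphic_on_circ[OF \<open>open S\<close> cont])
    fix z :: complex assume z: "norm z = 1"
    hence z0: "z \<noteq> 0" by auto
    have "ell_gamma q p (x * B i * z) \<noteq> 0" "ell_gamma q p (x * B i / z) \<noteq> 0" if "x \<in> S" for x
      by (rule ell_gamma_nonzero; use q p Sx[OF that] bnd(1)[OF that] z in \<open>simp add: norm_mult norm_divide\<close>)+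
    then show "(\<lambda>x. ebeta_weight q p (t(i := x)) z) holomorphic_on S"
      unfolding ebeta_weight_def A
      by (intro holomorphic_intros holomorphic_on_ell_gamma holomorphic_on_fun_upd q p)
         (use B z z0 Sx bnd domD in \<open>auto simp: norm_mult norm_divide simp del: fun_upd_apply\<close>)
  qed
  have den: "ell_gamma q p ((t(i := x)) j * (t(i := x)) k) \<noteq> 0" if "x \<in> S" "j < k" "k < 5" for x j k
  proof (rule ell_gamma_nonzero[OF q p])
    show "norm (p * q) < norm ((t(i := x)) j * (t(i := x)) k)"
      using less_le_trans[OF Sx(3)[OF that(1)] bnd(3)[OF that(1), of j k]] that by auto
    show "norm ((t(i := x)) j * (t(i := x)) k) < 1"
      using domD(1)[OF that(1)] that by (intro norm_mult_less_1) (auto simp del: fun_upd_apply)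
  qed
  have lt: "norm ((t(i := x)) j * (t(i := x)) k) < 1" "(t(i := x)) j * (t(i := x)) k \<noteq> 0"
    if "x \<in> S" "j < 5" "k < 5" for x j k
    using domD(1,4)[OF that(1)] that by (auto intro!: norm_mult_less_1 simp del: fun_upd_apply)
  have numh: "(\<lambda>x. ell_gamma q p (x * B i / (t(i := x)) j)) holomorphic_on S" if "j < 5" for j
    by (intro holomorphic_on_ell_gamma holomorphic_intros holomorphic_on_fun_upd q p)
       (use B Sx bnd domD(4) that in \<open>auto simp del: fun_upd_apply\<close>)
  have denh: "(\<lambda>x. ell_gamma q p ((t(i := x)) j * (t(i := x)) k)) holomorphic_on S" if "j < k" "k < 5" for j k
    by (intro holomorphic_on_ell_gamma holomorphic_intros holomorphic_on_fun_upd q p lt) (use that in auto)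
  have nz: "(\<Prod>k<5. \<Prod>j<k. ell_gamma q p ((t(i := x)) j * (t(i := x)) k)) \<noteq> 0" if "x \<in> S" for x
    using den[OF that] by auto
  show "(\<lambda>x. ebeta_normalised q p (t(i := x))) holomorphic_on S"
    unfolding ebeta_normalised_def A
    by (intro holomorphic_on_divide holomorphic_on_mult holomorphic_on_prod 1 numh denh nz) auto
qed

text \<open>Shift invariance is known where |x B_i|^2 > |p|. The assumption on B_i makes this true
  on a nonempty annulus below the unit circle, and a full period reaching inward from there still
  lies in S.\<close>

lemma ebeta_normalised_constant_in_one_variable:
  fixes t :: "nat \<Rightarrow> complex"
  defines "B \<equiv> \<lambda>i. \<Prod>j\<in>{..<5}-{i}. t j"
  assumes q0: "q \<noteq> 0" and p0: "p \<noteq> 0"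
  assumes t: "\<And>j. j < 5 \<Longrightarrow> j \<noteq> i \<Longrightarrow> norm (t j) < 1" and i: "i < 5" and B: "norm p < norm (B i) ^ 2"
  defines "S \<equiv> {x::complex. norm (p * q) / norm (B i) < norm x \<and> norm x < 1}"
  assumes xy: "x \<in> S" "y \<in> S"
  shows "ebeta_normalised q p (t(i := x)) = ebeta_normalised q p (t(i := y))"
proof -
  have B0: "B i \<noteq> 0" using B by auto
  have A: "(\<Prod>j<5. (t(i := x)) j) = x * B i" for x
    using i by (simp add: prod.remove[of "{..<5}" i] B_def)
  have B1: "norm (B i) \<le> 1"
    unfolding B_def prod_norm[symmetric] by (intro prod_le_1) (auto intro: less_imp_le t)
  \<comment> \<open>Shift invariance starts beyond the radius sqrt |p| / |B_i|; r is the midpoint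
    between it and 1.\<close>
  define r where "r = (1 + sqrt (norm p) / norm (B i)) / 2"
  have "sqrt (norm p) < norm (B i)" using B by (intro real_less_lsqrt) auto
  hence "sqrt (norm p) / norm (B i) < 1" using B0 by simp
  moreover have "x < (1 + x) / 2 \<and> (1 + x) / 2 < 1" if "x < 1" for x :: real using that by simp
  ultimately have r: "sqrt (norm p) / norm (B i) < r" "r < 1" unfolding r_def by blast+
  have r0: "0 < r" by (rule le_less_trans[OF _ r(1)]) simp
  have sq: "sqrt (norm p) < norm z * norm (B i)" if "r \<le> norm z" for z
    using less_le_trans[OF r(1) that] B0 by (simp add: field_simps)
  have Ap: "norm p < norm (z * B i) ^ 2" if "r \<le> norm z" for z
    using power_strict_mono[OF sq[OF that], of 2] by (simp add: norm_mult)
  have "norm p < (r * norm (B i)) ^ 2" using Ap[of "of_real r"] r0 by (simp add: norm_mult)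
  also have "\<dots> \<le> r * norm (B i)" using r0 r(2) B1
    by (simp add: power2_eq_square mult_left_le mult_le_one)
  finally have rp: "norm p < r * norm (B i)" .
  have a: "norm (p * q) / norm (B i) < norm q * r"
    using mult_strict_left_mono[OF rp, of "norm q"] q0 B0 by (simp add: norm_mult field_simps)
  have "(\<lambda>x. ebeta_normalised q p (t(i := x))) constant_on S"
    unfolding S_def
  proof (rule multiplicatively_periodic_on_annulus_imp_constant[OF _ _ q0 q a r(2)])
    show "(\<lambda>x. ebeta_normalised q p (t(i := x))) holomorphic_on {z. norm (p * q) / norm (B i) < norm z \<and> norm z < 1}"
      using ebeta_normalised_holomorphic(2)[of i t] t i B0 unfolding B_def by blast
    fix z :: complex assume z: "r \<le> norm z" "norm z < 1"
    have "ebeta_normalised q p ((t(i := z))(i := q * (t(i := z)) i)) = ebeta_normalised q p (t(i := z))"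
      by (rule ebeta_normalised_shift[OF q0 q p0 p _ _ i]) (use t z A Ap[OF z(1)] in auto)
    thus "ebeta_normalised q p (t(i := q * z)) = ebeta_normalised q p (t(i := z))" by simp
  qed auto
  thus ?thesis using xy by (auto simp: constant_on_def)
qed

text \<open>Coordinates are exchanged one at a time; the induction is on a set containing the
  indices where t and s differ. The exponent 10 makes |A|^2 > rho^10 >= |p| hold for all parameters
  involved. Each exchange uses only |B| >= rho^4.\<close>

lemma ebeta_normalised_constant_near_torus:
  fixes t s :: "nat \<Rightarrow> complex"
  assumes q0: "q \<noteq> 0" and p0: "p \<noteq> 0" and \<rho>: "0 < \<rho>" "norm p \<le> \<rho> ^ 10"
    and t: "\<And>j. j < 5 \<Longrightarrow> \<rho> < norm (t j) \<and> norm (t j) < 1"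
    and s: "\<And>j. j < 5 \<Longrightarrow> \<rho> < norm (s j) \<and> norm (s j) < 1"
  shows "ebeta_normalised q p t = ebeta_normalised q p s"
proof -
  have \<rho>1: "\<rho> < 1" using s[of 0] by auto
  have "\<forall>t. (\<forall>j<5. \<rho> < norm (t j) \<and> norm (t j) < 1) \<longrightarrow> {j. j < 5 \<and> t j \<noteq> s j} \<subseteq> I
      \<longrightarrow> ebeta_normalised q p t = ebeta_normalised q p s" if "finite I" for I
    using that
  proof (induction I)
    case empty
    thus ?case by (auto intro!: ebeta_normalised_cong)
  next
    case (insert i I)
    show ?case
    proof (intro allI impI)
      fix t assume t: "\<forall>j<5. \<rho> < norm (t j) \<and> norm (t j) < 1" and sub: "{j. j < 5 \<and> t j \<noteq> s j} \<subseteq> insert i I"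
      show "ebeta_normalised q p t = ebeta_normalised q p s"
      proof (cases "i < 5")
        case False
        hence "{j. j < 5 \<and> t j \<noteq> s j} \<subseteq> I" using sub by auto
        thus ?thesis using insert.IH t by blast
      next
        case i: True
        define B where "B = (\<Prod>j\<in>{..<5}-{i}. t j)"
        have "card ({..<5} - {i}) = 4" using i by (simp add: card_Diff_singleton)
        hence "\<rho> ^ 4 = (\<Prod>j\<in>{..<5}-{i}. \<rho>)" by simp
        also have "\<dots> \<le> norm B" unfolding B_def prod_norm[symmetric]
          using t \<rho> by (intro prod_mono) (auto intro: less_imp_le)
        finally have B: "\<rho> ^ 4 \<le> norm B" .
        hence B0: "B \<noteq> 0" using \<rho> by (auto dest: less_le_trans[OF zero_less_power[of \<rho> 4]])
        have "\<rho> ^ 10 < \<rho> ^ 8" using \<rho> \<rho>1 by (intro power_strict_decreasing) auto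
        also have "\<rho> ^ 8 = (\<rho> ^ 4) ^ 2" by (simp flip: power_mult)
        also have "\<dots> \<le> norm B ^ 2" using B \<rho> by (intro power_mono) auto
        finally have pB: "norm p < norm B ^ 2" using \<rho>(2) by simp
        have "norm p * norm q \<le> norm p" using q by (intro mult_left_le) auto
        also have "norm p < \<rho> ^ 5"
          by (rule le_less_trans[OF \<rho>(2)], rule power_strict_decreasing) (use \<rho> \<rho>1 in auto)
        also have "\<rho> ^ 5 = \<rho> * \<rho> ^ 4" by (simp add: numeral_eq_Suc)
        also have "\<dots> \<le> \<rho> * norm B" using B \<rho> by (intro mult_left_mono) auto
        finally have in_S: "norm (p * q) / norm B < \<rho>" using B0 by (simp add: norm_mult pos_divide_less_eq)
        have "ebeta_normalised q p (t(i := t i)) = ebeta_normalised q p (t(i := s i))"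
          by (rule ebeta_normalised_constant_in_one_variable[OF q0 p0 _ i])
             (use t s[OF i] i pB in_S in \<open>auto simp flip: B_def intro: less_trans\<close>)
        also have "\<dots> = ebeta_normalised q p s"
        proof -
          have "\<forall>j<5. \<rho> < norm ((t(i := s i)) j) \<and> norm ((t(i := s i)) j) < 1" using t s[OF i] by auto
          moreover have "{j. j < 5 \<and> (t(i := s i)) j \<noteq> s j} \<subseteq> I" using sub by auto
          ultimately show ?thesis using insert.IH by blast
        qed
        finally show ?thesis by simp
      qed
    qed
  qed
  from this[of "{..<5}"] show ?thesis using t by auto
qed

text \<open>Coordinates of modulus at most rho are removed one at a time. In such a coordinate the
  function is holomorphic on the annulus S and, by induction, constant on the part V with modulus
  above rho, hence constant on S.\<close>

lemma ebeta_normalised_constant: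
  fixes t s :: "nat \<Rightarrow> complex"
  assumes q0: "q \<noteq> 0" and p0: "p \<noteq> 0" and \<rho>: "0 < \<rho>" "norm p \<le> \<rho> ^ 10"
    and t: "ebeta_domain q p t"
    and s: "\<And>j. j < 5 \<Longrightarrow> \<rho> < norm (s j) \<and> norm (s j) < 1"
  shows "ebeta_normalised q p t = ebeta_normalised q p s"
proof -
  have \<rho>1: "\<rho> < 1" using s[of 0] by auto
  have "\<forall>t. ebeta_domain q p t \<longrightarrow> {j. j < 5 \<and> norm (t j) \<le> \<rho>} \<subseteq> I
      \<longrightarrow> ebeta_normalised q p t = ebeta_normalised q p s" if "finite I" for I
    using that
  proof (induction I)
    case empty
    show ?case
    proof (intro allI impI)
      fix t assume "ebeta_domain q p t" "{j. j < 5 \<and> norm (t j) \<le> \<rho>} \<subseteq> {}"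
      thus "ebeta_normalised q p t = ebeta_normalised q p s"
        by (intro ebeta_normalised_constant_near_torus[OF q0 p0 \<rho>] s) (auto simp: ebeta_domain_def not_le)
    qed
  next
    case (insert i I)
    show ?case
    proof (intro allI impI)
      fix t assume dom: "ebeta_domain q p t" and sub: "{j. j < 5 \<and> norm (t j) \<le> \<rho>} \<subseteq> insert i I"
      show "ebeta_normalised q p t = ebeta_normalised q p s"
      proof (cases "i < 5 \<and> norm (t i) \<le> \<rho>")
        case False
        hence "{j. j < 5 \<and> norm (t j) \<le> \<rho>} \<subseteq> I" using sub by auto
        thus ?thesis using insert.IH dom by blast
      next
        case True
        hence i: "i < 5" by blast
        define B where "B = (\<Prod>j\<in>{..<5}-{i}. t j)"
        define S where "S = {x::complex. norm (p * q) / norm B < norm x \<and> norm x < 1}"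
        define V where "V = {x::complex. \<rho> < norm x \<and> norm x < 1}"
        have A: "(\<Prod>j<5. t j) = t i * B" using i by (simp add: prod.remove[of "{..<5}" i] B_def)
        have B0: "B \<noteq> 0" using ebeta_domainD(2)[OF dom] unfolding A by auto
        have tS: "t i \<in> S" using ebeta_domainD(1,3)[OF dom] B0 i unfolding A
          by (auto simp: S_def norm_mult pos_divide_less_eq)
        have VS: "V \<subseteq> S" using tS True by (auto simp: S_def V_def)
        note hol = ebeta_normalised_holomorphic[of i t, OF _ i, folded B_def, OF _ B0, folded S_def]
        have "ebeta_normalised q p (t(i := t i)) = ebeta_normalised q p s"
        proof (rule analytic_continuation_open[of V S "\<lambda>x. ebeta_normalised q p (t(i := x))" "\<lambda>_. ebeta_normalised q p s" "t i"])
          have "of_real ((\<rho> + 1) / 2) \<in> V" using \<rho>(1) \<rho>1 unfolding V_def mem_Collect_eq norm_of_real by simp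
          thus "V \<noteq> {}" by blast
          show "(\<lambda>x. ebeta_normalised q p (t(i := x))) holomorphic_on S"
            by (rule hol(2)) (use ebeta_domainD(1)[OF dom] in auto)
          fix x assume x: "x \<in> V"
          have "ebeta_domain q p (t(i := x))"
            by (rule hol(1)) (use ebeta_domainD(1)[OF dom] x VS in auto)
          moreover have "{j. j < 5 \<and> norm ((t(i := x)) j) \<le> \<rho>} \<subseteq> I" using sub x by (auto simp: V_def)
          ultimately show "ebeta_normalised q p (t(i := x)) = ebeta_normalised q p s"
            using insert.IH by blast
        qed (use VS tS in \<open>auto simp: S_def V_def intro!: open_annulus connected_annulus_0\<close>)
        thus ?thesis by simp
      qed
    qed
  qed
  from this[of "{..<5}"] show ?thesis using t by auto
qed

end

section \<open>A limit of Poisson integrals\<close>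

lemma norm_circ_le_circ:
  assumes "continuous_on (sphere 0 1) f" "continuous_on (sphere 0 1) g"
    and "\<And>z. norm z = 1 \<Longrightarrow> norm (f z) \<le> (g z :: real)"
  shows "norm (circ f) \<le> Re (circ (\<lambda>z. of_real (g z)))"
proof -
  let ?e = "\<lambda>x::real. exp (2 * of_real pi * \<i> * of_real x)"
  have cont: "continuous_on {0..1} (\<lambda>x. g (?e x))"
    by (rule continuous_on_compose2[OF assms(2)]) (auto intro!: continuous_intros simp: exp_in_circle)
  have "norm (circ f) \<le> integral {0..1} (\<lambda>x. g (?e x))"
    unfolding circ_def
    by (intro integral_norm_bound_integral integrable_continuous_interval continuous_on_exp_circle assms cont)
       (use assms(3) exp_in_circle in auto)
  also have "complex_of_real (integral {0..1} (\<lambda>x. g (?e x))) = circ (\<lambda>z. of_real (g z))"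
    unfolding circ_def using integral_linear[OF integrable_continuous_interval[OF cont] bounded_linear_of_real[where 'a=complex]]
    by (simp add: o_def)
  hence "integral {0..1} (\<lambda>x. g (?e x)) = Re (circ (\<lambda>z. of_real (g z)))"
    by (metis Re_complex_of_real)
  finally show ?thesis .
qed

context
  fixes s :: real
  assumes s: "0 \<le> s" "s < 1"
begin

lemma poisson_denominator_nonzero:
  fixes z :: complex
  assumes "norm z = 1"
  shows "1 + s * z\<^sup>2 \<noteq> 0" "1 + s / z\<^sup>2 \<noteq> 0" "1 - s \<le> norm (1 + s * z\<^sup>2)" "norm (1 + s / z\<^sup>2) = norm (1 + s * z\<^sup>2)"
proof -
  have "1 - s \<le> norm (1 + s * z\<^sup>2)"
    using norm_triangle_ineq2[of 1 "- (s * z\<^sup>2)"] s assms by (simp add: norm_mult norm_power)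
  moreover have "norm (1 + s / z\<^sup>2) = norm (1 + s * z\<^sup>2)"
  proof -
    have "1 + s / z\<^sup>2 = cnj (1 + s * z\<^sup>2)"
      using assms by (simp add: complex_div_cnj[of s "z\<^sup>2"] norm_power)
    thus ?thesis by (simp only: complex_mod_cnj)
  qed
  ultimately show "1 - s \<le> norm (1 + s * z\<^sup>2)" "norm (1 + s / z\<^sup>2) = norm (1 + s * z\<^sup>2)"
    "1 + s * z\<^sup>2 \<noteq> 0" "1 + s / z\<^sup>2 \<noteq> 0" using s by auto
qed

text \<open>With a = s z^2 and b = s / z^2 one has (1 - a b) / ((1 + a) (1 + b)) = 1 / (1 + a) + 1 /
  (1 + b) - 1 and a b = s^2. The first two terms have mean 1, the value of 1 / (1 + s z^2) at
  0.\<close>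

lemma circ_poisson_kernel:
  "circ (\<lambda>z. 1 / ((1 + s * z\<^sup>2) * (1 + s / z\<^sup>2))) = 1 / (1 - s\<^sup>2)"
proof -
  let ?f = "\<lambda>z::complex. 1 / (1 + s * z\<^sup>2)"
  have ne: "1 + s * z\<^sup>2 \<noteq> 0" if "norm z \<le> 1" for z :: complex
  proof
    assume "1 + s * z\<^sup>2 = 0"
    hence "norm (of_real s * z\<^sup>2) = 1" by (metis add_eq_0_iff norm_minus_cancel norm_one)
    moreover have "norm (of_real s * z\<^sup>2) \<le> s" using s that by (simp add: norm_mult norm_power mult_left_le power_le_one)
    ultimately show False using s by simp
  qed
  have cont: "continuous_on (sphere 0 1) ?f" using ne by (auto intro!: continuous_intros)
  have "?f holomorphic_on cball 0 1" using ne by (auto intro!: holomorphic_intros)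
  hence "((\<lambda>u. ?f u / (u - 0)) has_contour_integral 2 * of_real pi * \<i> * ?f 0) (circlepath 0 1)"
    by (rule Cauchy_integral_circlepath_simple) simp
  hence "contour_integral (circlepath 0 1) (\<lambda>u. ?f u / u) = 2 * of_real pi * \<i>"
    by (simp add: contour_integral_unique)
  hence 1: "circ ?f = 1" unfolding contour_integral_eq_circ by simp
  have c2: "continuous_on (sphere 0 1) (\<lambda>z. ?f (1 / z))"
    by (rule continuous_on_compose2[OF cont]) (auto intro!: continuous_intros simp: norm_divide)
  have s2: "1 - (complex_of_real s)\<^sup>2 \<noteq> 0"
    using s by (metis diff_gt_0_iff_gt less_irrefl of_real_1 of_real_diff of_real_eq_0_iff of_real_power power_less_one_iff zero_less_numeral abs_of_nonneg power2_abs abs_square_less_1)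
  have "circ (\<lambda>z. 1 / ((1 + s * z\<^sup>2) * (1 + s / z\<^sup>2))) = circ (\<lambda>z. 1 / (1 - s\<^sup>2) * (?f z + (?f (1 / z) + (- 1))))"
  proof (rule circ_cong)
    fix z :: complex assume z: "norm z = 1"
    hence z0: "z \<noteq> 0" by auto
    define a where "a = s * z\<^sup>2"
    define b where "b = s / z\<^sup>2"
    have ab: "a * b = (complex_of_real s)\<^sup>2" using z0 by (simp add: a_def b_def power2_eq_square)
    have n: "1 + a \<noteq> 0" "1 + b \<noteq> 0" using poisson_denominator_nonzero[OF z] by (auto simp: a_def b_def)
    have "?f z + (?f (1 / z) + (- 1)) = 1 / (1 + a) + (1 / (1 + b) - 1)"
      by (simp add: a_def b_def power_divide)
    also have "\<dots> = (1 - a * b) / ((1 + a) * (1 + b))" using n by (simp add: field_simps)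
    finally show "1 / ((1 + s * z\<^sup>2) * (1 + s / z\<^sup>2)) = 1 / (1 - s\<^sup>2) * (?f z + (?f (1 / z) + (- 1)))"
      using s2 n by (simp add: ab flip: a_def b_def)
  qed
  also have "\<dots> = 1 / (1 - s\<^sup>2) * (circ ?f + (circ (\<lambda>z. ?f (1 / z)) + (-1)))"
    unfolding circ_cmult by (subst circ_add[OF cont], intro continuous_intros c2, subst circ_add[OF c2], intro continuous_intros, subst circ_const) simp
  also have "circ (\<lambda>z. ?f (1 / z)) = circ ?f" by (rule circ_reflect[OF cont])
  finally show ?thesis by (simp add: 1)
qed

end

text \<open>z^2 + 1 factors as (z - i) (z + i), and two factors of modulus at least d have a product
  of modulus at least d^2.\<close>

lemma square_plus_one_small_imp_near_i:
  fixes z :: complex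
  assumes "norm (z\<^sup>2 + 1) < d\<^sup>2" "0 < d"
  shows "norm (z - \<i>) < d \<or> norm (z - (- \<i>)) < d"
proof (rule ccontr)
  assume "\<not> ?thesis"
  hence "d * d \<le> norm (z - \<i>) * norm (z - (- \<i>))" using assms by (intro mult_mono) auto
  also have "\<dots> = norm (z\<^sup>2 + 1)" by (simp flip: norm_mult) (simp add: algebra_simps power2_eq_square)
  finally show False using assms by (simp add: power2_eq_square)
qed

text \<open>The kernel times 1 - r^4 has mean 1 and concentrates at i and -i as r tends to 1. Here
  the factor is 1 - r^2 = (1 - r^4) / (1 + r^2), whence the limit c / 2.\<close>

lemma poisson_limit:
  fixes H :: "real \<Rightarrow> complex \<Rightarrow> complex"
  assumes b: "0 < b" "b < 1"
    and cont: "continuous_on ({b..1} \<times> sphere 0 1) (\<lambda>(r, z). H r z)"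
    and c: "H 1 \<i> = c" "H 1 (- \<i>) = c"
  shows "((\<lambda>r. (1 - r\<^sup>2) * circ (\<lambda>z. H r z / ((1 + r\<^sup>2 * z\<^sup>2) * (1 + r\<^sup>2 / z\<^sup>2)))) \<longlongrightarrow> c / 2) (at_left 1)"
proof -
  let ?K = "{b..1} \<times> sphere (0::complex) 1"
  let ?den = "\<lambda>r z. (1 + r\<^sup>2 * z\<^sup>2) * (1 + r\<^sup>2 / z\<^sup>2) :: complex"
  have "compact ?K" by (intro compact_Times) auto
  hence "bounded ((\<lambda>(r, z). H r z) ` ?K)" using compact_continuous_image[OF cont] compact_imp_bounded by blast
  then obtain M where M: "\<And>r z. r \<in> {b..1} \<Longrightarrow> norm z = 1 \<Longrightarrow> norm (H r z) \<le> M" and M0: "0 < M"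
    unfolding bounded_pos by fastforce
  have contH: "continuous_on (sphere 0 1) (H r)" if "r \<in> {b..1}" for r
  proof -
    have "continuous_on (sphere 0 1) (\<lambda>z::complex. (r, z))" by (intro continuous_intros)
    from continuous_on_compose2[OF cont this] show ?thesis using that by fastforce
  qed
  have split: "(1 - r\<^sup>2) * circ (\<lambda>z. H r z / ?den r z)
       = (1 - r\<^sup>2) * circ (\<lambda>z. (H r z - c) / ?den r z) + c / (1 + r\<^sup>2)" if r: "b \<le> r" "r < 1" for r
  proof -
    have r2: "0 \<le> r\<^sup>2" "r\<^sup>2 < 1" using r b by (auto simp: power_less_one_iff)
    note den = poisson_denominator_nonzero[OF r2]
    have cH: "continuous_on (sphere 0 1) (H r)"
      using contH[of r] r by simp
    have c1: "continuous_on (sphere 0 1) (\<lambda>z. (H r z - c) / ?den r z)"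
      using den by (intro continuous_intros cH) auto
    have c2: "continuous_on (sphere 0 1) (\<lambda>z. 1 / ?den r z)"
      using den by (intro continuous_intros) auto
    have "circ (\<lambda>z. H r z / ?den r z) = circ (\<lambda>z. (H r z - c) / ?den r z + c * (1 / ?den r z))"
      by (rule circ_cong) (simp add: diff_divide_distrib)
    also have "\<dots> = circ (\<lambda>z. (H r z - c) / ?den r z) + c * circ (\<lambda>z. 1 / ?den r z)"
      by (subst circ_add[OF c1], intro continuous_intros c2, subst circ_cmult) simp
    also have "circ (\<lambda>z. 1 / ?den r z) = of_real (1 / (1 - (r\<^sup>2)\<^sup>2))"
      using circ_poisson_kernel[OF r2] by simp
    also have "1 - (r\<^sup>2)\<^sup>2 = (1 - r\<^sup>2) * (1 + r\<^sup>2)" by (simp add: algebra_simps power2_eq_square)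
    finally have eq: "circ (\<lambda>z. H r z / ?den r z) = circ (\<lambda>z. (H r z - c) / ?den r z) + c * of_real (1 / ((1 - r\<^sup>2) * (1 + r\<^sup>2)))" .
    have "complex_of_real (1 - r\<^sup>2) \<noteq> 0" "complex_of_real (1 + r\<^sup>2) \<noteq> 0"
      using r2 by (simp_all only: of_real_eq_0_iff)
    hence "(1 - (complex_of_real r)\<^sup>2) * (c * of_real (1 / ((1 - r\<^sup>2) * (1 + r\<^sup>2)))) = c / (1 + (complex_of_real r)\<^sup>2)"
      by simp
    thus ?thesis unfolding eq distrib_left[of "1 - (complex_of_real r)\<^sup>2"] by simp
  qed
  have lim1: "((\<lambda>r. (1 - r\<^sup>2) * circ (\<lambda>z. (H r z - c) / ?den r z)) \<longlongrightarrow> 0) (at_left 1)"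
  proof (rule tendstoI)
    fix e :: real assume e: "0 < e"
    obtain d where d: "0 < d" "\<And>r z. r \<in> {b..1} \<Longrightarrow> norm z = 1 \<Longrightarrow> 1 - r < d \<Longrightarrow> norm (z\<^sup>2 + 1) < d\<^sup>2 \<Longrightarrow> norm (H r z - c) \<le> e / 2"
    proof -
      have "\<exists>d>0. \<forall>y\<in>?K. dist y (1, w) < d \<longrightarrow> dist ((\<lambda>(r, z). H r z) y) (H 1 w) < e / 2" if "norm w = 1" for w
        using cont[unfolded continuous_on_iff, rule_format, of "(1, w)" "e / 2"] that b e by auto
      from this[of \<i>] this[of "- \<i>"] obtain d1 d2 where d12: "d1 > 0" "d2 > 0"
        "\<And>y. y \<in> ?K \<Longrightarrow> dist y (1, \<i>) < d1 \<Longrightarrow> dist ((\<lambda>(r, z). H r z) y) c < e / 2"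
        "\<And>y. y \<in> ?K \<Longrightarrow> dist y (1, - \<i>) < d2 \<Longrightarrow> dist ((\<lambda>(r, z). H r z) y) c < e / 2"
        using c by auto
      define d where "d = min d1 d2 / 2"
      have "d > 0" using d12 by (simp add: d_def)
      moreover have "norm (H r z - c) \<le> e / 2"
        if rz: "r \<in> {b..1}" "norm z = 1" "1 - r < d" "norm (z\<^sup>2 + 1) < d\<^sup>2" for r z
      proof -
        have close: "dist (r, z) (1, w) < min d1 d2" if "norm (z - w) < d" for w
        proof -
          have "dist (r, z) (1, w) \<le> dist r 1 + dist z w" by (simp add: dist_Pair_Pair real_sqrt_sum_squares_less sqrt_sum_squares_le_sum)
          also have "\<dots> < d + d" using rz that by (intro add_strict_mono) (auto simp: dist_norm)
          finally show ?thesis by (simp add: d_def)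
        qed
        from square_plus_one_small_imp_near_i[OF rz(4) \<open>d > 0\<close>] show ?thesis
        proof
          assume "norm (z - \<i>) < d"
          from close[OF this] d12(3)[of "(r, z)"] rz show ?thesis by (auto simp: dist_norm)
        next
          assume "norm (z - (- \<i>)) < d"
          from close[OF this] d12(4)[of "(r, z)"] rz show ?thesis by (auto simp: dist_norm)
        qed
      qed
      ultimately show ?thesis by (rule that)
    qed
    \<comment> \<open>Away from i and -i, where |z^2 + 1| >= d^2, the deviation of H from c is at
      most M' |z^2 + 1|^2. Since |z^2 + 1| <= 2 |1 + r^2 z^2|, this cancels the denominator and
      leaves 4 M' (1 - r^2), which tends to 0.\<close>
    define M' where "M' = (M + norm c) / (d\<^sup>2)\<^sup>2"
    have M'0: "0 \<le> M'" using M0 by (simp add: M'_def)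
    have bound: "norm ((1 - r\<^sup>2) * circ (\<lambda>z. (H r z - c) / ?den r z)) \<le> e / 2 + M' * 4 * (1 - r\<^sup>2)"
      if r: "b \<le> r" "r < 1" "1 - r < d" for r
    proof -
      have r2: "0 \<le> r\<^sup>2" "r\<^sup>2 < 1" using r b by (auto simp: power_less_one_iff)
      note den = poisson_denominator_nonzero[OF r2]
      have cH: "continuous_on (sphere 0 1) (H r)"
        using contH[of r] r by simp
      have c1: "continuous_on (sphere 0 1) (\<lambda>z. (1 - r\<^sup>2) * ((H r z - c) / ?den r z))"
        using den by (intro continuous_intros cH) auto
      define g where "g = (\<lambda>z. e / 2 * (1 - r\<^sup>2) / norm (?den r z) + M' * 4 * (1 - r\<^sup>2))"
      have c2: "continuous_on (sphere 0 1) g"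
        unfolding g_def using den by (intro continuous_intros) auto
      have c3: "continuous_on (sphere 0 1) (\<lambda>z. complex_of_real (e / 2 * (1 - r\<^sup>2)) * (1 / ?den r z))"
        using den by (intro continuous_intros) auto
      \<comment> \<open>On the unit circle the two factors are complex conjugates, so the majorant g
        is itself a Poisson kernel plus a constant and its mean is known.\<close>
      have den_real: "?den r z = of_real (norm (?den r z))" if "norm z = 1" for z
      proof -
        have "1 + (of_real r)\<^sup>2 / z\<^sup>2 = cnj (1 + (of_real r)\<^sup>2 * z\<^sup>2)"
          using that by (simp add: complex_div_cnj[of _ "z\<^sup>2"] norm_power)
        hence eq: "?den r z = of_real ((norm (1 + (complex_of_real r)\<^sup>2 * z\<^sup>2))\<^sup>2)"
          by (simp only: complex_norm_square)
        show ?thesis unfolding eq by (simp add: norm_power)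
      qed
      have pt: "norm ((1 - r\<^sup>2) * ((H r z - c) / ?den r z)) \<le> g z" if z: "norm z = 1" for z
      proof -
        let ?N = "norm (1 + of_real (r\<^sup>2) * z\<^sup>2)"
        have N: "norm (?den r z) = ?N ^ 2" using den(4)[OF z] by (simp add: norm_mult power2_eq_square)
        have Npos: "0 < ?N" using den(1)[OF z] by simp
        have H: "norm (H r z - c) \<le> e / 2 + M' * (norm (z\<^sup>2 + 1))\<^sup>2"
        proof (cases "norm (z\<^sup>2 + 1) < d\<^sup>2")
          case True
          thus ?thesis using d(2)[of r z] r z M'0 by (auto intro: add_increasing2)
        next
          case False
          have "norm (H r z - c) \<le> M + norm c"
            using norm_triangle_ineq4[of "H r z" c] M[of r z] r z by auto
          also have "\<dots> = M' * (d\<^sup>2)\<^sup>2" using d(1) by (simp add: M'_def)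
          also have "\<dots> \<le> M' * (norm (z\<^sup>2 + 1))\<^sup>2" using False M'0 by (intro mult_left_mono power_mono) auto
          finally show ?thesis using e by simp
        qed
        have "norm (z\<^sup>2 + 1) \<le> norm (1 + of_real (r\<^sup>2) * z\<^sup>2) + norm ((1 - of_real (r\<^sup>2)) * z\<^sup>2)"
          by (rule order_trans[OF _ norm_triangle_ineq]) (simp add: algebra_simps)
        also have "norm ((1 - complex_of_real (r\<^sup>2)) * z\<^sup>2) = 1 - r\<^sup>2"
        proof -
          have eq: "1 - complex_of_real (r\<^sup>2) = of_real (1 - r\<^sup>2)" by simp
          show ?thesis unfolding norm_mult eq norm_of_real using z r2 by (simp add: norm_power)
        qed
        also have "1 - r\<^sup>2 \<le> ?N" by (rule den(3)[OF z])
        finally have "norm (z\<^sup>2 + 1) \<le> 2 * ?N" by simp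
        hence "(norm (z\<^sup>2 + 1))\<^sup>2 \<le> (2 * ?N)\<^sup>2" by (intro power_mono) auto
        hence "M' * (norm (z\<^sup>2 + 1))\<^sup>2 \<le> M' * (4 * ?N ^ 2)" using M'0 by (intro mult_left_mono) (auto simp: power_mult_distrib)
        with H have "norm (H r z - c) \<le> e / 2 + M' * 4 * ?N ^ 2" by simp
        hence "(1 - r\<^sup>2) * norm (H r z - c) / ?N ^ 2 \<le> (1 - r\<^sup>2) * (e / 2 + M' * 4 * ?N ^ 2) / ?N ^ 2"
          using r2 by (intro divide_right_mono mult_left_mono) auto
        also have "\<dots> = e / 2 * (1 - r\<^sup>2) / ?N ^ 2 + M' * 4 * (1 - r\<^sup>2)" using Npos by (simp add: field_simps)
        finally have "(1 - r\<^sup>2) * norm (H r z - c) / norm (?den r z) \<le> g z" unfolding g_def N .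
        moreover have "norm ((1 - complex_of_real r ^ 2)) = 1 - r\<^sup>2"
          using r2 by (metis abs_of_pos diff_gt_0_iff_gt norm_of_real of_real_1 of_real_diff of_real_power)
        ultimately show ?thesis by (simp add: norm_mult norm_divide)
      qed
      have "norm ((1 - r\<^sup>2) * circ (\<lambda>z. (H r z - c) / ?den r z)) = norm (circ (\<lambda>z. (1 - r\<^sup>2) * ((H r z - c) / ?den r z)))"
        by (simp only: circ_cmult)
      also have "\<dots> \<le> Re (circ (\<lambda>z. of_real (g z)))" by (rule norm_circ_le_circ[OF c1 c2 pt])
      also have "circ (\<lambda>z. of_real (g z)) = circ (\<lambda>z. of_real (e / 2 * (1 - r\<^sup>2)) * (1 / ?den r z) + of_real (M' * 4 * (1 - r\<^sup>2)))"
      proof (rule circ_cong)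
        fix z :: complex assume z: "norm z = 1"
        define N where "N = norm (?den r z)"
        have N: "?den r z = of_real N" unfolding N_def by (rule den_real[OF z])
        have gz: "g z = e / 2 * (1 - r\<^sup>2) / N + M' * 4 * (1 - r\<^sup>2)" by (simp add: g_def N_def)
        show "of_real (g z) = of_real (e / 2 * (1 - r\<^sup>2)) * (1 / ?den r z) + of_real (M' * 4 * (1 - r\<^sup>2))"
          unfolding N gz by simp
      qed
      also have "\<dots> = of_real (e / 2 * (1 - r\<^sup>2)) * circ (\<lambda>z. 1 / ?den r z) + of_real (M' * 4 * (1 - r\<^sup>2))"
        by (subst circ_add[OF c3], intro continuous_intros, subst circ_cmult, subst circ_const) simp
      also have "circ (\<lambda>z. 1 / ?den r z) = of_real (1 / (1 - (r\<^sup>2)\<^sup>2))"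
        using circ_poisson_kernel[OF r2] by simp
      also have "Re (of_real (e / 2 * (1 - r\<^sup>2)) * of_real (1 / (1 - (r\<^sup>2)\<^sup>2)) + of_real (M' * 4 * (1 - r\<^sup>2)))
           = e / 2 * ((1 - r\<^sup>2) / (1 - (r\<^sup>2)\<^sup>2)) + M' * 4 * (1 - r\<^sup>2)" by simp
      also have "(1 - r\<^sup>2) / (1 - (r\<^sup>2)\<^sup>2) = 1 / (1 + r\<^sup>2)"
      proof -
        have "1 - (r\<^sup>2)\<^sup>2 = (1 - r\<^sup>2) * (1 + r\<^sup>2)" by (simp add: algebra_simps power2_eq_square)
        thus ?thesis using r2 by simp
      qed
      also have "e / 2 * (1 / (1 + r\<^sup>2)) \<le> e / 2 * 1" using e r2 by (intro mult_left_mono) (auto simp: add_pos_nonneg)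
      finally show ?thesis by simp
    qed
    have "((\<lambda>r. e / 2 + M' * 4 * (1 - r\<^sup>2)) \<longlongrightarrow> e / 2 + M' * 4 * (1 - 1\<^sup>2)) (at_left 1)"
      by (intro tendsto_intros)
    hence "eventually (\<lambda>r. e / 2 + M' * 4 * (1 - r\<^sup>2) < e) (at_left 1)"
      by (rule order_tendstoD) (use e in auto)
    moreover have "eventually (\<lambda>r. r \<in> {max b (1 - d)<..<1}) (at_left (1::real))"
      by (rule eventually_at_left_real) (use b d in auto)
    ultimately show "eventually (\<lambda>r. dist ((1 - r\<^sup>2) * circ (\<lambda>z. (H r z - c) / ?den r z)) 0 < e) (at_left 1)"
    proof eventually_elim
      case (elim r)
      thus ?case using bound[of r] by (simp add: dist_norm) 
    qed
  qed
  have "((\<lambda>r. (1 - r\<^sup>2) * circ (\<lambda>z. (H r z - c) / ?den r z) + c / (1 + (of_real r)\<^sup>2)) \<longlongrightarrow> 0 + c / (1 + (of_real 1)\<^sup>2)) (at_left 1)"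
    by (intro tendsto_intros lim1) auto
  moreover have "eventually (\<lambda>r. r \<in> {b<..<1}) (at_left (1::real))"
    by (rule eventually_at_left_real) (use b in auto)
  hence "eventually (\<lambda>r. (1 - r\<^sup>2) * circ (\<lambda>z. (H r z - c) / ?den r z) + c / (1 + (of_real r)\<^sup>2)
       = (1 - r\<^sup>2) * circ (\<lambda>z. H r z / ?den r z)) (at_left 1)"
    by eventually_elim (use split in auto)
  ultimately show ?thesis by (simp add: tendsto_cong)
qed

section \<open>Evaluation of the elliptic beta integral\<close>

text \<open>This is (1 - x) * Gamma(x), continued to the pole x = 1.\<close>

definition ell_gamma_reg :: "complex \<Rightarrow> complex \<Rightarrow> complex \<Rightarrow> complex" where
  "ell_gamma_reg q p x = qpoch2 q p (p * q / x) / (qpoch (p * x) p * qpoch (q * x) q * qpoch2 q p (p * (q * x)))"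

context
  fixes q p :: complex
  assumes q: "norm q < 1" and p: "norm p < 1"
begin

lemma ell_gamma_eq_reg: "ell_gamma q p x = ell_gamma_reg q p x / (1 - x)"
  unfolding ell_gamma_eq[OF q p] ell_gamma_reg_def qpoch2_step_q[OF q p, of x]
    qpoch_step[OF p, of x] qpoch2_step_p[OF q p, of "q * x"]
  by (simp add: mult_ac)

lemma ell_gamma_reg_nonzero_parts:
  assumes "norm x \<le> 1"
  shows "qpoch (p * x) p * qpoch (q * x) q * qpoch2 q p (p * (q * x)) \<noteq> 0"
proof -
  have "norm (p * x) < 1" "norm (q * x) < 1"
    using assms mult_left_le[of "norm x" "norm p"] mult_left_le[of "norm x" "norm q"] p q by (simp_all add: norm_mult)
  moreover from this have "norm (p * (q * x)) < 1" using norm_mult_less_1[of p "q * x"] p by simp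
  ultimately show ?thesis using p q qpoch_nonzero qpoch2_nonzero by simp
qed

lemma ell_gamma_reg_1: "ell_gamma_reg q p 1 = 1 / (qpoch p p * qpoch q q)"
  using ell_gamma_reg_nonzero_parts[of 1] by (simp add: ell_gamma_reg_def)

lemma ell_gamma_reg_nonzero:
  assumes "norm (p * q) < norm x" "norm x \<le> 1"
  shows "ell_gamma_reg q p x \<noteq> 0"
proof -
  have "norm (p * q / x) < 1" using assms by (auto simp: norm_divide divide_simps)
  thus ?thesis unfolding ell_gamma_reg_def
    using ell_gamma_reg_nonzero_parts[OF assms(2)] qpoch2_nonzero[OF q p] by simp
qed

lemma continuous_on_ell_gamma_reg:
  assumes "continuous_on S f" "\<And>x. x \<in> S \<Longrightarrow> f x \<noteq> 0" "\<And>x. x \<in> S \<Longrightarrow> norm (f x) \<le> 1"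
  shows "continuous_on S (\<lambda>x. ell_gamma_reg q p (f x))"
  unfolding ell_gamma_reg_def
  by (rule continuous_on_divide; (intro ballI ell_gamma_reg_nonzero_parts continuous_intros)?)
     (use assms p q in auto)

text \<open>With t_0 = i r and t_1 = -i r the four Gamma factors in t_0 and t_1 contribute 1 / ((1 +
  r^2 z^2) (1 + r^2 / z^2)), while Gamma(t_0 t_1) = Gamma(r^2) in the normalising denominator
  contributes 1 - r^2. This is the situation of \<open>poisson_limit\<close>.\<close>

lemma ebeta_limit_value:
  assumes b: "0 < b" "b < 1" "norm (p * q) < b ^ 5"
    and const: "\<And>r. b \<le> r \<Longrightarrow> r < 1 \<Longrightarrow>
      ebeta_normalised q p (\<lambda>j. if j = 0 then \<i> * of_real r else if j = 1 then - \<i> * of_real r else of_real b) = C"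
  shows "C = 2 / (qpoch p p * qpoch q q)"
proof -
  let ?T = "\<lambda>r (j::nat). if j = 0 then \<i> * of_real r else if j = 1 then - \<i> * of_real r else complex_of_real b"
  let ?G = "ell_gamma q p" and ?g = "ell_gamma_reg q p"
  define A where "A = (\<lambda>r. complex_of_real (r\<^sup>2 * b ^ 3))"
  \<comment> \<open>H is the integrand without the Poisson kernel, and E below is the normalisation
    without the factor 1 - r^2; both stay continuous up to r = 1.\<close>
  define H :: "real \<Rightarrow> complex \<Rightarrow> complex" where "H = (\<lambda>r (z::complex). ?g (\<i> * of_real r * z) * ?g (\<i> * of_real r / z) * ?g (- \<i> * of_real r * z) * ?g (- \<i> * of_real r / z)
      * (?G (of_real b * z) * ?G (of_real b / z)) ^ 3 * (theta p (z\<^sup>2) * theta q (1 / z\<^sup>2)) / (?G (A r * z) * ?G (A r / z)))"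
  define E :: "real \<Rightarrow> complex" where "E = (\<lambda>r. ?G (A r / (\<i> * of_real r)) * ?G (A r / (- \<i> * of_real r)) * ?G (A r / b) ^ 3
      / (?g (of_real (r\<^sup>2)) * (?G (\<i> * of_real r * b) * ?G (- \<i> * of_real r * b)) ^ 3 * ?G (b * b) ^ 3))"
  have ii: "\<i> * x * (\<i> * y) = - (x * y)" for x y
  proof -
    have "\<i> * x * (\<i> * y) = (\<i> * \<i>) * (x * y)" by (simp only: mult_ac)
    thus ?thesis by simp
  qed
  have r_bounds: "0 < r" "r\<^sup>2 \<le> 1" "b ^ 5 \<le> r\<^sup>2 * b ^ 3" "r\<^sup>2 * b ^ 3 < 1" "b ^ 5 < r * b" "b ^ 5 < b * b" "b ^ 5 < r\<^sup>2"
     "r * b < 1" "r * b ^ 3 < 1" "r\<^sup>2 * b\<^sup>2 < 1" if "r \<in> {b..1}" for r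
  proof -
    show r0: "0 < r" using that b by auto
    show r1: "r\<^sup>2 \<le> 1" using that r0 by (auto simp: power_le_one)
    have "b ^ 5 = b\<^sup>2 * b ^ 3" by (simp flip: power_add)
    also have "\<dots> \<le> r\<^sup>2 * b ^ 3" using that b by (intro mult_right_mono power_mono) auto
    finally show "b ^ 5 \<le> r\<^sup>2 * b ^ 3" .
    have lt: "c * b ^ n < 1" if "0 \<le> c" "c \<le> 1" "0 < n" for c n
    proof -
      have "c * b ^ n \<le> 1 * b ^ n" using that b by (intro mult_right_mono) auto
      also have "\<dots> < 1" using that b by (simp add: power_less_one_iff)
      finally show ?thesis .
    qed
    show "r\<^sup>2 * b ^ 3 < 1" "r * b < 1" "r * b ^ 3 < 1" "r\<^sup>2 * b\<^sup>2 < 1"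
      using lt[of "r\<^sup>2" 3] lt[of r 1] lt[of r 3] lt[of "r\<^sup>2" 2] r0 r1 that by auto
    have "b ^ 5 < b ^ 2" by (rule power_strict_decreasing) (use b in auto)
    moreover have "b ^ 2 \<le> r\<^sup>2" "b\<^sup>2 \<le> r * b" using that b by (auto simp: power2_eq_square mult_mono)
    ultimately show "b ^ 5 < r * b" "b ^ 5 < b * b" "b ^ 5 < r\<^sup>2" by (auto simp: power2_eq_square)
  qed
  have normA: "norm (A r) = r\<^sup>2 * b ^ 3" for r using b by (simp add: A_def norm_mult norm_power)
  have A_b: "norm (p * q) < norm (A r)" "norm (A r) < 1" "A r \<noteq> 0" if "r \<in> {b..1}" for r
    using r_bounds[OF that] b unfolding normA by (auto simp: A_def)
  have AG: "?G (A r * z) \<noteq> 0" "?G (A r / z) \<noteq> 0" if "r \<in> {b..1}" "norm z = 1" for r and z :: complex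
    by (rule ell_gamma_nonzero[OF q p]; use A_b[OF that(1)] that(2) in \<open>simp add: norm_mult norm_divide\<close>)+
  have eq: "ebeta_normalised q p (?T r) = (1 - r\<^sup>2) * circ (\<lambda>z. H r z / ((1 + r\<^sup>2 * z\<^sup>2) * (1 + r\<^sup>2 / z\<^sup>2))) * E r"
    if r: "b \<le> r" "r < 1" for r
  proof -
    have P: "(\<Prod>j<5. f (?T r j)) = f (\<i> * of_real r) * f (- \<i> * of_real r) * f (of_real b) ^ 3" for f :: "complex \<Rightarrow> complex"
      by (simp add: numeral_eq_Suc)
    have A: "(\<Prod>j<5. ?T r j) = A r"
      using P[of "\<lambda>x. x"] by (simp add: A_def power2_eq_square ii)
    have W: "ebeta_weight q p (?T r) z = H r z / ((1 + r\<^sup>2 * z\<^sup>2) * (1 + r\<^sup>2 / z\<^sup>2))" if z: "norm z = 1" for z :: complex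
    proof -
      have f: "1 + (of_real r)\<^sup>2 * z\<^sup>2 = (1 - \<i> * of_real r * z) * (1 - (- \<i> * of_real r * z))"
        "1 + (of_real r)\<^sup>2 / z\<^sup>2 = (1 - \<i> * of_real r / z) * (1 - (- \<i> * of_real r / z))"
        by (simp_all add: algebra_simps power2_eq_square)
      show ?thesis
        unfolding ebeta_weight_def A P[of "\<lambda>x. ?G (x * z) * ?G (x / z)"] H_def of_real_power f
          ell_gamma_eq_reg[of "\<i> * of_real r * z"] ell_gamma_eq_reg[of "\<i> * of_real r / z"]
          ell_gamma_eq_reg[of "- \<i> * of_real r * z"] ell_gamma_eq_reg[of "- \<i> * of_real r / z"]
        by (simp add: divide_inverse mult_ac)
    qed
    have pairs: "(\<Prod>k<5. \<Prod>j<k. ?G (?T r j * ?T r k)) = ?G (\<i> * of_real r * (- \<i> * of_real r))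
        * (?G (\<i> * of_real r * b) * ?G (- \<i> * of_real r * b)) ^ 3 * ?G (b * b) ^ 3"
      by (simp add: numeral_eq_Suc)
    have r2: "\<i> * of_real r * (- \<i> * of_real r) = of_real (r\<^sup>2)" by (simp add: power2_eq_square ii)
    have "circ (ebeta_weight q p (?T r)) = circ (\<lambda>z. H r z / ((1 + r\<^sup>2 * z\<^sup>2) * (1 + r\<^sup>2 / z\<^sup>2)))"
      by (rule circ_cong) (rule W)
    thus ?thesis
      unfolding ebeta_normalised_def A P[of "\<lambda>x. ?G (A r / x)"] pairs r2 ell_gamma_eq_reg[of "of_real (r\<^sup>2)"] E_def
      by (simp add: divide_inverse mult_ac)
  qed
  let ?K = "{b..1} \<times> sphere (0::complex) 1"
  have K: "fst y \<in> {b..1}" "norm (snd y) = 1" "snd y \<noteq> 0" "0 < fst y" "fst y \<le> 1" if "y \<in> ?K" for y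
    using that b by auto
  have contA: "continuous_on S (\<lambda>y. A (f y))" if "continuous_on S f" for S and f :: "'x::topological_space \<Rightarrow> real"
    unfolding A_def using that by (intro continuous_intros)
  have cA: "continuous_on ?K (\<lambda>y. ?G (A (fst y) * snd y))" "continuous_on ?K (\<lambda>y. ?G (A (fst y) / snd y))"
    by (intro continuous_on_ell_gamma continuous_intros contA; use K A_b q p in \<open>force simp: norm_mult norm_divide\<close>)+
  have cb: "continuous_on ?K (\<lambda>y. ?G (of_real b * snd y))" "continuous_on ?K (\<lambda>y. ?G (of_real b / snd y))"
    by (intro continuous_on_ell_gamma continuous_intros; use K b q p in \<open>force simp: norm_mult norm_divide\<close>)+
  have cg: "continuous_on ?K (\<lambda>y. ?g (c * of_real (fst y) * snd y))" "continuous_on ?K (\<lambda>y. ?g (c * of_real (fst y) / snd y))"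
    if "norm c = 1" for c
    by (intro continuous_on_ell_gamma_reg continuous_intros; use K that in \<open>force simp: norm_mult norm_divide\<close>)+
  have ct: "continuous_on ?K (\<lambda>y. theta p ((snd y)\<^sup>2))" "continuous_on ?K (\<lambda>y. theta q (1 / (snd y)\<^sup>2))"
    by (intro continuous_intros; use K q p in \<open>force\<close>)+
  have AG': "?G (A (fst y) * snd y) * ?G (A (fst y) / snd y) \<noteq> 0" if "y \<in> ?K" for y
    using AG[OF K(1,2)[OF that]] by simp
  have "continuous_on ?K (\<lambda>y. H (fst y) (snd y))"
    unfolding H_def
    by (intro continuous_on_divide continuous_on_mult continuous_on_power cA cb cg ct ballI AG') simp_all
  hence contH: "continuous_on ({b..1} \<times> sphere 0 1) (\<lambda>(r, z). H r z)" by (simp add: case_prod_unfold)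
  have Edenom: "?g (of_real (r\<^sup>2)) \<noteq> 0" "?G (\<i> * of_real r * b) \<noteq> 0" "?G (- \<i> * of_real r * b) \<noteq> 0" "?G (b * b) \<noteq> 0"
    if "r \<in> {b..1}" for r
  proof -
    show "?g (of_real (r\<^sup>2)) \<noteq> 0"
      by (rule ell_gamma_reg_nonzero) (use r_bounds[OF that] b in \<open>auto simp: norm_power\<close>)
    show "?G (\<i> * of_real r * b) \<noteq> 0" "?G (- \<i> * of_real r * b) \<noteq> 0" "?G (b * b) \<noteq> 0"
      by (rule ell_gamma_nonzero[OF q p]; use r_bounds[OF that] b mult_strict_mono[of b 1 b 1] in \<open>simp add: norm_mult\<close>)+
  qed
  have Enum: "norm (A r / (\<i> * of_real r)) < 1" "norm (A r / (- \<i> * of_real r)) < 1" "norm (A r / b) < 1"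
    if "r \<in> {b..1}" for r
    unfolding norm_divide normA using r_bounds[OF that] b
    by (simp_all add: norm_mult power2_eq_square power3_eq_cube mult_ac)
  have contE: "continuous_on {b..1} E"
  proof -
    have r: "0 < r" "r \<le> 1" if "r \<in> {b..1}" for r using that b by auto
    have e1: "continuous_on {b..1} (\<lambda>r. ?G (A r / (c * of_real r)))" if "norm c = 1" for c
      using that by (intro continuous_on_ell_gamma continuous_intros contA)
        (use Enum(1) A_b(3) r(1) q p in \<open>force simp: norm_mult norm_divide\<close>)+
    have e2: "continuous_on {b..1} (\<lambda>r. ?G (A r / of_real b))"
      by (intro continuous_on_ell_gamma continuous_intros contA)
         (use Enum(3) A_b(3) b q p in \<open>force\<close>)+
    have e3: "continuous_on {b..1} (\<lambda>r. ?g (of_real (r\<^sup>2)))"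
    proof (intro continuous_on_ell_gamma_reg continuous_intros)
      fix r assume "r \<in> {b..1}"
      thus "complex_of_real (r\<^sup>2) \<noteq> 0" "norm (complex_of_real (r\<^sup>2)) \<le> 1"
        unfolding norm_of_real of_real_eq_0_iff using r(1)[of r] r_bounds(2)[of r] by simp_all
    qed
    have e4: "continuous_on {b..1} (\<lambda>r. ?G (c * of_real r * of_real b))" if "norm c = 1" for c
    proof (intro continuous_on_ell_gamma continuous_intros q p)
      fix r assume "r \<in> {b..1}"
      thus "c * of_real r * of_real b \<noteq> 0" "norm (c * of_real r * of_real b) < 1"
        unfolding norm_mult norm_of_real using that r(1)[of r] r_bounds(8)[of r] b by auto
    qed
    have e5: "?g (of_real (r\<^sup>2)) * (?G (\<i> * of_real r * b) * ?G (- \<i> * of_real r * b)) ^ 3 * ?G (b * b) ^ 3 \<noteq> 0"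
      if "r \<in> {b..1}" for r using Edenom[OF that] by simp
    show ?thesis
      unfolding E_def
      by (intro continuous_on_divide continuous_on_mult continuous_on_power continuous_on_const ballI e1 e2 e3 e4 e5) simp_all
  qed
  have E1: "(E \<longlongrightarrow> E 1) (at_left 1)"
    by (rule continuous_on_Icc_at_leftD[OF contE b(2)])
  have c: "H 1 (- \<i>) = H 1 \<i>" unfolding H_def by (simp add: mult_ac)
  have "((\<lambda>r. (1 - r\<^sup>2) * circ (\<lambda>z. H r z / ((1 + r\<^sup>2 * z\<^sup>2) * (1 + r\<^sup>2 / z\<^sup>2))) * E r) \<longlongrightarrow> H 1 \<i> / 2 * E 1) (at_left 1)"
    by (intro tendsto_mult E1 poisson_limit[OF b(1,2) contH refl c])
  moreover have "eventually (\<lambda>r. r \<in> {b<..<1}) (at_left (1::real))"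
    by (rule eventually_at_left_real) (use b in auto)
  hence "eventually (\<lambda>r. (1 - r\<^sup>2) * circ (\<lambda>z. H r z / ((1 + r\<^sup>2 * z\<^sup>2) * (1 + r\<^sup>2 / z\<^sup>2))) * E r = C) (at_left 1)"
  proof eventually_elim
    case (elim r)
    thus ?case using eq[of r] const[of r] by simp
  qed
  ultimately have "((\<lambda>r. C) \<longlongrightarrow> H 1 \<i> / 2 * E 1) (at_left (1::real))"
    by (simp add: tendsto_cong)
  hence "C = H 1 \<i> / 2 * E 1"
    using tendsto_unique[OF trivial_limit_at_left_real _ tendsto_const] by blast
  \<comment> \<open>At r = 1 one has A = b^3, and every factor that contains b cancels.\<close>
  also have "\<dots> = ?g 1 * (?g (-1))\<^sup>2 * (theta p (-1) * theta q (-1)) / 2"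
  proof -
    have one: "1 \<in> {b..1}" using b by simp
    have inv: "x / \<i> = - (\<i> * x)" "x / (- \<i>) = \<i> * x" for x by (simp_all add: divide_complex_def mult_ac)
    have "of_real (b ^ 3) / of_real b = complex_of_real (b * b)" using b by (simp add: power3_eq_cube)
    hence Ab: "A 1 / b = of_real (b * b)" by (simp add: A_def)
    have AG1: "?G (\<i> * A 1) \<noteq> 0" "?G (- (\<i> * A 1)) \<noteq> 0"
      using AG[OF one, of \<i>] by (simp_all add: inv mult_ac)
    show ?thesis
      unfolding H_def E_def of_real_1 Ab inv using Edenom[OF one] AG1
      by (simp add: inv mult_ac field_simps power2_eq_square)
  qed
  \<comment> \<open>The pair formula at z = -1, which is z^2 for z = i, expresses the theta factors
    through Gamma(-1), so that only the regularised value at 1 survives.\<close>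
  also have "theta p (-1) * theta q (-1) = 1 / (?G (-1) * ?G (-1))"
    using inverse_ell_gamma_pair[OF q p, of "-1"] by simp
  also have "?G (-1) = ?g (-1) / 2" by (simp add: ell_gamma_eq_reg)
  also have "?g 1 * (?g (-1))\<^sup>2 * (1 / (?g (-1) / 2 * (?g (-1) / 2))) / 2 = 2 * ?g 1"
    using ell_gamma_reg_nonzero[of "-1"] norm_mult_less_1[OF p q] by (simp add: power2_eq_square)
  finally show ?thesis by (simp add: ell_gamma_reg_1)
qed

lemma ebeta_normalised_generic:
  assumes q0: "q \<noteq> 0" and p0: "p \<noteq> 0" and t: "ebeta_domain q p t"
  shows "ebeta_normalised q p t = 2 / (qpoch p p * qpoch q q)"
proof -
  \<comment> \<open>The smallest radius that \<open>ebeta_normalised_constant\<close> admits. As b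
    exceeds it, the test point with entries i r, -i r and b is a legitimate reference point for all
    r in [b, 1).\<close>
  define \<rho> where "\<rho> = root 10 (norm p)"
  have \<rho>: "0 < \<rho>" "\<rho> < 1" "\<rho> ^ 10 = norm p"
    using p0 p by (simp_all add: \<rho>_def)
  define b where "b = (1 + \<rho>) / 2"
  have b: "\<rho> < b" "b < 1" "0 < b" using \<rho> by (auto simp: b_def)
  show ?thesis
  proof (rule ebeta_limit_value[OF b(3,2)])
    have "norm p * norm q \<le> norm p" using q by (intro mult_left_le) auto
    also have "\<dots> = \<rho> ^ 10" using \<rho> by simp
    also have "\<dots> \<le> \<rho> ^ 5" using \<rho> by (intro power_decreasing) auto
    also have "\<dots> < b ^ 5" using b \<rho> by (intro power_strict_mono) auto
    finally show "norm (p * q) < b ^ 5" by (simp add: norm_mult)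
    fix r assume r: "b \<le> r" "r < 1"
    show "ebeta_normalised q p (\<lambda>j. if j = 0 then \<i> * of_real r else if j = 1 then - \<i> * of_real r else of_real b)
        = ebeta_normalised q p t"
      by (rule ebeta_normalised_constant[OF q p q0 p0 \<rho>(1) _ t, symmetric]) (use \<rho> b r in \<open>auto simp: norm_mult\<close>)
  qed
qed

end

theorem ebeta_normalised_value:
  assumes q: "norm q < 1" and p: "norm p < 1" and t: "ebeta_domain q p t"
  shows "ebeta_normalised q p t = 2 / (qpoch p p * qpoch q q)"
proof -
  \<comment> \<open>The difference equation needs q and p to be nonzero; the remaining cases follow by continuity.\<close>
  define S :: "(complex \<times> complex) set" where "S = {y. norm (fst y) < 1 \<and> norm (snd y) < 1 \<and> norm (snd y * fst y) < norm (\<Prod>j<5. t j)}"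
  define f where "f = (\<lambda>y. ebeta_normalised (fst y) (snd y) t - 2 / (qpoch (snd y) (snd y) * qpoch (fst y) (fst y)))"
  define e where "e = (\<lambda>n. complex_of_real (inverse (real (Suc n))))"
  \<comment> \<open>Only components equal to 0 are perturbed; the perturbed pairs lie in the open
    set S for all large n.\<close>
  define s where "s = (\<lambda>n. (if q = 0 then e n else q, if p = 0 then e n else p))"
  have dom: "ebeta_domain (fst y) (snd y) t" if "y \<in> S" for y
    using that t by (auto simp: S_def ebeta_domain_def)
  have cont: "continuous_on S f"
    unfolding f_def
    by (intro continuous_intros continuous_on_ebeta_normalised)
       (use dom in \<open>auto simp: S_def qpoch_nonzero\<close>)
  have "open S" unfolding S_def by (intro open_Collect_conj open_Collect_less continuous_intros)
  have "e \<longlonglongrightarrow> of_real 0" unfolding e_def by (rule tendsto_of_real[OF LIMSEQ_inverse_real_of_nat])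
  hence e0: "e \<longlonglongrightarrow> 0" by (simp only: of_real_0)
  have s: "s \<longlonglongrightarrow> (q, p)" unfolding s_def by (intro tendsto_Pair; cases "q = 0"; cases "p = 0"; use e0 in simp)
  have qpS: "(q, p) \<in> S" using q p t by (auto simp: S_def ebeta_domain_def)
  have ev: "eventually (\<lambda>n. s n \<in> S) sequentially"
    using topological_tendstoD[OF s \<open>open S\<close> qpS] .
  have "(\<lambda>n. f (s n)) \<longlonglongrightarrow> f (q, p)"
    by (rule continuous_on_tendsto_compose[OF cont s qpS ev])
  moreover have "eventually (\<lambda>n. f (s n) = 0) sequentially"
    using ev
  proof eventually_elim
    case (elim n)
    have "e n \<noteq> 0" unfolding e_def of_real_eq_0_iff by simp
    hence "fst (s n) \<noteq> 0" "snd (s n) \<noteq> 0" by (auto simp: s_def)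
    thus ?case using ebeta_normalised_generic[of "fst (s n)" "snd (s n)" t] dom[OF elim] elim
      by (simp add: f_def S_def)
  qed
  hence "(\<lambda>n. f (s n)) \<longlonglongrightarrow> 0" by (rule tendsto_eventually)
  ultimately have "f (q, p) = 0" by (rule LIMSEQ_unique)
  thus ?thesis by (simp add: f_def)
qed

section \<open>The star-triangle relation\<close>

lemma kappa_eq: "kappa q p = qpoch p p * qpoch q q / (4 * of_real pi * \<i>)"
  by (simp add: kappa_def euler_prod_eq_qpoch)

context
  fixes q p :: complex
  assumes q: "norm q < 1" and p: "norm p < 1"
begin

definition gamma_pm :: "complex \<Rightarrow> complex \<Rightarrow> complex" where
  "gamma_pm a x = ell_gamma q p (a * x) * ell_gamma q p (a / x)"

definition gamma_pm2 :: "complex \<Rightarrow> complex \<Rightarrow> complex \<Rightarrow> complex" where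
  "gamma_pm2 a z x = gamma_pm (a * z) x * gamma_pm (a / z) x"

definition gamma_sq :: "complex \<Rightarrow> complex" where
  "gamma_sq x = ell_gamma q p (x\<^sup>2) * ell_gamma q p (1 / x\<^sup>2)"

lemma ell_gammas_simps:
  "ell_gammas q p [] = 1"
  "ell_gammas q p (a # as) = ell_gamma q p a * ell_gammas q p as"
  "ell_gammas q p (as @ bs) = ell_gammas q p as * ell_gammas q p bs"
  "ell_gammas q p (pm a x) = gamma_pm a x"
  "ell_gammas q p (pm2 a z x) = gamma_pm2 a z x"
  "ell_gammas q p [x\<^sup>2, inverse (x\<^sup>2)] = gamma_sq x"
  by (simp_all add: ell_gammas_def pm_def pm2_def gamma_pm_def gamma_pm2_def gamma_sq_def divide_inverse mult_ac)

lemma gamma_pm2_commute: "gamma_pm2 a z x = gamma_pm2 a x z"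
  by (simp add: gamma_pm2_def gamma_pm_def mult_ac)

lemma gamma_pm_nonzero:
  assumes "norm (p * q) < norm a" "norm a < 1" "norm x = 1"
  shows "gamma_pm a x \<noteq> 0"
proof -
  have "ell_gamma q p (a * x) \<noteq> 0" "ell_gamma q p (a / x) \<noteq> 0"
    by (rule ell_gamma_nonzero[OF q p]; use assms in \<open>simp add: norm_mult norm_divide\<close>)+
  thus ?thesis by (simp add: gamma_pm_def)
qed

lemma continuous_on_gamma_pm:
  assumes "continuous_on S f" "continuous_on S g"
    and "\<And>y. y \<in> S \<Longrightarrow> f y \<noteq> 0" "\<And>y. y \<in> S \<Longrightarrow> norm (f y) < 1" "\<And>y. y \<in> S \<Longrightarrow> norm (g y) = 1"
  shows "continuous_on S (\<lambda>y. gamma_pm (f y) (g y))"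
proof -
  have "g y \<noteq> 0" if "y \<in> S" for y using assms(5)[OF that] by auto
  thus ?thesis unfolding gamma_pm_def using assms q p
    by (intro continuous_intros continuous_on_ell_gamma) (auto simp: norm_mult norm_divide)
qed

lemma continuous_on_gamma_pm2:
  assumes "continuous_on S f" "continuous_on S g" "a \<noteq> 0" "norm a < 1"
    and "\<And>y. y \<in> S \<Longrightarrow> norm (f y) = 1" "\<And>y. y \<in> S \<Longrightarrow> norm (g y) = 1"
  shows "continuous_on S (\<lambda>y. gamma_pm2 a (f y) (g y))"
proof -
  have "f y \<noteq> 0" if "y \<in> S" for y using assms(5)[OF that] by auto
  thus ?thesis unfolding gamma_pm2_def using assms
    by (intro continuous_on_mult continuous_on_divide continuous_on_gamma_pm continuous_on_const)
       (auto simp: norm_mult norm_divide)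
qed

lemma inverse_gamma_sq: "norm x = 1 \<Longrightarrow> 1 / gamma_sq x = theta p (x\<^sup>2) * theta q (1 / x\<^sup>2)"
  unfolding gamma_sq_def by (rule inverse_ell_gamma_pair[OF q p]) (simp add: norm_power)

lemma continuous_on_inverse_gamma_sq:
  assumes "continuous_on S f" "\<And>y. y \<in> S \<Longrightarrow> norm (f y) = 1"
  shows "continuous_on S (\<lambda>y. 1 / gamma_sq (f y))"
proof -
  have "f y \<noteq> 0" if "y \<in> S" for y using assms(2)[OF that] by auto
  hence "continuous_on S (\<lambda>y. theta p ((f y)\<^sup>2) * theta q (1 / (f y)\<^sup>2))"
    using assms p q by (intro continuous_intros) auto
  thus ?thesis using assms(2) by (simp add: inverse_gamma_sq cong: continuous_on_cong)
qed

lemma kappa_nonzero: "kappa q p \<noteq> 0"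
  using qpoch_nonzero[OF p p] qpoch_nonzero[OF q q] by (simp add: kappa_eq)

text \<open>The constant arises from 2 pi i * 2 / ((p; p)_infinity (q; q)_infinity) = 1 /
  kappa.\<close>

lemma elliptic_beta_integral:
  assumes "\<And>x. x \<in> {a, b, c, d, e} \<Longrightarrow> norm x < 1" and "norm (p * q) < norm (a * b * c * d * e)"
  defines "A \<equiv> a * b * c * d * e"
  shows "2 * of_real pi * \<i> * circ (\<lambda>y. gamma_pm a y * gamma_pm b y * gamma_pm c y * gamma_pm d y * gamma_pm e y
            / (gamma_sq y * gamma_pm A y))
     = ell_gamma q p (a * b) * ell_gamma q p (a * c) * ell_gamma q p (a * d) * ell_gamma q p (a * e)
       * ell_gamma q p (b * c) * ell_gamma q p (b * d) * ell_gamma q p (b * e)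
       * ell_gamma q p (c * d) * ell_gamma q p (c * e) * ell_gamma q p (d * e)
       / (kappa q p * (ell_gamma q p (A / a) * ell_gamma q p (A / b) * ell_gamma q p (A / c)
            * ell_gamma q p (A / d) * ell_gamma q p (A / e)))"
proof -
  define t where "t = (\<lambda>j::nat. if j = 0 then a else if j = 1 then b else if j = 2 then c else if j = 3 then d else e)"
  have P: "(\<Prod>j<5. f (t j)) = f a * f b * f c * f d * f e" for f :: "complex \<Rightarrow> complex"
    by (simp add: numeral_eq_Suc t_def mult_ac)
  have A: "(\<Prod>j<5. t j) = A" using P[of "\<lambda>x. x"] by (simp add: A_def)
  have dom: "ebeta_domain q p t"
    unfolding ebeta_domain_def A using assms by (auto simp: t_def A_def)
  note D = ebeta_domainD[OF dom, unfolded A]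
  have "\<forall>j<5. norm (t j) < 1" using D(1) by blast
  note B = ebeta_bounds[OF this, unfolded A, OF D(2)]
  have pairs: "(\<Prod>k<5. \<Prod>j<k. ell_gamma q p (t j * t k)) =
      ell_gamma q p (a * b) * ell_gamma q p (a * c) * ell_gamma q p (a * d) * ell_gamma q p (a * e)
       * ell_gamma q p (b * c) * ell_gamma q p (b * d) * ell_gamma q p (b * e)
       * ell_gamma q p (c * d) * ell_gamma q p (c * e) * ell_gamma q p (d * e)"
    by (simp add: numeral_eq_Suc t_def mult_ac)
  have pairs_nz: "(\<Prod>k<5. \<Prod>j<k. ell_gamma q p (t j * t k)) \<noteq> 0"
  proof -
    have "ell_gamma q p (t j * t k) \<noteq> 0" if "j < k" "k < 5" for j k
    proof (rule ell_gamma_nonzero[OF q p])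
      show "norm (p * q) < norm (t j * t k)" using less_le_trans[OF D(3) B(4)[of j k]] that by auto
      show "norm (t j * t k) < 1" using D(1)[of j] D(1)[of k] that by (intro norm_mult_less_1) auto
    qed
    thus ?thesis by auto
  qed
  have num_nz: "(\<Prod>j<5. ell_gamma q p (A / t j)) \<noteq> 0"
  proof -
    have "ell_gamma q p (A / t j) \<noteq> 0" if "j < 5" for j
      using less_trans[OF D(3) B(5)[OF that]] B(6)[OF that] by (rule ell_gamma_nonzero[OF q p])
    thus ?thesis by auto
  qed
  have W: "ebeta_weight q p t y = gamma_pm a y * gamma_pm b y * gamma_pm c y * gamma_pm d y * gamma_pm e y
            / (gamma_sq y * gamma_pm A y)" if "norm y = 1" for y
    unfolding ebeta_weight_def A P[of "\<lambda>x. ell_gamma q p (x * y) * ell_gamma q p (x / y)"]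
      inverse_gamma_sq[OF that, symmetric] gamma_pm_def by (simp add: field_simps)
  have val: "circ (ebeta_weight q p t) * (\<Prod>j<5. ell_gamma q p (A / t j)) / (\<Prod>k<5. \<Prod>j<k. ell_gamma q p (t j * t k))
      = 2 / (qpoch p p * qpoch q q)"
    using ebeta_normalised_value[OF q p dom] unfolding ebeta_normalised_def A .
  have eb: "circ (ebeta_weight q p t) = 2 / (qpoch p p * qpoch q q) * (\<Prod>k<5. \<Prod>j<k. ell_gamma q p (t j * t k)) / (\<Prod>j<5. ell_gamma q p (A / t j))"
  proof -
    have "X = K * M / N" if "X * N / M = K" "M \<noteq> 0" "N \<noteq> 0" for X N M K :: complex using that by auto
    from this[OF val pairs_nz num_nz] show ?thesis .
  qed
  have "2 * of_real pi * \<i> * circ (ebeta_weight q p t)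
      = (\<Prod>k<5. \<Prod>j<k. ell_gamma q p (t j * t k)) / (kappa q p * (\<Prod>j<5. ell_gamma q p (A / t j)))"
    unfolding kappa_eq eb by simp
  also have "circ (ebeta_weight q p t) = circ (\<lambda>y. gamma_pm a y * gamma_pm b y * gamma_pm c y * gamma_pm d y * gamma_pm e y
            / (gamma_sq y * gamma_pm A y))"
    by (rule circ_cong) (rule W)
  finally show ?thesis unfolding pairs P[of "\<lambda>x. ell_gamma q p (A / x)"] .
qed

text \<open>The elliptic beta integral with parameters s w, s / w, t x, t / x and a, whose product
  s^2 t^2 a is free of w and x. The first form creates an integration, as the iteration needs; the
  second removes one, as the final evaluation needs.\<close>

lemma star_triangle:
  assumes "norm s < 1" "norm t < 1" "norm a < 1" "norm w = 1" "norm x = 1"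
    and A: "norm (p * q) < norm (s\<^sup>2 * t\<^sup>2 * a)"
  shows "gamma_pm2 (s * t) w x * (gamma_pm (s * a) w / gamma_pm (s * t\<^sup>2 * a) w) * (gamma_pm (t * a) x / gamma_pm (s\<^sup>2 * t * a) x)
    = kappa q p * ell_gamma q p (s\<^sup>2 * t\<^sup>2) / (ell_gamma q p (s\<^sup>2) * ell_gamma q p (t\<^sup>2))
      * (2 * of_real pi * \<i> * circ (\<lambda>y. gamma_pm2 s w y * gamma_pm2 t x y * gamma_pm a y / (gamma_sq y * gamma_pm (s\<^sup>2 * t\<^sup>2 * a) y)))"
      (is ?transform)
    and "2 * of_real pi * \<i> * circ (\<lambda>y. gamma_pm2 s w y * gamma_pm2 t x y * gamma_pm a y / (gamma_sq y * gamma_pm (s\<^sup>2 * t\<^sup>2 * a) y))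
     = ell_gamma q p (s\<^sup>2) * ell_gamma q p (t\<^sup>2) / (kappa q p * ell_gamma q p (s\<^sup>2 * t\<^sup>2)) *
     (gamma_pm2 (s * t) w x * (gamma_pm (s * a) w / gamma_pm (s * t\<^sup>2 * a) w) * (gamma_pm (t * a) x / gamma_pm (s\<^sup>2 * t * a) x))"
      (is ?evaluation)
proof -
  have w0: "w \<noteq> 0" and x0: "x \<noteq> 0" using assms by auto
  have ne: "s \<noteq> 0" "t \<noteq> 0" "a \<noteq> 0" using A by auto
  let ?G = "ell_gamma q p"
  have le: "norm (u * v) \<le> norm u" if "norm v < 1" for u v :: complex
    using that by (simp add: norm_mult mult_left_le)
  have sq1: "norm (s\<^sup>2) < 1" "norm (t\<^sup>2) < 1" using assms by (simp_all add: norm_power power_less_one_iff)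
  have nz: "?G (s\<^sup>2) \<noteq> 0" "?G (t\<^sup>2) \<noteq> 0" "?G (s\<^sup>2 * t\<^sup>2) \<noteq> 0"
  proof -
    have 1: "norm (p * q) < norm (s\<^sup>2 * t\<^sup>2)" using less_le_trans[OF A le[OF assms(3)]] .
    hence 2: "norm (p * q) < norm (s\<^sup>2)" using le[OF sq1(2), of "s\<^sup>2"] by simp
    from 1 have 3: "norm (p * q) < norm (t\<^sup>2)" using le[OF sq1(1), of "t\<^sup>2"] by (simp add: mult.commute)
    show "?G (s\<^sup>2) \<noteq> 0" "?G (t\<^sup>2) \<noteq> 0" "?G (s\<^sup>2 * t\<^sup>2) \<noteq> 0"
      using 1 2 3 sq1 norm_mult_less_1[OF sq1] ell_gamma_nonzero[OF q p] by blast+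
  qed
  have prod: "(s * w) * (s / w) * (t * x) * (t / x) * a = s\<^sup>2 * t\<^sup>2 * a"
    using w0 x0 by (simp add: power2_eq_square)
  have quot: "s\<^sup>2 * t\<^sup>2 * a / (s * w) = s * t\<^sup>2 * a / w" "s\<^sup>2 * t\<^sup>2 * a / (s / w) = s * t\<^sup>2 * a * w"
    "s\<^sup>2 * t\<^sup>2 * a / (t * x) = s\<^sup>2 * t * a / x" "s\<^sup>2 * t\<^sup>2 * a / (t / x) = s\<^sup>2 * t * a * x"
    "s\<^sup>2 * t\<^sup>2 * a / a = s\<^sup>2 * t\<^sup>2"
    using ne w0 x0 by (simp_all add: power2_eq_square mult_ac)
  have pair: "s * w * (s / w) = s\<^sup>2" "t * x * (t / x) = t\<^sup>2" "s * w * (t * x) = s * t * w * x" "s * w * (t / x) = s * t * w / x"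
     "s / w * (t * x) = s * t / w * x" "s / w * (t / x) = s * t / w / x" "s * w * a = s * a * w" "s / w * a = s * a / w"
     "t * x * a = t * a * x" "t / x * a = t * a / x"
    using w0 x0 by (simp_all add: power2_eq_square mult_ac)
  have "2 * of_real pi * \<i> * circ (\<lambda>y. gamma_pm (s * w) y * gamma_pm (s / w) y * gamma_pm (t * x) y * gamma_pm (t / x) y * gamma_pm a y
            / (gamma_sq y * gamma_pm (s\<^sup>2 * t\<^sup>2 * a) y))
     = ?G (s\<^sup>2) * ?G (s * t * w * x) * ?G (s * t * w / x) * ?G (s * a * w) * ?G (s * t / w * x) * ?G (s * t / w / x) * ?G (s * a / w)
       * ?G (t\<^sup>2) * ?G (t * a * x) * ?G (t * a / x)
       / (kappa q p * (?G (s * t\<^sup>2 * a / w) * ?G (s * t\<^sup>2 * a * w) * ?G (s\<^sup>2 * t * a / x) * ?G (s\<^sup>2 * t * a * x) * ?G (s\<^sup>2 * t\<^sup>2)))"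
  proof -
    have 1: "norm z < 1" if "z \<in> {s * w, s / w, t * x, t / x, a}" for z
      using that assms by (auto simp: norm_mult norm_divide)
    have 2: "norm (p * q) < norm ((s * w) * (s / w) * (t * x) * (t / x) * a)" unfolding prod by (rule A)
    show ?thesis by (rule elliptic_beta_integral[OF 1 2, unfolded prod, unfolded quot, unfolded pair])
  qed
  also have "\<dots> = ?G (s\<^sup>2) * ?G (t\<^sup>2) / (kappa q p * ?G (s\<^sup>2 * t\<^sup>2)) *
     (gamma_pm2 (s * t) w x * (gamma_pm (s * a) w / gamma_pm (s * t\<^sup>2 * a) w) * (gamma_pm (t * a) x / gamma_pm (s\<^sup>2 * t * a) x))"
    unfolding gamma_pm2_def gamma_pm_def by (simp add: mult_ac)
  finally show ?evaluation
    by (simp add: gamma_pm2_def mult.assoc)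
  thus ?transform using nz kappa_nonzero by simp
qed

text \<open>The start of the iteration: the elliptic beta integral with parameters t x, t / x, a, b
  and c, the last three being the tau_r.\<close>

lemma elliptic_beta_transform:
  assumes "norm t < 1" "norm a < 1" "norm b < 1" "norm c < 1" "norm x = 1"
    and A: "norm (p * q) < norm (t\<^sup>2 * a * b * c)"
  shows "gamma_pm (t * a) x * gamma_pm (t * b) x * gamma_pm (t * c) x / gamma_pm (t * a * b * c) x
    = kappa q p * (ell_gamma q p (t\<^sup>2 * a * b) / ell_gamma q p (a * b) * (ell_gamma q p (t\<^sup>2 * a * c) / ell_gamma q p (a * c))
         * (ell_gamma q p (t\<^sup>2 * b * c) / ell_gamma q p (b * c))) / ell_gamma q p (t\<^sup>2)
      * (2 * of_real pi * \<i> * circ (\<lambda>y. gamma_pm2 t x y * (gamma_pm a y * gamma_pm b y * gamma_pm c y) / (gamma_sq y * gamma_pm (t\<^sup>2 * a * b * c) y)))"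
proof -
  have x0: "x \<noteq> 0" using assms by auto
  have ne: "t \<noteq> 0" "a \<noteq> 0" "b \<noteq> 0" "c \<noteq> 0" using A by auto
  let ?G = "ell_gamma q p"
  have le: "norm (u * v) \<le> norm u" "norm (v * u) \<le> norm u" if "norm v < 1" for u v :: complex
    using that by (simp_all add: norm_mult mult_left_le mult.commute)
  have t1: "norm (t\<^sup>2) < 1" using assms by (simp add: norm_power power_less_one_iff)
  note lt1 = norm_mult_less_1[OF assms(2,3)] norm_mult_less_1[OF assms(2,4)] norm_mult_less_1[OF assms(3,4)]
  have tt: "norm (t\<^sup>2 * y) < 1" if "norm y < 1" for y using norm_mult_less_1[OF t1 that] .
  have nzI: "?G z \<noteq> 0" if "t\<^sup>2 * a * b * c = z * z'" "norm z' < 1" "norm z < 1" for z z'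
  proof (rule ell_gamma_nonzero[OF q p _ that(3)])
    show "norm (p * q) < norm z" using less_le_trans[OF A[unfolded that(1)] le(1)[OF that(2)]] .
  qed
  have nz: "?G (a * b) \<noteq> 0" "?G (a * c) \<noteq> 0" "?G (b * c) \<noteq> 0" "?G (t\<^sup>2) \<noteq> 0"
     "?G (t\<^sup>2 * a * b) \<noteq> 0" "?G (t\<^sup>2 * a * c) \<noteq> 0" "?G (t\<^sup>2 * b * c) \<noteq> 0"
    by (rule nzI[of "a * b" "t\<^sup>2 * c"] nzI[of "a * c" "t\<^sup>2 * b"] nzI[of "b * c" "t\<^sup>2 * a"] nzI[of "t\<^sup>2" "a * (b * c)"]
          nzI[of "t\<^sup>2 * a * b" c] nzI[of "t\<^sup>2 * a * c" b] nzI[of "t\<^sup>2 * b * c" a];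
        use tt[OF assms(2)] tt[OF assms(3)] tt[OF assms(4)] tt[OF lt1(1)] tt[OF lt1(2)] tt[OF lt1(3)]
          norm_mult_less_1[OF assms(2) lt1(3)] lt1 t1 assms(2-4) in \<open>simp add: mult_ac\<close>)+
  have prod: "(t * x) * (t / x) * a * b * c = t\<^sup>2 * a * b * c"
    using x0 by (simp add: power2_eq_square)
  have quot: "t\<^sup>2 * a * b * c / (t * x) = t * a * b * c / x" "t\<^sup>2 * a * b * c / (t / x) = t * a * b * c * x"
    "t\<^sup>2 * a * b * c / a = t\<^sup>2 * b * c" "t\<^sup>2 * a * b * c / b = t\<^sup>2 * a * c" "t\<^sup>2 * a * b * c / c = t\<^sup>2 * a * b"
    using ne x0 by (simp_all add: power2_eq_square mult_ac)
  have pair: "t * x * (t / x) = t\<^sup>2" "t * x * a = t * a * x" "t * x * b = t * b * x" "t * x * c = t * c * x"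
     "t / x * a = t * a / x" "t / x * b = t * b / x" "t / x * c = t * c / x"
    using x0 by (simp_all add: power2_eq_square mult_ac)
  have "2 * of_real pi * \<i> * circ (\<lambda>y. gamma_pm (t * x) y * gamma_pm (t / x) y * gamma_pm a y * gamma_pm b y * gamma_pm c y
            / (gamma_sq y * gamma_pm (t\<^sup>2 * a * b * c) y))
     = ?G (t\<^sup>2) * ?G (t * a * x) * ?G (t * b * x) * ?G (t * c * x) * ?G (t * a / x) * ?G (t * b / x) * ?G (t * c / x)
        * ?G (a * b) * ?G (a * c) * ?G (b * c)
       / (kappa q p * (?G (t * a * b * c / x) * ?G (t * a * b * c * x) * ?G (t\<^sup>2 * b * c) * ?G (t\<^sup>2 * a * c) * ?G (t\<^sup>2 * a * b)))"
  proof -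
    have 1: "norm z < 1" if "z \<in> {t * x, t / x, a, b, c}" for z
      using that assms by (auto simp: norm_mult norm_divide)
    have 2: "norm (p * q) < norm ((t * x) * (t / x) * a * b * c)" unfolding prod by (rule A)
    show ?thesis by (rule elliptic_beta_integral[OF 1 2, unfolded prod, unfolded quot, unfolded pair])
  qed
  also have "\<dots> = ?G (t\<^sup>2) * ?G (a * b) * ?G (a * c) * ?G (b * c) / (kappa q p * (?G (t\<^sup>2 * b * c) * ?G (t\<^sup>2 * a * c) * ?G (t\<^sup>2 * a * b))) *
     (gamma_pm (t * a) x * gamma_pm (t * b) x * gamma_pm (t * c) x / gamma_pm (t * a * b * c) x)"
    unfolding gamma_pm_def by (simp add: mult_ac)
  finally have "2 * of_real pi * \<i> * circ (\<lambda>y. gamma_pm2 t x y * (gamma_pm a y * gamma_pm b y * gamma_pm c y) / (gamma_sq y * gamma_pm (t\<^sup>2 * a * b * c) y))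
     = ?G (t\<^sup>2) * ?G (a * b) * ?G (a * c) * ?G (b * c) / (kappa q p * (?G (t\<^sup>2 * b * c) * ?G (t\<^sup>2 * a * c) * ?G (t\<^sup>2 * a * b))) *
     (gamma_pm (t * a) x * gamma_pm (t * b) x * gamma_pm (t * c) x / gamma_pm (t * a * b * c) x)"
    by (simp add: gamma_pm2_def mult.assoc)
  thus ?thesis using nz kappa_nonzero by (simp add: mult_ac)
qed

end

section \<open>Integrals over tori and the Bailey chain\<close>

lemma torus_integral_Suc_circ:
  "torus_integral (Suc n) F = torus_integral n (\<lambda>x. 2 * of_real pi * \<i> * circ (\<lambda>z. F (x(Suc n := z))))"
  by (simp only: torus_integral.simps contour_integral_eq_circ)

declare torus_integral.simps(2) [simp del]

lemma torus_integral_cong: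
  assumes "\<And>x. (\<And>i. 1 \<le> i \<Longrightarrow> i \<le> n \<Longrightarrow> norm (x i) = 1) \<Longrightarrow> F x = G x"
  shows "torus_integral n F = torus_integral n G"
  using assms
proof (induction n arbitrary: F G)
  case 0
  thus ?case by simp
next
  case (Suc n)
  show ?case unfolding torus_integral_Suc_circ
  proof (rule Suc.IH)
    fix x :: "nat \<Rightarrow> complex" assume x: "\<And>i. 1 \<le> i \<Longrightarrow> i \<le> n \<Longrightarrow> norm (x i) = 1"
    have "circ (\<lambda>z. F (x(Suc n := z))) = circ (\<lambda>z. G (x(Suc n := z)))"
      by (rule circ_cong, rule Suc.prems) (use x in auto)
    thus "2 * of_real pi * \<i> * circ (\<lambda>z. F (x(Suc n := z))) = 2 * of_real pi * \<i> * circ (\<lambda>z. G (x(Suc n := z)))"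
      by simp
  qed
qed

lemma torus_integral_cmult: "torus_integral n (\<lambda>x. c * F x) = c * torus_integral n F"
proof (induction n arbitrary: F)
  case (Suc n)
  have "torus_integral (Suc n) (\<lambda>x. c * F x)
      = torus_integral n (\<lambda>x. c * (2 * of_real pi * \<i> * circ (\<lambda>z. F (x(Suc n := z)))))"
    unfolding torus_integral_Suc_circ circ_cmult by (simp only: mult_ac)
  thus ?case unfolding Suc.IH torus_integral_Suc_circ .
qed simp

definition torus :: "nat \<Rightarrow> (nat \<Rightarrow> complex) set" where
  "torus n = {y. \<forall>i\<in>{1..n}. norm (y i) = 1}"

text \<open>Induction on n, with one exchange of two circle means per coordinate. Joint continuity
  refers to the product topology on functions from the natural numbers.\<close>

lemma circ_torus_integral_swap:
  assumes "continuous_on (sphere 0 1 \<times> torus n) (\<lambda>(x, y). G x y)"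
  shows "circ (\<lambda>x. torus_integral n (G x)) = torus_integral n (\<lambda>y. circ (\<lambda>x. G x y))"
  using assms
proof (induction n arbitrary: G)
  case (Suc n)
  define H where "H = (\<lambda>x y. 2 * of_real pi * \<i> * circ (\<lambda>z. G x (y(Suc n := z))))"
  \<comment> \<open>Adjoining a coordinate is continuous in the product topology because it is so in
    every coordinate.\<close>
  have "continuous_on ((sphere 0 1 \<times> torus n) \<times> sphere (0::complex) 1)
      (\<lambda>a. (fst (fst a) :: complex, (snd (fst a))(Suc n := snd a)))"
  proof (intro continuous_on_Pair continuous_on_coordinatewise_then_product)
    show "continuous_on ((sphere (0::complex) 1 \<times> torus n) \<times> sphere (0::complex) 1) (\<lambda>a. ((snd (fst a))(Suc n := snd a)) i)" for i
    proof (cases "i = Suc n")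
      case False
      have "continuous_on ((sphere (0::complex) 1 \<times> torus n) \<times> sphere (0::complex) 1) (\<lambda>a. snd (fst a) i)"
        by (rule continuous_on_product_then_coordinatewise) (intro continuous_intros)
      thus ?thesis using False by simp
    qed (auto intro!: continuous_intros)
  qed (intro continuous_intros)
  moreover have "(\<lambda>a. (fst (fst a), (snd (fst a))(Suc n := snd a))) ` ((sphere 0 1 \<times> torus n) \<times> sphere (0::complex) 1)
      \<subseteq> sphere (0::complex) 1 \<times> torus (Suc n)"
    by (auto simp: torus_def)
  ultimately have G: "continuous_on ((sphere 0 1 \<times> torus n) \<times> sphere (0::complex) 1)
      (\<lambda>a. G (fst (fst a)) ((snd (fst a))(Suc n := snd a)))"
    using continuous_on_compose2[OF Suc.prems] by fastforce
  hence "continuous_on (sphere 0 1 \<times> torus n) (\<lambda>a. circ (\<lambda>z. G (fst a) ((snd a)(Suc n := z))))"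
    by (intro continuous_on_circ) (simp add: case_prod_unfold)
  hence contH: "continuous_on (sphere 0 1 \<times> torus n) (\<lambda>(x, y). H x y)"
    unfolding H_def case_prod_unfold by (intro continuous_on_mult continuous_on_const)
  have "circ (\<lambda>x. torus_integral (Suc n) (G x)) = circ (\<lambda>x. torus_integral n (H x))"
    unfolding torus_integral_Suc_circ H_def ..
  also have "\<dots> = torus_integral n (\<lambda>y. circ (\<lambda>x. H x y))" by (rule Suc.IH[OF contH])
  also have "\<dots> = torus_integral n (\<lambda>y. 2 * of_real pi * \<i> * circ (\<lambda>z. circ (\<lambda>x. G x (y(Suc n := z)))))"
  proof (rule torus_integral_cong)
    fix y :: "nat \<Rightarrow> complex" assume y: "\<And>i. 1 \<le> i \<Longrightarrow> i \<le> n \<Longrightarrow> norm (y i) = 1"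
    have "continuous_on (sphere 0 1 \<times> sphere 0 1) (\<lambda>a. ((fst a :: complex, y), snd a :: complex))"
      by (intro continuous_intros)
    moreover have "(\<lambda>a. ((fst a, y), snd a)) ` (sphere 0 1 \<times> sphere 0 1)
        \<subseteq> (sphere (0::complex) 1 \<times> torus n) \<times> sphere (0::complex) 1"
      using y by (auto simp: torus_def)
    ultimately have "continuous_on (sphere 0 1 \<times> sphere 0 1) (\<lambda>a. G (fst a) (y(Suc n := snd a)))"
      using continuous_on_compose2[OF G] by fastforce
    hence "continuous_on (sphere 0 1 \<times> sphere 0 1) (\<lambda>(x, z). G x (y(Suc n := z)))"
      by (simp add: case_prod_unfold)
    hence "circ (\<lambda>x. circ (\<lambda>z. G x (y(Suc n := z)))) = circ (\<lambda>z. circ (\<lambda>x. G x (y(Suc n := z))))"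
      by (rule circ_swap)
    thus "circ (\<lambda>x. H x y) = 2 * of_real pi * \<i> * circ (\<lambda>z. circ (\<lambda>x. G x (y(Suc n := z))))"
      unfolding H_def circ_cmult by simp
  qed
  finally show ?case unfolding torus_integral_Suc_circ .
qed simp

section \<open>The Bailey chain: iteration of the star-triangle relation\<close>

context
  fixes q p :: complex and \<tau> s u :: "nat \<Rightarrow> complex"
  assumes q: "norm q < 1" and p: "norm p < 1"
begin

text \<open>Up to the factors that contain s_(m+1), u_(m+1) and w, \<open>bailey_function\<close> is the integrand on
the left-hand side of the theorem and \<open>bailey_kernel\<close> the integrand on its right-hand side.\<close>

definition bailey_function :: "nat \<Rightarrow> complex \<Rightarrow> complex \<Rightarrow> complex" where
  "bailey_function m t x =
     (\<Prod>k=1..m. gamma_pm q p (t * (\<Prod>l=k+1..m. s l) * u k) x / gamma_pm q p (t * (\<Prod>l=k+1..m. s l) * (s k)\<^sup>2 * u k) x)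
     * ((\<Prod>r=0..2. gamma_pm q p (t * (\<Prod>k=1..m. s k) * \<tau> r) x) / gamma_pm q p (t * (\<Prod>k=1..m. s k) * \<tau> 0 * \<tau> 1 * \<tau> 2) x)"

definition bailey_kernel :: "nat \<Rightarrow> complex \<Rightarrow> (nat \<Rightarrow> complex) \<Rightarrow> complex" where
  "bailey_kernel m t y =
     (\<Prod>r=0..2. gamma_pm q p (\<tau> r) (y 1))
     / (gamma_sq q p (y 1) * gamma_pm q p (t\<^sup>2 * (\<Prod>k=1..m. (s k)\<^sup>2) * \<tau> 0 * \<tau> 1 * \<tau> 2) (y 1))
     * (\<Prod>k=1..m. gamma_pm q p (u k) (y (k+1)) * gamma_pm q p ((\<Prod>l=k+1..m. (s l)\<^sup>2) * t\<^sup>2 * s k * u k) (y k)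
          * gamma_pm2 q p (s k) (y (k+1)) (y k)
          / (gamma_sq q p (y (k+1)) * gamma_pm q p ((\<Prod>l=k..m. (s l)\<^sup>2) * t\<^sup>2 * u k) (y (k+1)) * gamma_pm q p (s k * u k) (y k)))"

text \<open>Each of the m + 1 integrations contributes one \<open>kappa q p\<close>: the first comes
  from the elliptic beta integral, the others from star-triangle steps, which also contribute the
  factors of the product over k.\<close>

definition bailey_constant :: "nat \<Rightarrow> complex \<Rightarrow> complex" where
  "bailey_constant m t =
     kappa q p ^ (m + 1)
     * (\<Prod>(r, j)\<in>{(r, j). r < j \<and> j \<le> 2}. ell_gamma q p (t\<^sup>2 * (\<Prod>k=1..m. (s k)\<^sup>2) * \<tau> r * \<tau> j) / ell_gamma q p (\<tau> r * \<tau> j))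
     / ell_gamma q p (t\<^sup>2 * (\<Prod>k=1..m. (s k)\<^sup>2))
     * (\<Prod>k=1..m. ell_gamma q p ((\<Prod>l=k..m. (s l)\<^sup>2) * t\<^sup>2)
          / (ell_gamma q p ((s k)\<^sup>2) * ell_gamma q p ((\<Prod>l=k+1..m. (s l)\<^sup>2) * t\<^sup>2)))"

definition bailey_domain :: "nat \<Rightarrow> complex \<Rightarrow> bool" where
  "bailey_domain m t \<longleftrightarrow> norm t < 1 \<and> (\<forall>r\<in>{0..2}. norm (\<tau> r) < 1) \<and> (\<forall>k\<in>{1..m}. norm (s k) < 1 \<and> norm (u k) < 1)
     \<and> norm (p * q) < norm (t\<^sup>2 * (\<Prod>k=1..m. (s k)\<^sup>2) * \<tau> 0 * \<tau> 1 * \<tau> 2)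
     \<and> (\<forall>k\<in>{1..m}. norm (p * q) < norm (t\<^sup>2 * (\<Prod>l=k..m. (s l)\<^sup>2) * u k))"

text \<open>Each product of s_l ends at the top index, so its last factor s_(m+1) can be absorbed
  into t. The kernel, the constant and the domain obey the same recursion.\<close>

lemma bailey_function_Suc:
  "bailey_function (Suc m) t x
   = gamma_pm q p (t * u (Suc m)) x / gamma_pm q p (t * (s (Suc m))\<^sup>2 * u (Suc m)) x * bailey_function m (t * s (Suc m)) x"
proof -
  have "(\<Prod>k=1..m. gamma_pm q p (t * (\<Prod>l=k+1..Suc m. s l) * u k) x / gamma_pm q p (t * (\<Prod>l=k+1..Suc m. s l) * (s k)\<^sup>2 * u k) x)
      = (\<Prod>k=1..m. gamma_pm q p (t * s (Suc m) * (\<Prod>l=k+1..m. s l) * u k) x / gamma_pm q p (t * s (Suc m) * (\<Prod>l=k+1..m. s l) * (s k)\<^sup>2 * u k) x)"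
    by (intro prod.cong refl) (simp add: mult_ac)
  thus ?thesis unfolding bailey_function_def by (simp add: mult_ac)
qed

lemma bailey_kernel_Suc:
  "bailey_kernel (Suc m) t y = bailey_kernel m (t * s (Suc m)) y
     * (gamma_pm q p (u (Suc m)) (y (Suc (Suc m))) * gamma_pm q p (t\<^sup>2 * s (Suc m) * u (Suc m)) (y (Suc m))
          * gamma_pm2 q p (s (Suc m)) (y (Suc (Suc m))) (y (Suc m))
          / (gamma_sq q p (y (Suc (Suc m))) * gamma_pm q p (t\<^sup>2 * (s (Suc m))\<^sup>2 * u (Suc m)) (y (Suc (Suc m)))
              * gamma_pm q p (s (Suc m) * u (Suc m)) (y (Suc m))))"
proof -
  have 1: "(\<Prod>k=1..m. gamma_pm q p (u k) (y (k+1)) * gamma_pm q p ((\<Prod>l=k+1..Suc m. (s l)\<^sup>2) * t\<^sup>2 * s k * u k) (y k)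
          * gamma_pm2 q p (s k) (y (k+1)) (y k)
          / (gamma_sq q p (y (k+1)) * gamma_pm q p ((\<Prod>l=k..Suc m. (s l)\<^sup>2) * t\<^sup>2 * u k) (y (k+1)) * gamma_pm q p (s k * u k) (y k)))
      = (\<Prod>k=1..m. gamma_pm q p (u k) (y (k+1)) * gamma_pm q p ((\<Prod>l=k+1..m. (s l)\<^sup>2) * (t * s (Suc m))\<^sup>2 * s k * u k) (y k)
          * gamma_pm2 q p (s k) (y (k+1)) (y k)
          / (gamma_sq q p (y (k+1)) * gamma_pm q p ((\<Prod>l=k..m. (s l)\<^sup>2) * (t * s (Suc m))\<^sup>2 * u k) (y (k+1)) * gamma_pm q p (s k * u k) (y k)))"
    by (intro prod.cong refl) (simp add: power_mult_distrib mult_ac)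
  have 2: "t\<^sup>2 * (\<Prod>k=1..Suc m. (s k)\<^sup>2) = (t * s (Suc m))\<^sup>2 * (\<Prod>k=1..m. (s k)\<^sup>2)"
    by (simp add: power_mult_distrib mult_ac)
  have split: "(\<Prod>k=1..Suc m. F k) = (\<Prod>k=1..m. F k) * F (Suc m)" for F :: "nat \<Rightarrow> complex" by simp
  have last: "(\<Prod>l=Suc m + 1..Suc m. (s l)\<^sup>2) = 1" "(\<Prod>l=Suc m..Suc m. (s l)\<^sup>2) = (s (Suc m))\<^sup>2" by simp_all
  have comm: "(s (Suc m))\<^sup>2 * t\<^sup>2 * u (Suc m) = t\<^sup>2 * (s (Suc m))\<^sup>2 * u (Suc m)" by (simp add: mult_ac)
  show ?thesis unfolding bailey_kernel_def 2 unfolding split 1 last mult_1_left comm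
    by (simp only: mult.assoc Suc_eq_plus1)
qed

lemma bailey_constant_Suc:
  "bailey_constant (Suc m) t = kappa q p * ell_gamma q p (t\<^sup>2 * (s (Suc m))\<^sup>2) / (ell_gamma q p (t\<^sup>2) * ell_gamma q p ((s (Suc m))\<^sup>2))
     * bailey_constant m (t * s (Suc m))"
proof -
  have 1: "(\<Prod>k=1..m. ell_gamma q p ((\<Prod>l=k..Suc m. (s l)\<^sup>2) * t\<^sup>2)
          / (ell_gamma q p ((s k)\<^sup>2) * ell_gamma q p ((\<Prod>l=k+1..Suc m. (s l)\<^sup>2) * t\<^sup>2)))
     = (\<Prod>k=1..m. ell_gamma q p ((\<Prod>l=k..m. (s l)\<^sup>2) * (t * s (Suc m))\<^sup>2)
          / (ell_gamma q p ((s k)\<^sup>2) * ell_gamma q p ((\<Prod>l=k+1..m. (s l)\<^sup>2) * (t * s (Suc m))\<^sup>2)))"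
    by (intro prod.cong refl) (simp add: power_mult_distrib mult_ac)
  have 2: "t\<^sup>2 * (\<Prod>k=1..Suc m. (s k)\<^sup>2) = (t * s (Suc m))\<^sup>2 * (\<Prod>k=1..m. (s k)\<^sup>2)"
    by (simp add: power_mult_distrib mult_ac)
  have split: "(\<Prod>k=1..Suc m. F k) = (\<Prod>k=1..m. F k) * F (Suc m)" for F :: "nat \<Rightarrow> complex" by simp
  have last: "(\<Prod>l=Suc m + 1..Suc m. (s l)\<^sup>2) = 1" "(\<Prod>l=Suc m..Suc m. (s l)\<^sup>2) = (s (Suc m))\<^sup>2" by simp_all
  have comm: "(s (Suc m))\<^sup>2 * t\<^sup>2 = t\<^sup>2 * (s (Suc m))\<^sup>2" by (simp add: mult_ac)
  show ?thesis unfolding bailey_constant_def 2 unfolding split 1 last mult_1_left comm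
    by (simp only: add_Suc power_Suc divide_inverse inverse_mult_distrib mult_ac)
qed

lemma bailey_domain_Suc:
  assumes "bailey_domain (Suc m) t"
  shows "bailey_domain m (t * s (Suc m))" "norm t < 1" "norm (s (Suc m)) < 1" "norm (u (Suc m)) < 1"
    "norm (p * q) < norm (t\<^sup>2 * (s (Suc m))\<^sup>2 * u (Suc m))"
proof -
  show "norm t < 1" "norm (s (Suc m)) < 1" "norm (u (Suc m)) < 1"
    using assms by (auto simp: bailey_domain_def)
  moreover have "norm (p * q) < norm (t\<^sup>2 * (\<Prod>l=Suc m..Suc m. (s l)\<^sup>2) * u (Suc m))"
    using assms unfolding bailey_domain_def by (metis atLeastAtMost_iff le_refl One_nat_def Suc_le_mono le0)
  thus "norm (p * q) < norm (t\<^sup>2 * (s (Suc m))\<^sup>2 * u (Suc m))" by simp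
  moreover have "norm (p * q) < norm ((t * s (Suc m))\<^sup>2 * (\<Prod>l=k..m. (s l)\<^sup>2) * u k)" if "k \<in> {1..m}" for k
  proof -
    have "norm (p * q) < norm (t\<^sup>2 * (\<Prod>l=k..Suc m. (s l)\<^sup>2) * u k)"
      using assms that by (auto simp: bailey_domain_def)
    thus ?thesis using that by (simp add: power_mult_distrib mult_ac)
  qed
  moreover have "norm (p * q) < norm ((t * s (Suc m))\<^sup>2 * (\<Prod>k=1..m. (s k)\<^sup>2) * \<tau> 0 * \<tau> 1 * \<tau> 2)"
    using assms by (simp add: bailey_domain_def power_mult_distrib mult_ac)
  ultimately show "bailey_domain m (t * s (Suc m))"
    using assms norm_mult_less_1[of t "s (Suc m)"] unfolding bailey_domain_def by auto
qed

lemma norm_mult_le_left: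
  fixes a b :: complex
  shows "norm b \<le> 1 \<Longrightarrow> norm (a * b) \<le> norm a"
  by (simp add: norm_mult mult_left_le)

text \<open>Induction on m for all t, since the step passes to t s_(m+1). The new quotient in x
  times \<open>gamma_pm2 q p (t * S) x\<close> at y_(m+1) is what the star-triangle relation yields
  from an integral over a new variable, coupled to x through t and to y_(m+1) through S.\<close>

lemma bailey_integral_representation:
  assumes "bailey_domain m t" "norm x = 1"
  shows "bailey_function m t x = bailey_constant m t * torus_integral (m + 1) (\<lambda>y. gamma_pm2 q p t x (y (m + 1)) * bailey_kernel m t y)"
  using assms
proof (induction m arbitrary: t)
  case 0
  have P: "(\<Prod>r=0..2::nat. f r) = f 0 * f 1 * f 2" for f :: "nat \<Rightarrow> complex"
    by (simp add: numeral_2_eq_2 mult_ac)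
  have S: "{(r, j). r < j \<and> j \<le> (2::nat)} = {(0, 1), (0, 2), (1, 2)}" by auto
  have "gamma_pm q p (t * \<tau> 0) x * gamma_pm q p (t * \<tau> 1) x * gamma_pm q p (t * \<tau> 2) x / gamma_pm q p (t * \<tau> 0 * \<tau> 1 * \<tau> 2) x
    = bailey_constant 0 t * (2 * of_real pi * \<i> * circ (\<lambda>y. gamma_pm2 q p t x y *
        (gamma_pm q p (\<tau> 0) y * gamma_pm q p (\<tau> 1) y * gamma_pm q p (\<tau> 2) y)
        / (gamma_sq q p y * gamma_pm q p (t\<^sup>2 * \<tau> 0 * \<tau> 1 * \<tau> 2) y)))"
    using elliptic_beta_transform[OF q p, of t "\<tau> 0" "\<tau> 1" "\<tau> 2" x] 0
    by (simp add: bailey_domain_def bailey_constant_def S mult_ac)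
  thus ?case
    by (simp add: bailey_function_def bailey_kernel_def P torus_integral_Suc_circ)
next
  case (Suc m)
  define S U where "S = s (Suc m)" and "U = u (Suc m)"
  note D = bailey_domain_Suc[OF Suc.prems(1), folded S_def U_def]
  let ?P = "gamma_pm q p"
  have sq: "norm (t\<^sup>2) < 1" "norm (S\<^sup>2) < 1" using D by (auto simp: norm_power power_less_one_iff)
  have SU: "norm (p * q) < norm (S * U)" "norm (S * U) < 1" "norm (p * q) < norm (t\<^sup>2 * S * U)" "norm (t\<^sup>2 * S * U) < 1"
  proof -
    show SU1: "norm (S * U) < 1" using D by (intro norm_mult_less_1)
    have "norm (t\<^sup>2 * S\<^sup>2 * U) = norm (t\<^sup>2 * S * U * S)" by (simp add: power2_eq_square mult_ac)
    also have "\<dots> \<le> norm (t\<^sup>2 * S * U)" using D by (intro norm_mult_le_left) simp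
    finally show 1: "norm (p * q) < norm (t\<^sup>2 * S * U)" using D(5) by simp
    have 2: "norm (t\<^sup>2 * S * U) \<le> norm (S * U)"
      using norm_mult_le_left[of "t\<^sup>2" "S * U"] sq by (simp add: mult_ac)
    from 1 2 show "norm (p * q) < norm (S * U)" by simp
    from 2 SU1 show "norm (t\<^sup>2 * S * U) < 1" by simp
  qed
  define r where "r = ?P (t * U) x / ?P (t * S\<^sup>2 * U) x"
  define c where "c = kappa q p * ell_gamma q p (t\<^sup>2 * S\<^sup>2) / (ell_gamma q p (t\<^sup>2) * ell_gamma q p (S\<^sup>2))"
  \<comment> \<open>The factor by which the kernel grows. The quotient at y_(m+1) in the
    star-triangle relation is free of x and is moved into it.\<close>
  define L where "L = (\<lambda>y z. ?P U z * ?P (t\<^sup>2 * S * U) (y (Suc m)) * gamma_pm2 q p S z (y (Suc m))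
          / (gamma_sq q p z * ?P (t\<^sup>2 * S\<^sup>2 * U) z * ?P (S * U) (y (Suc m))))"
  have step: "r * gamma_pm2 q p (t * S) x (y (Suc m)) = c * (2 * of_real pi * \<i> * circ (\<lambda>z. gamma_pm2 q p t x z * L y z))"
    if y: "norm (y (Suc m)) = 1" for y :: "nat \<Rightarrow> complex"
  proof -
    let ?v = "y (Suc m)"
    have nz: "?P (S * U) ?v \<noteq> 0" "?P (t\<^sup>2 * S * U) ?v \<noteq> 0"
      using gamma_pm_nonzero[OF q p SU(1,2) y] gamma_pm_nonzero[OF q p SU(3,4) y] by auto
    have "circ (\<lambda>z. gamma_pm2 q p t x z * L y z) = circ (\<lambda>z. (?P (t\<^sup>2 * S * U) ?v / ?P (S * U) ?v)
        * (gamma_pm2 q p t x z * gamma_pm2 q p S ?v z * ?P U z / (gamma_sq q p z * ?P (t\<^sup>2 * S\<^sup>2 * U) z)))"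
      by (rule circ_cong) (simp add: L_def gamma_pm2_commute[OF q p, of S] mult_ac)
    hence "c * (2 * of_real pi * \<i> * circ (\<lambda>z. gamma_pm2 q p t x z * L y z))
       = (?P (t\<^sup>2 * S * U) ?v / ?P (S * U) ?v) * (c * (2 * of_real pi * \<i> * circ (\<lambda>z.
           gamma_pm2 q p t x z * gamma_pm2 q p S ?v z * ?P U z / (gamma_sq q p z * ?P (t\<^sup>2 * S\<^sup>2 * U) z))))"
      unfolding circ_cmult by (simp only: mult_ac)
    also have "c * (2 * of_real pi * \<i> * circ (\<lambda>z.
           gamma_pm2 q p t x z * gamma_pm2 q p S ?v z * ?P U z / (gamma_sq q p z * ?P (t\<^sup>2 * S\<^sup>2 * U) z)))
       = gamma_pm2 q p (t * S) x ?v * r * (?P (S * U) ?v / ?P (t\<^sup>2 * S * U) ?v)"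
      unfolding c_def r_def
      by (rule star_triangle(1)[OF q p D(2,3,4) Suc.prems(2) y D(5), symmetric])
    finally show ?thesis using nz by simp
  qed
  have "bailey_function (Suc m) t x = r * (bailey_constant m (t * S) * torus_integral (m + 1) (\<lambda>y. gamma_pm2 q p (t * S) x (y (m + 1)) * bailey_kernel m (t * S) y))"
    by (simp only: bailey_function_Suc r_def S_def U_def Suc.IH[OF D(1)[unfolded S_def] Suc.prems(2)])
  also have "\<dots> = bailey_constant m (t * S) * torus_integral (Suc m) (\<lambda>y. (r * gamma_pm2 q p (t * S) x (y (Suc m))) * bailey_kernel m (t * S) y)"
    by (simp add: torus_integral_cmult[symmetric] mult_ac)
  also have "torus_integral (Suc m) (\<lambda>y. (r * gamma_pm2 q p (t * S) x (y (Suc m))) * bailey_kernel m (t * S) y)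
     = torus_integral (Suc m) (\<lambda>y. c * (2 * of_real pi * \<i> * circ (\<lambda>z. gamma_pm2 q p t x z * (bailey_kernel m (t * S) y * L y z))))"
  proof (rule torus_integral_cong)
    fix y :: "nat \<Rightarrow> complex" assume "\<And>i. 1 \<le> i \<Longrightarrow> i \<le> Suc m \<Longrightarrow> norm (y i) = 1"
    hence "norm (y (Suc m)) = 1" by simp
    note step[of y, OF this]
    moreover have "circ (\<lambda>z. gamma_pm2 q p t x z * (bailey_kernel m (t * S) y * L y z))
       = bailey_kernel m (t * S) y * circ (\<lambda>z. gamma_pm2 q p t x z * L y z)"
      unfolding circ_cmult[symmetric] by (simp only: mult_ac)
    ultimately show "r * gamma_pm2 q p (t * S) x (y (Suc m)) * bailey_kernel m (t * S) y
       = c * (2 * of_real pi * \<i> * circ (\<lambda>z. gamma_pm2 q p t x z * (bailey_kernel m (t * S) y * L y z)))"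
      by (simp only: mult_ac)
  qed
  also have "\<dots> = c * torus_integral (Suc (Suc m)) (\<lambda>y. gamma_pm2 q p t x (y (Suc (Suc m))) * bailey_kernel (Suc m) t y)"
  proof -
    \<comment> \<open>\<open>bailey_kernel m\<close> reads the coordinates 1 to m + 1 only, so it is
      unaffected by the new variable at index m + 2.\<close>
    have "bailey_kernel (Suc m) t (y(Suc (Suc m) := z)) = bailey_kernel m (t * S) y * L y z" for y z
    proof -
      have "bailey_kernel m (t * S) (y(Suc (Suc m) := z)) = bailey_kernel m (t * S) y"
        unfolding bailey_kernel_def by (intro arg_cong2[where f="(*)"] prod.cong refl) auto
      thus ?thesis unfolding bailey_kernel_Suc L_def S_def U_def by simp
    qed
    thus ?thesis unfolding torus_integral_Suc_circ[of "Suc m"] torus_integral_cmult by simp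
  qed
  also have "bailey_constant m (t * S) * (c * torus_integral (Suc (Suc m)) (\<lambda>y. gamma_pm2 q p t x (y (Suc (Suc m))) * bailey_kernel (Suc m) t y))
     = bailey_constant (Suc m) t * torus_integral (Suc m + 1) (\<lambda>y. gamma_pm2 q p t x (y (Suc m + 1)) * bailey_kernel (Suc m) t y)"
    unfolding bailey_constant_Suc c_def S_def by simp
  finally show ?case .
qed

lemma continuous_on_bailey_kernel:
  assumes "bailey_domain m t"
  shows "continuous_on (torus (m + 1)) (bailey_kernel m t)"
  using assms
proof (induction m arbitrary: t)
  case 0
  define A where "A = t\<^sup>2 * \<tau> 0 * \<tau> 1 * \<tau> 2"
  have D: "norm t < 1" "norm (\<tau> 0) < 1" "norm (\<tau> 1) < 1" "norm (\<tau> 2) < 1" "norm (p * q) < norm A"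
    using 0 by (auto simp: bailey_domain_def A_def)
  have ne: "t \<noteq> 0" "\<tau> 0 \<noteq> 0" "\<tau> 1 \<noteq> 0" "\<tau> 2 \<noteq> 0" "A \<noteq> 0" using D(5) by (auto simp: A_def)
  have A1: "norm A < 1"
    unfolding A_def using D by (intro norm_mult_less_1) (auto simp: norm_power power_less_one_iff)
  have T: "norm (y 1) = 1" if "y \<in> torus (0 + 1)" for y using that by (simp add: torus_def)
  have c1: "continuous_on (torus (0 + 1)) (\<lambda>y. y (1::nat))"
    by (rule continuous_on_product_then_coordinatewise) (rule continuous_on_id)
  have P: "continuous_on (torus (0 + 1)) (\<lambda>y. gamma_pm q p (\<tau> r) (y 1))" if "r \<in> {0, 1, 2}" for r
    using that ne D T by (intro continuous_on_gamma_pm[OF q p] continuous_on_const c1) auto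
  \<comment> \<open>The reciprocal of \<open>gamma_sq\<close> is kept as a factor of its own:
    \<open>gamma_sq\<close> is 0 at 1 and -1 by convention, so continuity of quotients does not
    apply to it, but its reciprocal is a product of theta functions.\<close>
  have "continuous_on (torus (0 + 1)) (\<lambda>y. (\<Prod>r=0..2. gamma_pm q p (\<tau> r) (y 1)) * (1 / gamma_sq q p (y 1)) / gamma_pm q p A (y 1))"
    using ne A1 T
    by (intro continuous_on_divide continuous_on_mult continuous_on_prod P continuous_on_inverse_gamma_sq[OF q p]
         continuous_on_gamma_pm[OF q p] continuous_on_const c1 ballI gamma_pm_nonzero[OF q p D(5) A1]) auto
  thus ?case by (simp add: bailey_kernel_def A_def mult_ac cong: continuous_on_cong)
next
  case (Suc m)
  define S U where "S = s (Suc m)" and "U = u (Suc m)"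
  note D = bailey_domain_Suc[OF Suc.prems(1), folded S_def U_def]
  let ?T = "torus (Suc m + 1)"
  have ne: "t \<noteq> 0" "S \<noteq> 0" "U \<noteq> 0" using D(5) by auto
  have sq: "norm (t\<^sup>2) < 1" "norm (S\<^sup>2) < 1" using D by (auto simp: norm_power power_less_one_iff)
  have lt: "norm (S * U) < 1" "norm (t\<^sup>2 * S * U) < 1" "norm (t\<^sup>2 * S\<^sup>2 * U) < 1"
    using D sq by (intro norm_mult_less_1; simp)+
  have SU: "norm (p * q) < norm (S * U)"
  proof -
    have "norm (t\<^sup>2 * S\<^sup>2 * U) = norm (S * U * (t\<^sup>2 * S))" by (simp add: power2_eq_square mult_ac)
    also have "\<dots> \<le> norm (S * U)" using norm_mult_less_1[OF sq(1) D(3)] by (intro norm_mult_le_left) simp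
    finally show ?thesis using D(5) by simp
  qed
  have T: "norm (y (Suc m)) = 1" "norm (y (Suc (Suc m))) = 1" "y \<in> torus (m + 1)" if "y \<in> ?T" for y
    using that by (auto simp: torus_def)
  have c: "continuous_on ?T (\<lambda>y. y (i::nat))" for i
    by (rule continuous_on_product_then_coordinatewise) (rule continuous_on_id)
  have K: "continuous_on ?T (bailey_kernel m (t * S))"
    by (rule continuous_on_subset[OF Suc.IH[OF D(1)]]) (use T in auto)
  have "continuous_on ?T (\<lambda>y. bailey_kernel m (t * S) y
     * (gamma_pm q p U (y (Suc (Suc m))) * gamma_pm q p (t\<^sup>2 * S * U) (y (Suc m)) * gamma_pm2 q p S (y (Suc (Suc m))) (y (Suc m))
        * (1 / gamma_sq q p (y (Suc (Suc m)))) / gamma_pm q p (t\<^sup>2 * S\<^sup>2 * U) (y (Suc (Suc m))) / gamma_pm q p (S * U) (y (Suc m))))"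
    using ne lt T D(3,4)
    by (intro continuous_on_divide continuous_on_mult K continuous_on_inverse_gamma_sq[OF q p]
         continuous_on_gamma_pm[OF q p] continuous_on_gamma_pm2[OF q p] continuous_on_const c ballI
         gamma_pm_nonzero[OF q p D(5) lt(3)] gamma_pm_nonzero[OF q p SU lt(1)]) auto
  thus ?case unfolding bailey_kernel_Suc S_def U_def by (simp add: mult_ac cong: continuous_on_cong)
qed

text \<open>S and U stand for s_(m+1) and u_(m+1). Once the order of integration is exchanged, x
  occurs in an elliptic beta integral with parameters S w, S / w, t y_(m+1), t / y_(m+1) and
  U.\<close>

theorem bailey_chain:
  assumes dom: "bailey_domain m t" and S: "norm S < 1" and U: "norm U < 1"
    and A: "norm (p * q) < norm (t\<^sup>2 * S\<^sup>2 * U)" and w: "norm w = 1"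
  shows "2 * of_real pi * \<i> * circ (\<lambda>x. gamma_pm2 q p S w x * gamma_pm q p U x
            / (gamma_sq q p x * gamma_pm q p (t\<^sup>2 * S\<^sup>2 * U) x) * bailey_function m t x)
    = bailey_constant m t * (ell_gamma q p (S\<^sup>2) * ell_gamma q p (t\<^sup>2) / (kappa q p * ell_gamma q p (t\<^sup>2 * S\<^sup>2)))
      * (gamma_pm q p (S * U) w / gamma_pm q p (t\<^sup>2 * S * U) w)
      * torus_integral (m + 1) (\<lambda>y. gamma_pm2 q p (t * S) w (y (m + 1)) * gamma_pm q p (t * U) (y (m + 1))
           / gamma_pm q p (t * S\<^sup>2 * U) (y (m + 1)) * bailey_kernel m t y)"
proof -
  let ?P = "gamma_pm q p" and ?P2 = "gamma_pm2 q p"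
  define V where "V = (\<lambda>x. ?P2 S w x * ?P U x / (gamma_sq q p x * ?P (t\<^sup>2 * S\<^sup>2 * U) x))"
  define D where "D = bailey_constant m t"
  define E where "E = ell_gamma q p (S\<^sup>2) * ell_gamma q p (t\<^sup>2) / (kappa q p * ell_gamma q p (t\<^sup>2 * S\<^sup>2))"
  have t: "norm t < 1" using dom by (simp add: bailey_domain_def)
  have ne: "t \<noteq> 0" "S \<noteq> 0" "U \<noteq> 0" using A by auto
  have lt: "norm (t\<^sup>2 * S\<^sup>2 * U) < 1"
    using t S U by (intro norm_mult_less_1) (auto simp: norm_power power_less_one_iff)
  have contV: "continuous_on (sphere 0 1) V"
  proof -
    have "continuous_on (sphere 0 1) (\<lambda>x. ?P2 S w x * ?P U x * (1 / gamma_sq q p x) / ?P (t\<^sup>2 * S\<^sup>2 * U) x)"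
      using ne lt S U w
      by (intro continuous_on_divide continuous_on_mult continuous_on_inverse_gamma_sq[OF q p]
         continuous_on_gamma_pm[OF q p] continuous_on_gamma_pm2[OF q p] continuous_on_const continuous_on_id ballI
         gamma_pm_nonzero[OF q p A lt]) auto
    thus ?thesis by (simp add: V_def)
  qed
  define G where "G = (\<lambda>x y. V x * ?P2 t x (y (m + 1)) * bailey_kernel m t y)"
  have contG: "continuous_on (sphere 0 1 \<times> torus (m + 1)) (\<lambda>(x, y). G x y)"
  proof -
    have c: "continuous_on (sphere (0::complex) 1 \<times> torus (m + 1)) (\<lambda>a. snd a (m + 1))"
      by (rule continuous_on_product_then_coordinatewise) (intro continuous_intros)
    have 1: "continuous_on (sphere 0 1 \<times> torus (m + 1)) (\<lambda>a. V (fst a))"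
      by (rule continuous_on_compose2[OF contV]) (auto intro!: continuous_intros)
    have 2: "continuous_on (sphere (0::complex) 1 \<times> torus (m + 1)) (\<lambda>a. bailey_kernel m t (snd a))"
      by (rule continuous_on_compose2[OF continuous_on_bailey_kernel[OF dom]]) (auto intro!: continuous_on_snd continuous_on_id)
    have 3: "continuous_on (sphere 0 1 \<times> torus (m + 1)) (\<lambda>a. ?P2 t (fst a) (snd a (m + 1)))"
      using c ne t by (intro continuous_on_gamma_pm2[OF q p] continuous_on_fst continuous_on_id) (auto simp: torus_def)
    from continuous_on_mult[OF continuous_on_mult[OF 1 3] 2] show ?thesis
      by (simp add: G_def case_prod_unfold)
  qed
  have inner: "2 * of_real pi * \<i> * circ (\<lambda>x. G x y) = E * (?P (S * U) w / ?P (t\<^sup>2 * S * U) w)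
      * (?P2 (t * S) w (y (m + 1)) * ?P (t * U) (y (m + 1)) / ?P (t * S\<^sup>2 * U) (y (m + 1)) * bailey_kernel m t y)"
    if y: "norm (y (m + 1)) = 1" for y :: "nat \<Rightarrow> complex"
  proof -
    let ?v = "y (m + 1)"
    have st: "S\<^sup>2 * t\<^sup>2 = t\<^sup>2 * S\<^sup>2" "S * t = t * S" "S * t\<^sup>2 * U = t\<^sup>2 * S * U" "S\<^sup>2 * t * U = t * S\<^sup>2 * U"
      by (simp_all only: mult_ac)
    have "circ (\<lambda>x. G x y) = circ (\<lambda>x. bailey_kernel m t y *
        (?P2 S w x * ?P2 t ?v x * ?P U x / (gamma_sq q p x * ?P (t\<^sup>2 * S\<^sup>2 * U) x)))"
      by (rule circ_cong, simp only: G_def V_def gamma_pm2_commute[OF q p, of t _ ?v]) (simp add: mult_ac)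
    hence "2 * of_real pi * \<i> * circ (\<lambda>x. G x y) = bailey_kernel m t y * (2 * of_real pi * \<i> * circ (\<lambda>x.
        ?P2 S w x * ?P2 t ?v x * ?P U x / (gamma_sq q p x * ?P (t\<^sup>2 * S\<^sup>2 * U) x)))"
      unfolding circ_cmult by (simp only: mult_ac)
    also have "2 * of_real pi * \<i> * circ (\<lambda>x. ?P2 S w x * ?P2 t ?v x * ?P U x / (gamma_sq q p x * ?P (t\<^sup>2 * S\<^sup>2 * U) x))
      = E * (?P2 (t * S) w ?v * (?P (S * U) w / ?P (t\<^sup>2 * S * U) w) * (?P (t * U) ?v / ?P (t * S\<^sup>2 * U) ?v))"
      unfolding E_def
      by (rule star_triangle(2)[OF q p S t U w y, unfolded st, OF A])
    finally show ?thesis by simp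
  qed
  have "2 * of_real pi * \<i> * circ (\<lambda>x. V x * bailey_function m t x)
      = 2 * of_real pi * \<i> * circ (\<lambda>x. D * torus_integral (m + 1) (G x))"
  proof (rule arg_cong[where f="\<lambda>c. 2 * of_real pi * \<i> * c"], rule circ_cong)
    fix x :: complex assume x: "norm x = 1"
    have "torus_integral (m + 1) (G x) = V x * torus_integral (m + 1) (\<lambda>y. ?P2 t x (y (m + 1)) * bailey_kernel m t y)"
      unfolding torus_integral_cmult[symmetric] G_def by (simp only: mult.assoc)
    thus "V x * bailey_function m t x = D * torus_integral (m + 1) (G x)"
      unfolding bailey_integral_representation[OF dom x] D_def by (simp only: mult_ac)
  qed
  also have "\<dots> = D * torus_integral (m + 1) (\<lambda>y. 2 * of_real pi * \<i> * circ (\<lambda>x. G x y))"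
    unfolding circ_cmult torus_integral_cmult circ_torus_integral_swap[OF contG] by (simp only: mult_ac)
  also have "torus_integral (m + 1) (\<lambda>y. 2 * of_real pi * \<i> * circ (\<lambda>x. G x y))
     = torus_integral (m + 1) (\<lambda>y. E * (?P (S * U) w / ?P (t\<^sup>2 * S * U) w)
      * (?P2 (t * S) w (y (m + 1)) * ?P (t * U) (y (m + 1)) / ?P (t * S\<^sup>2 * U) (y (m + 1)) * bailey_kernel m t y))"
    by (rule torus_integral_cong) (use inner in auto)
  finally show ?thesis unfolding torus_integral_cmult V_def D_def E_def by (simp only: mult_ac)
qed

end

theorem mainTheorem4:
  fixes q p t w :: complex
    and \<tau> s u :: "nat \<Rightarrow> complex"
    and m :: nat
  assumes "norm q < 1" and "norm p < 1"
    and "m \<ge> 1"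
    and "norm t < 1"
    and "\<forall>r\<in>{0..2}. norm (\<tau> r) < 1"
    and "\<forall>k\<in>{1..m+1}. norm (s k) < 1"
    and "\<forall>k\<in>{1..m+1}. norm (u k) < 1"
    and "norm (p * q) < norm (t^2 * (\<Prod>k=1..m. (s k)^2) * \<tau> 0 * \<tau> 1 * \<tau> 2)"
    and "\<forall>k\<in>{1..m}. norm (p * q) < norm (t^2 * (\<Prod>l=k..m. (s l)^2) * u k)"
    and "norm (p * q) < norm (t^2 * (s (m+1))^2 * u (m+1))"
    and "w \<in> sphere 0 1"
  shows
    "contour_integral (circlepath 0 1) (\<lambda>x.
        ell_gammas q p (pm2 (s (m+1)) w x @ pm (u (m+1)) x)
        / ell_gammas q p ([x^2, inverse (x^2)] @ pm (t^2 * (s (m+1))^2 * u (m+1)) x)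
        * (\<Prod>k=1..m.
             ell_gammas q p (pm (t * (\<Prod>l=k+1..m. s l) * u k) x)
             / ell_gammas q p (pm (t * (\<Prod>l=k+1..m. s l) * (s k)^2 * u k) x))
        * ((\<Prod>r=0..2. ell_gammas q p (pm (t * (\<Prod>k=1..m. s k) * \<tau> r) x))
           / ell_gammas q p (pm (t * (\<Prod>k=1..m. s k) * \<tau> 0 * \<tau> 1 * \<tau> 2) x))
        / x)
     = (kappa q p)^m
        * ell_gammas q p ([(s (m+1))^2, t^2] @ pm (s (m+1) * u (m+1)) w)
        / ell_gammas q p
            ([t^2 * (s (m+1))^2, t^2 * (\<Prod>k=1..m. (s k)^2)]
             @ pm (t^2 * s (m+1) * u (m+1)) w)
        * (\<Prod>k=1..m.
             ell_gammas q p [(\<Prod>l=k..m. (s l)^2) * t^2]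
             / ell_gammas q p [(s k)^2, (\<Prod>l=k+1..m. (s l)^2) * t^2])
        * (\<Prod>(r, j)\<in>{(r, j). r < j \<and> j \<le> 2}.
             ell_gammas q p [t^2 * (\<Prod>k=1..m. (s k)^2) * \<tau> r * \<tau> j]
             / ell_gammas q p [\<tau> r * \<tau> j])
        * torus_integral (m+1) (\<lambda>x.
            ell_gammas q p (pm2 (t * s (m+1)) w (x (m+1)) @ pm (t * u (m+1)) (x (m+1)))
            * (\<Prod>r=0..2. ell_gammas q p (pm (\<tau> r) (x 1)))
            / ell_gammas q p
                (pm (t * (s (m+1))^2 * u (m+1)) (x (m+1))
                 @ [(x 1)^2, inverse ((x 1)^2)]
                 @ pm (t^2 * (\<Prod>k=1..m. (s k)^2) * \<tau> 0 * \<tau> 1 * \<tau> 2) (x 1))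
            * (\<Prod>k=1..m.
                 ell_gammas q p
                   (pm (u k) (x (k+1))
                    @ pm ((\<Prod>l=k+1..m. (s l)^2) * t^2 * s k * u k) (x k)
                    @ pm2 (s k) (x (k+1)) (x k))
                 / ell_gammas q p
                     ([(x (k+1))^2, inverse ((x (k+1))^2)]
                      @ pm ((\<Prod>l=k..m. (s l)^2) * t^2 * u k) (x (k+1))
                      @ pm (s k * u k) (x k))))"
proof -
  note qp = assms(1,2)
  have w: "norm w = 1" using assms(11) by simp
  have dom: "bailey_domain q p \<tau> s u m t"
    unfolding bailey_domain_def[OF qp] using assms by auto
  have su: "norm (s (m+1)) < 1" "norm (u (m+1)) < 1" using assms by auto
  define V where "V = (\<lambda>x. gamma_pm2 q p (s (m+1)) w x * gamma_pm q p (u (m+1)) x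
      / (gamma_sq q p x * gamma_pm q p (t\<^sup>2 * (s (m+1))\<^sup>2 * u (m+1)) x))"
  define T where "T = torus_integral (m + 1) (\<lambda>y. gamma_pm2 q p (t * s (m+1)) w (y (m+1)) * gamma_pm q p (t * u (m+1)) (y (m+1))
           / gamma_pm q p (t * (s (m+1))\<^sup>2 * u (m+1)) (y (m+1)) * bailey_kernel q p \<tau> s u m t y)"
  define G where "G = ell_gamma q p"
  define W where "W = gamma_pm q p (s (m+1) * u (m+1)) w / gamma_pm q p (t\<^sup>2 * s (m+1) * u (m+1)) w"
  define X where "X = (\<Prod>(r, j)\<in>{(r, j). r < j \<and> j \<le> 2}. G (t\<^sup>2 * (\<Prod>k=1..m. (s k)\<^sup>2) * \<tau> r * \<tau> j) / G (\<tau> r * \<tau> j))"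
  define Z where "Z = (\<Prod>k=1..m. G ((\<Prod>l=k..m. (s l)\<^sup>2) * t\<^sup>2) / (G ((s k)\<^sup>2) * G ((\<Prod>l=k+1..m. (s l)\<^sup>2) * t\<^sup>2)))"
  have chain: "contour_integral (circlepath 0 1) (\<lambda>x. V x * bailey_function q p \<tau> s u m t x / x)
      = bailey_constant q p \<tau> s m t * (G ((s (m+1))\<^sup>2) * G (t\<^sup>2) / (kappa q p * G (t\<^sup>2 * (s (m+1))\<^sup>2))) * W * T"
    unfolding contour_integral_eq_circ V_def T_def W_def G_def
    by (rule bailey_chain[OF qp dom su assms(10) w])
  have "bailey_constant q p \<tau> s m t = kappa q p ^ (m + 1) * X / G (t\<^sup>2 * (\<Prod>k=1..m. (s k)\<^sup>2)) * Z"
    unfolding bailey_constant_def[OF qp] X_def Z_def G_def ..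
  \<comment> \<open>The evaluation of the integral over x divides by one \<open>kappa q p\<close>,
    which lowers the exponent from m + 1 to m.\<close>
  hence const: "bailey_constant q p \<tau> s m t * (G ((s (m+1))\<^sup>2) * G (t\<^sup>2) / (kappa q p * G (t\<^sup>2 * (s (m+1))\<^sup>2))) * W * T
      = kappa q p ^ m * (G ((s (m+1))\<^sup>2) * (G (t\<^sup>2) * 1) * gamma_pm q p (s (m+1) * u (m+1)) w)
        / (G (t\<^sup>2 * (s (m+1))\<^sup>2) * (G (t\<^sup>2 * (\<Prod>k=1..m. (s k)\<^sup>2)) * 1) * gamma_pm q p (t\<^sup>2 * s (m+1) * u (m+1)) w)
        * Z * X * T"
    using kappa_nonzero[OF qp] by (simp add: W_def mult_ac)
  have torus: "torus_integral (m+1) (\<lambda>x.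
            gamma_pm2 q p (t * s (m+1)) w (x (m+1)) * gamma_pm q p (t * u (m+1)) (x (m+1))
            * (\<Prod>r=0..2. gamma_pm q p (\<tau> r) (x 1))
            / (gamma_pm q p (t * (s (m+1))\<^sup>2 * u (m+1)) (x (m+1))
               * (gamma_sq q p (x 1) * gamma_pm q p (t\<^sup>2 * (\<Prod>k=1..m. (s k)\<^sup>2) * \<tau> 0 * \<tau> 1 * \<tau> 2) (x 1)))
            * (\<Prod>k=1..m.
                 gamma_pm q p (u k) (x (k+1))
                    * (gamma_pm q p ((\<Prod>l=k+1..m. (s l)\<^sup>2) * t\<^sup>2 * s k * u k) (x k)
                       * gamma_pm2 q p (s k) (x (k+1)) (x k))
                 / (gamma_sq q p (x (k+1))
                      * (gamma_pm q p ((\<Prod>l=k..m. (s l)\<^sup>2) * t\<^sup>2 * u k) (x (k+1))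
                         * gamma_pm q p (s k * u k) (x k))))) = T"
    unfolding T_def bailey_kernel_def[OF qp]
    by (simp only: divide_inverse inverse_mult_distrib mult_ac)
  show ?thesis
    \<comment> \<open>Blocks with sign pairs are recognised before lists are taken apart entry by
      entry; the opposite order would dissolve the blocks.\<close>
    unfolding ell_gammas_simps(3-6)[OF qp] unfolding ell_gammas_simps(1,2)[OF qp] mult_1_right torus
    using chain[unfolded const]
    by (simp add: V_def bailey_function_def[OF qp] X_def Z_def G_def mult.assoc)
qed

end
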